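(* Let $\alpha$ be an ordinal and let $(G_j)_{j\le\alpha}$ be an iterated rational extension. \begin{enumerate} \item The embedding $G_0\to G_\alpha$ is isometric for $\operatorname{scl}$. \item Suppose that the iterated rational extension is malnormal and that $\operatorname{scl}_{G_0}(g)>0$ for all $e\neq g\in G_0$. Then $\operatorname{scl}_{G_\alpha}(g)>0$ for all $e\neq g\in G_\alpha$. \end{enumerate}
   Context: Given a subgroup $A$ of $\mathbb{Q}$, a group $G$ and a subgroup $Z<G$ isomorphic to a subgroup of $A$, the amalgamated product $G*_ZA$ is a rational extension of $G$; it is malnormal if $Z$ is malnormal in $G$ (i.e. $Z\cap gZg^{-1}=\{e\}$ for all $g\in G\setminus Z$). An iterated rational extension is a family of groups $(G_j)_{j\le\alpha}$ indexed by ordinals, with $G_j\le G_{j'}$ for $j\le j'$, such that each $G_{j+1}$ is a rational extension of $G_j$ (for some subgroup $A$ of $\mathbb{Q}$ depending on $j$), and for each limit ordinal $\beta\le\alpha$, $G_\beta$ is the directed union of $(G_j)_{j<\beta}$. It is an iterated malnormal rational extension if all the rational extensions involved are malnormal. For elements: $\operatorname{scl}_G(g)=\lim_n\operatorname{cl}_G(g^n)/n$ for $g\in[G,G]$ ($\operatorname{cl}_G$ = commutator length), $\operatorname{scl}_G(g)=\operatorname{scl}_G(g^k)/k$ if $g^k\in[G,G]$, and $\infty$ otherwise. On chains: $\operatorname{C}_1(G)$ is the real vector space with basis $G$; for an integral chain $c=\sum_ig_i$, $\operatorname{cl}_G(c)$ is the minimal number of commutators whose product equals some $\prod_it_ig_it_i^{-1}$,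 and $\operatorname{scl}_G(c)=\lim_n\operatorname{cl}_G(\sum_ig_i^n)/n$, extended by homogeneity and continuity to real chains (value $\infty$ off boundaries). $\operatorname{C}_1^H(G)$ is $\operatorname{C}_1(G)$ modulo the span of all $g^n-ng$ and $hgh^{-1}-g$. A homomorphism $G_1\to G_2$ is isometric for $\operatorname{scl}$ if the induced map $\operatorname{C}_1^H(G_1)\to\operatorname{C}_1^H(G_2)$ preserves $\operatorname{scl}$, including infinite values. *)

theory Defs
  imports "HOL-Analysis.Analysis" "HOL-Algebra.Algebra" "HOL-Library.Multiset"
begin

definition lprod :: "('g, 'b) monoid_scheme \<Rightarrow> 'g list \<Rightarrow> 'g" where
  "lprod G xs = foldr (\<lambda>x y. x \<otimes>\<^bsub>G\<^esub> y) xs \<one>\<^bsub>G\<^esub>"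

definition comm :: "('g, 'b) monoid_scheme \<Rightarrow> 'g \<Rightarrow> 'g \<Rightarrow> 'g" where
  "comm G a b = a \<otimes>\<^bsub>G\<^esub> b \<otimes>\<^bsub>G\<^esub> inv\<^bsub>G\<^esub> a \<otimes>\<^bsub>G\<^esub> inv\<^bsub>G\<^esub> b"

definition conj :: "('g, 'b) monoid_scheme \<Rightarrow> 'g \<Rightarrow> 'g \<Rightarrow> 'g" where
  "conj G t x = t \<otimes>\<^bsub>G\<^esub> x \<otimes>\<^bsub>G\<^esub> inv\<^bsub>G\<^esub> t"

definition cl_elem :: "('g, 'b) monoid_scheme \<Rightarrow> 'g \<Rightarrow> enat" where
  "cl_elem G g = (INF n \<in> {n. \<exists>as bs. length as = n \<and> length bs = n \<and>
       set as \<subseteq> carrier G \<and> set bs \<subseteq> carrier G \<and>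
       lprod G (map2 (comm G) as bs) = g}. enat n)"

definition scl_elem :: "('g, 'b) monoid_scheme \<Rightarrow> 'g \<Rightarrow> ereal" where
  "scl_elem G g =
    (if \<exists>k::nat. k > 0 \<and> cl_elem G (g [^]\<^bsub>G\<^esub> k) \<noteq> \<infinity>
     then (let k = (LEAST k::nat. k > 0 \<and> cl_elem G (g [^]\<^bsub>G\<^esub> k) \<noteq> \<infinity>) in
       ereal (lim (\<lambda>n. real (the_enat (cl_elem G (g [^]\<^bsub>G\<^esub> (k * Suc n)))) / real (Suc n))
              / real k))
     else \<infinity>)"

text \<open>An integral chain is represented by the multiset of its group elements (sum of the g_i).
  cl of such a chain: least number of commutators whose product equals some product
  of conjugates t_i g_i t_i^{-1}.\<close>
definition cl_chain :: "('g, 'b) monoid_scheme \<Rightarrow> 'g multiset \<Rightarrow> enat" where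
  "cl_chain G M = (INF n \<in> {n. \<exists>xs ts as bs. mset xs = M \<and> length ts = length xs \<and>
       length as = n \<and> length bs = n \<and>
       set ts \<subseteq> carrier G \<and> set as \<subseteq> carrier G \<and> set bs \<subseteq> carrier G \<and>
       lprod G (map2 (comm G) as bs) = lprod G (map2 (conj G) ts xs)}. enat n)"

definition pow_chain :: "('g, 'b) monoid_scheme \<Rightarrow> nat \<Rightarrow> 'g multiset \<Rightarrow> 'g multiset" where
  "pow_chain G n M = image_mset (\<lambda>g. g [^]\<^bsub>G\<^esub> n) M"

definition scl_int :: "('g, 'b) monoid_scheme \<Rightarrow> 'g multiset \<Rightarrow> real" where
  "scl_int G M = lim (\<lambda>n. real (the_enat (cl_chain G (pow_chain G (Suc n) M))) / real (Suc n))"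

definition supp :: "('g \<Rightarrow> real) \<Rightarrow> 'g set" where
  "supp c = {g. c g \<noteq> 0}"

definition is_chain :: "'g set \<Rightarrow> ('g \<Rightarrow> real) \<Rightarrow> bool" where
  "is_chain S c \<longleftrightarrow> finite (supp c) \<and> supp c \<subseteq> S"

text \<open>The multiset of an integer-valued chain sum n_g g, where n g with n<0 is read as
  |n| g^{-1} (equal in C_1^H).\<close>
definition int_chain_mset :: "('g, 'b) monoid_scheme \<Rightarrow> ('g \<Rightarrow> real) \<Rightarrow> 'g multiset" where
  "int_chain_mset G c = (\<Sum>g\<in>supp c. replicate_mset (nat \<lfloor>\<bar>c g\<bar>\<rfloor>)
                           (if c g > 0 then g else inv\<^bsub>G\<^esub> g))"

definition scl_rat :: "('g, 'b) monoid_scheme \<Rightarrow> ('g \<Rightarrow> real) \<Rightarrow> ereal" where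
  "scl_rat G c =
    (if \<exists>k::nat. k > 0 \<and> (\<forall>g. real k * c g \<in> \<int>) \<and>
                 cl_chain G (int_chain_mset G (\<lambda>g. real k * c g)) \<noteq> \<infinity>
     then (let k = (LEAST k::nat. k > 0 \<and> (\<forall>g. real k * c g \<in> \<int>) \<and>
                 cl_chain G (int_chain_mset G (\<lambda>g. real k * c g)) \<noteq> \<infinity>) in
       ereal (scl_int G (int_chain_mset G (\<lambda>g. real k * c g)) / real k))
     else \<infinity>)"

text \<open>scl on real chains: on rational chains as above; on other real chains, the extension
  by continuity, i.e. the limit of scl over rational boundaries (with support in that of c)
  converging to c; if no such rational boundaries approach c (c is not a real boundary)
  the value is infinity (Liminf over the empty filter is top).\<close>
definition scl :: "('g, 'b) monoid_scheme \<Rightarrow> ('g \<Rightarrow> real) \<Rightarrow> ereal" where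
  "scl G c =
    (if \<forall>g. c g \<in> \<rat> then scl_rat G c
     else Liminf (at c within {c'. (\<forall>g. c' g \<in> \<rat>) \<and> supp c' \<subseteq> supp c \<and> scl_rat G c' < \<infinity>})
                 (scl_rat G))"

definition rat_group :: "rat set \<Rightarrow> rat monoid" where
  "rat_group A = \<lparr>carrier = A, monoid.mult = (+), one = 0\<rparr>"

text \<open>K is the internal amalgamated product of its subgroups H and B over Z = H \<inter> B:
  K is generated by H \<union> B and every alternating product of elements of (H - Z) and (B - Z)
  of length at least 1 is nontrivial (normal form theorem).\<close>
definition internal_amalgam :: "('g, 'b) monoid_scheme \<Rightarrow> 'g set \<Rightarrow> 'g set \<Rightarrow> 'g set \<Rightarrow> bool" where
  "internal_amalgam U H B K \<longleftrightarrow>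
     subgroup H U \<and> subgroup B U \<and> subgroup K U \<and> H \<subseteq> K \<and> B \<subseteq> K \<and>
     K = generate U (H \<union> B) \<and>
     (\<forall>xs. xs \<noteq> [] \<longrightarrow> set xs \<subseteq> (H - (H \<inter> B)) \<union> (B - (H \<inter> B)) \<longrightarrow>
        (\<forall>i. Suc i < length xs \<longrightarrow>
            (xs ! i \<in> H \<and> xs ! Suc i \<in> B) \<or> (xs ! i \<in> B \<and> xs ! Suc i \<in> H)) \<longrightarrow>
        lprod U xs \<noteq> \<one>\<^bsub>U\<^esub>)"

definition malnormal :: "('g, 'b) monoid_scheme \<Rightarrow> 'g set \<Rightarrow> 'g set \<Rightarrow> bool" where
  "malnormal U Z H \<longleftrightarrow> (\<forall>g \<in> H - Z. Z \<inter> {g \<otimes>\<^bsub>U\<^esub> z \<otimes>\<^bsub>U\<^esub> inv\<^bsub>U\<^esub> g | z. z \<in> Z} = {\<one>\<^bsub>U\<^esub>})"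

definition rational_ext :: "bool \<Rightarrow> ('g, 'b) monoid_scheme \<Rightarrow> 'g set \<Rightarrow> 'g set \<Rightarrow> bool" where
  "rational_ext mal U H K \<longleftrightarrow>
     (\<exists>(A::rat set) B \<phi>. group (rat_group A) \<and> subgroup B U \<and>
        \<phi> \<in> iso (rat_group A) (U\<lparr>carrier := B\<rparr>) \<and>
        internal_amalgam U H B K \<and> (mal \<longrightarrow> malnormal U (H \<inter> B) H))"

text \<open>Ordinals \<le> alpha are modelled as the initial segment {..alpha} of a well-ordered type.\<close>
definition is_succ :: "'i::wellorder \<Rightarrow> 'i \<Rightarrow> bool" where
  "is_succ j j' \<longleftrightarrow> j < j' \<and> \<not> (\<exists>k. j < k \<and> k < j')"

definition is_limit :: "'i::wellorder \<Rightarrow> bool" where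
  "is_limit b \<longleftrightarrow> (\<exists>j. j < b) \<and> (\<forall>j. j < b \<longrightarrow> (\<exists>k. j < k \<and> k < b))"

definition ord_zero :: "'i::wellorder" where
  "ord_zero = (LEAST j. True)"

definition iterated_rational_ext ::
    "bool \<Rightarrow> ('g, 'b) monoid_scheme \<Rightarrow> ('i::wellorder \<Rightarrow> 'g set) \<Rightarrow> 'i \<Rightarrow> bool" where
  "iterated_rational_ext mal U G alpha \<longleftrightarrow>
     group U \<and>
     (\<forall>j \<le> alpha. subgroup (G j) U) \<and>
     (\<forall>j j'. j \<le> j' \<and> j' \<le> alpha \<longrightarrow> G j \<subseteq> G j') \<and>
     (\<forall>j j'. j' \<le> alpha \<and> is_succ j j' \<longrightarrow> rational_ext mal U (G j) (G j')) \<and>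
     (\<forall>b \<le> alpha. is_limit b \<longrightarrow> G b = (\<Union>j \<in> {j. j < b}. G j))"

end

(*
  Commutator length. Let K = H *_Z B with B a subgroup of the rationals and Z = H \<inter> B. Up to a directed
  union, B / Z is cyclic of some order k. If k is infinite, K retracts onto H; else K maps to the wreath
  product of H with the cyclic group of order k, with H going to the constants: an element x of H that
  is a product of M commutators in K becomes the constant function x. Multiplying the k coordinates
  turns this into an expression of x^k as a word in 4kM signed letters in which every letter occurs
  as often as its inverse, and such a word is a product of kM commutators of H. Hence
  cl_H(x^k) \<le> k cl_K(x), and the same for an iterated extension, by transfinite induction. Since
  h_1^n ... h_m^n is subadditive in n modulo m commutators, this gives equality of the scl of chains.
  Finiteness of scl is preserved because the abelianization of H embeds in that of K.

  Positivity. An element conjugate into H or B is handled by the previous step. Otherwise it is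
  conjugate to a cyclically reduced word of even length p, and one counts the windows of length
  2p + 1 of reduced words lying in the double coset Z w Z, where w is an initial window of the
  periodic word, minus those in Z w^-1 Z. This is a quasimorphism. It grows linearly on the powers of
  the given element because no window of the periodic word lies in Z w^-1 Z: otherwise the period
  would admit a reflection, and malnormality and torsion-freeness exclude its centre.
*)

theory Submission
  imports Defs
begin

section \<open>Products of commutators\<close>

text \<open>The transfer cannot give equality of commutator lengths. It controls only a power
  \<open>x^k\<close>, where k depends on \<open>x\<close> and on the chosen expression, because the
  orders of the cyclic quotients met inside \<open>B\<close> may be unbounded. This lack of
  uniformity is harmless: scl is homogeneous, so k cancels in the limit, and a statement about
  single elements composes and survives directed unions, which is what transfinite induction asks
  for. It leaves open, however, whether \<open>x\<close> itself lies in the derived subgroup, and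
  the least multiple in the definition of scl depends on exactly that; hence the separate argument
  with abelianizations. Chains bring unspecified conjugators and an unspecified order, but these
  cost a number of commutators bounded by the number of terms, whatever the exponent n. For
  positivity, the letters of a reduced word are determined only up to Z, so windows can be counted
  only up to the double coset of their product; the difficulty is then that a window and an inverse
  window may fall into the same double coset.\<close>

definition comm_prods :: "('g, 'b) monoid_scheme \<Rightarrow> nat \<Rightarrow> 'g set" where
  "comm_prods G n = ((\<lambda>ps. lprod G (map (\<lambda>(a, b). comm G a b) ps)) `
     {ps. length ps = n \<and> set ps \<subseteq> carrier G \<times> carrier G})"

lemma lprod_Nil [simp]: "lprod G [] = \<one>\<^bsub>G\<^esub>"
  by (simp add: lprod_def)

lemma lprod_Cons [simp]: "lprod G (x # xs) = x \<otimes>\<^bsub>G\<^esub> lprod G xs"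
  by (simp add: lprod_def)

lemma lprod_carrier_update [simp]: "lprod (G\<lparr>carrier := S\<rparr>) xs = lprod G xs"
  by (induction xs) auto

context group
begin

lemma inv_mult_cancel [simp]:
  "x \<in> carrier G \<Longrightarrow> y \<in> carrier G \<Longrightarrow> inv x \<otimes> (x \<otimes> y) = y"
  "x \<in> carrier G \<Longrightarrow> y \<in> carrier G \<Longrightarrow> x \<otimes> (inv x \<otimes> y) = y"
  by (simp_all add: m_assoc[symmetric])

lemma lprod_closed [simp]: "set xs \<subseteq> carrier G \<Longrightarrow> lprod G xs \<in> carrier G"
  by (induction xs) auto

lemma lprod_append:
  "set xs \<subseteq> carrier G \<Longrightarrow> set ys \<subseteq> carrier G \<Longrightarrow> lprod G (xs @ ys) = lprod G xs \<otimes> lprod G ys"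
  by (induction xs) (auto simp: m_assoc)

lemma lprod_in_subgroup: "subgroup S G \<Longrightarrow> set xs \<subseteq> S \<Longrightarrow> lprod G xs \<in> S"
  by (induction xs) (auto intro: subgroup.m_closed subgroup.one_closed)

lemma lprod_rev_inv:
  "set xs \<subseteq> carrier G \<Longrightarrow> lprod G (rev (map (m_inv G) xs)) = inv (lprod G xs)"
proof (induction xs)
  case (Cons x xs)
  then have "set (rev (map (m_inv G) xs)) \<subseteq> carrier G" by auto
  with Cons show ?case by (simp add: lprod_append inv_mult_group)
qed simp



lemma comm_closed [simp]: "a \<in> carrier G \<Longrightarrow> b \<in> carrier G \<Longrightarrow> comm G a b \<in> carrier G"
  by (simp add: comm_def)

lemma comm_one: "comm G \<one> \<one> = \<one>"
  by (simp add: comm_def)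

lemma inv_comm: "a \<in> carrier G \<Longrightarrow> b \<in> carrier G \<Longrightarrow> inv (comm G a b) = comm G b a"
  by (simp add: comm_def inv_mult_group m_assoc)

lemma conj_comm:
  "g \<in> carrier G \<Longrightarrow> a \<in> carrier G \<Longrightarrow> b \<in> carrier G \<Longrightarrow>
   g \<otimes> comm G a b \<otimes> inv g = comm G (g \<otimes> a \<otimes> inv g) (g \<otimes> b \<otimes> inv g)"
  by (simp add: comm_def inv_mult_group m_assoc)

lemma comm_prods_0 [simp]: "comm_prods G 0 = {\<one>}"
  by (auto simp: comm_prods_def)

lemma comm_prods_Suc:
  "x \<in> comm_prods G (Suc n) \<longleftrightarrow>
   (\<exists>a b y. a \<in> carrier G \<and> b \<in> carrier G \<and> y \<in> comm_prods G n \<and> x = comm G a b \<otimes> y)"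
proof
  assume "x \<in> comm_prods G (Suc n)"
  then obtain ps where "length ps = Suc n" "set ps \<subseteq> carrier G \<times> carrier G"
    "x = lprod G (map (\<lambda>(a, b). comm G a b) ps)"
    by (auto simp: comm_prods_def)
  then show "\<exists>a b y. a \<in> carrier G \<and> b \<in> carrier G \<and> y \<in> comm_prods G n \<and> x = comm G a b \<otimes> y"
    by (cases ps) (auto simp: comm_prods_def)
next
  assume "\<exists>a b y. a \<in> carrier G \<and> b \<in> carrier G \<and> y \<in> comm_prods G n \<and> x = comm G a b \<otimes> y"
  then obtain a b ps where "a \<in> carrier G" "b \<in> carrier G" "length ps = n"
    "set ps \<subseteq> carrier G \<times> carrier G" "x = comm G a b \<otimes> lprod G (map (\<lambda>(a, b). comm G a b) ps)"
    by (auto simp: comm_prods_def)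
  then show "x \<in> comm_prods G (Suc n)"
    unfolding comm_prods_def by (intro image_eqI[of _ _ "(a, b) # ps"]) auto
qed

lemma comm_prods_SucI:
  "a \<in> carrier G \<Longrightarrow> b \<in> carrier G \<Longrightarrow> y \<in> comm_prods G n \<Longrightarrow> comm G a b \<otimes> y \<in> comm_prods G (Suc n)"
  unfolding comm_prods_Suc by blast

lemma comm_prods_closed: "x \<in> comm_prods G n \<Longrightarrow> x \<in> carrier G"
  by (induction n arbitrary: x) (auto simp: comm_prods_Suc)

lemma comm_in_comm_prods: "a \<in> carrier G \<Longrightarrow> b \<in> carrier G \<Longrightarrow> comm G a b \<in> comm_prods G 1"
  using comm_prods_SucI[of a b \<one> 0] by simp

lemma comm_prods_mult:
  "x \<in> comm_prods G m \<Longrightarrow> y \<in> comm_prods G n \<Longrightarrow> x \<otimes> y \<in> comm_prods G (m + n)"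
proof (induction m arbitrary: x)
  case 0
  then show ?case by (simp add: comm_prods_closed)
next
  case (Suc m)
  then obtain a b z where "a \<in> carrier G" "b \<in> carrier G" "z \<in> comm_prods G m" "x = comm G a b \<otimes> z"
    by (auto simp: comm_prods_Suc)
  moreover from this Suc have "z \<otimes> y \<in> comm_prods G (m + n)" by blast
  ultimately show ?case
    using Suc.prems by (auto simp: comm_prods_Suc comm_prods_closed m_assoc)
qed

text \<open>The definition asks for exactly n commutators; trivial commutators pad a shorter
  product.\<close>

lemma comm_prods_mono: "x \<in> comm_prods G m \<Longrightarrow> m \<le> n \<Longrightarrow> x \<in> comm_prods G n"
proof -
  have one: "\<one> \<in> comm_prods G k" for k
    using comm_prods_SucI[of \<one> \<one> \<one>] by (induction k) (simp_all add: comm_one)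
  assume "x \<in> comm_prods G m" "m \<le> n"
  then show ?thesis using comm_prods_mult[OF _ one[of "n - m"], of x m] comm_prods_closed by fastforce
qed

lemma comm_prods_conj:
  "g \<in> carrier G \<Longrightarrow> x \<in> comm_prods G n \<Longrightarrow> g \<otimes> x \<otimes> inv g \<in> comm_prods G n"
proof (induction n arbitrary: x)
  case (Suc n)
  then obtain a b y where ab: "a \<in> carrier G" "b \<in> carrier G" "y \<in> comm_prods G n" "x = comm G a b \<otimes> y"
    by (auto simp: comm_prods_Suc)
  then have "g \<otimes> x \<otimes> inv g = (g \<otimes> comm G a b \<otimes> inv g) \<otimes> (g \<otimes> y \<otimes> inv g)"
    using Suc.prems comm_prods_closed[of y n] by (simp add: m_assoc)
  moreover have "g \<otimes> y \<otimes> inv g \<in> comm_prods G n" using Suc ab by blast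
  ultimately show ?case
    using ab Suc.prems by (simp add: comm_prods_Suc conj_comm) (metis inv_closed m_closed)
qed simp

lemma comm_prods_inv: "x \<in> comm_prods G n \<Longrightarrow> inv x \<in> comm_prods G n"
proof (induction n arbitrary: x)
  case (Suc n)
  then obtain a b y where ab: "a \<in> carrier G" "b \<in> carrier G" "y \<in> comm_prods G n" "x = comm G a b \<otimes> y"
    by (auto simp: comm_prods_Suc)
  then have "inv y \<otimes> comm G b a \<in> comm_prods G (n + 1)"
    using Suc comm_in_comm_prods[of b a] by (intro comm_prods_mult) auto
  then show ?case using ab comm_prods_closed[of y n] by (simp add: inv_mult_group inv_comm)
qed simp

lemma comm_prods_pow: "x \<in> comm_prods G n \<Longrightarrow> x [^] k \<in> comm_prods G (k * n)" for k :: nat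
proof (induction k)
  case (Suc k)
  then show ?case using comm_prods_mult[of "x [^] k" "k * n" x n] by (simp add: add.commute)
qed simp

lemma comm_prods_pow_conj:
  fixes k :: nat
  assumes "t \<in> carrier G" "x \<in> carrier G" "(t \<otimes> x \<otimes> inv t) [^] k \<in> comm_prods G n"
  shows "x [^] k \<in> comm_prods G n"
proof -
  have eq: "(t \<otimes> x \<otimes> inv t) [^] j = t \<otimes> x [^] j \<otimes> inv t" for j :: nat
    using assms by (induction j) (auto simp: m_assoc)
  show ?thesis using comm_prods_conj[of "inv t" _ n, OF _ assms(3)] assms
    unfolding eq by (simp add: m_assoc)
qed

section \<open>Equality up to a bounded number of commutators\<close>

definition near :: "nat \<Rightarrow> 'a \<Rightarrow> 'a \<Rightarrow> bool" where
  "near n x y \<longleftrightarrow> x \<in> carrier G \<and> y \<in> carrier G \<and> x \<otimes> inv y \<in> comm_prods G n"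

lemma near_refl: "x \<in> carrier G \<Longrightarrow> near 0 x x"
  by (simp add: near_def)

lemma near_sym: "near n x y \<Longrightarrow> near n y x"
  unfolding near_def using comm_prods_inv[of "x \<otimes> inv y" n] by (auto simp: inv_mult_group)



lemma near_trans: "near m x y \<Longrightarrow> near n y z \<Longrightarrow> near (m + n) x z"
  unfolding near_def using comm_prods_mult[of "x \<otimes> inv y" m "y \<otimes> inv z" n] by (auto simp: m_assoc)

text \<open>Errors add up in products because \<open>x x' (y y')^-1\<close> is the conjugate of
  \<open>x' y'^-1\<close> by \<open>x\<close>, times \<open>x y^-1\<close>, and conjugation
  preserves the number of commutators.\<close>

lemma near_mult: "near m x y \<Longrightarrow> near n x' y' \<Longrightarrow> near (m + n) (x \<otimes> x') (y \<otimes> y')"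
proof -
  assume xy: "near m x y" "near n x' y'"
  then have "x \<otimes> (x' \<otimes> inv y') \<otimes> inv x \<in> comm_prods G n"
    by (auto simp: near_def intro: comm_prods_conj)
  then have "x \<otimes> (x' \<otimes> inv y') \<otimes> inv x \<otimes> (x \<otimes> inv y) \<in> comm_prods G (n + m)"
    using xy by (auto simp: near_def intro: comm_prods_mult)
  then show ?thesis using xy by (simp add: near_def inv_mult_group m_assoc add.commute)
qed

lemma near_commute: "x \<in> carrier G \<Longrightarrow> y \<in> carrier G \<Longrightarrow> near 1 (x \<otimes> y) (y \<otimes> x)"
  using comm_in_comm_prods[of x y] by (simp add: near_def inv_mult_group m_assoc comm_def)

lemma near_conj: "t \<in> carrier G \<Longrightarrow> x \<in> carrier G \<Longrightarrow> near 1 (t \<otimes> x \<otimes> inv t) x"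
  using comm_in_comm_prods[of t x] by (simp add: near_def comm_def)

lemma near_pow: "near n x y \<Longrightarrow> near (k * n) (x [^] k) (y [^] k)" for k :: nat
proof (induction k)
  case (Suc k)
  then show ?case using near_mult[of "k * n" "x [^] k" "y [^] k" n x y] by (simp add: add.commute)
qed (simp add: near_refl)

lemma near_comm_prods: "near n x y \<Longrightarrow> y \<in> comm_prods G m \<Longrightarrow> x \<in> comm_prods G (n + m)"
  unfolding near_def using comm_prods_mult[of "x \<otimes> inv y" n y m] by (auto simp: m_assoc)

end

lemma (in group) comm_prods_abelian:
  assumes "\<And>a b. a \<in> carrier G \<Longrightarrow> b \<in> carrier G \<Longrightarrow> comm G a b = \<one>" "x \<in> comm_prods G n"
  shows "x = \<one>"
  using assms(2)
proof (induction n arbitrary: x)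
  case (Suc n)
  then obtain a b y where "a \<in> carrier G" "b \<in> carrier G" "y \<in> comm_prods G n" "x = comm G a b \<otimes> y"
    by (auto simp: comm_prods_Suc)
  then show ?case using Suc.IH[of y] assms(1)[of a b] by simp
qed simp

lemma (in group_hom) hom_comm_prods: "x \<in> comm_prods G n \<Longrightarrow> h x \<in> comm_prods H n"
proof (induction n arbitrary: x)
  case (Suc n)
  then obtain a b y where ab: "a \<in> carrier G" "b \<in> carrier G" "y \<in> comm_prods G n" "x = comm G a b \<otimes> y"
    by (auto simp: G.comm_prods_Suc)
  then have "h x = comm H (h a) (h b) \<otimes>\<^bsub>H\<^esub> h y"
    using G.comm_prods_closed by (simp add: comm_def)
  then show ?case using Suc.IH[OF ab(3)] ab(1,2) by (simp add: H.comm_prods_SucI)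
qed simp

lemma (in group) subgroup_group: "subgroup S G \<Longrightarrow> group (G\<lparr>carrier := S\<rparr>)"
  by (rule subgroup.subgroup_is_group) auto

lemma (in group) comm_subgroup:
  "subgroup S G \<Longrightarrow> a \<in> S \<Longrightarrow> b \<in> S \<Longrightarrow> comm (G\<lparr>carrier := S\<rparr>) a b = comm G a b"
  by (simp add: comm_def)

lemma (in group) comm_prods_subgroup_mono:
  assumes "subgroup S G" "subgroup T G" "S \<subseteq> T" "x \<in> comm_prods (G\<lparr>carrier := S\<rparr>) n"
  shows "x \<in> comm_prods (G\<lparr>carrier := T\<rparr>) n"
  using assms(4)
proof (induction n arbitrary: x)
  case (Suc n)
  interpret S: group "G\<lparr>carrier := S\<rparr>" by (rule subgroup_group[OF assms(1)])
  interpret T: group "G\<lparr>carrier := T\<rparr>" by (rule subgroup_group[OF assms(2)])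
  from Suc.prems obtain a b y where "a \<in> S" "b \<in> S" "y \<in> comm_prods (G\<lparr>carrier := S\<rparr>) n"
    "x = comm (G\<lparr>carrier := S\<rparr>) a b \<otimes> y"
    by (auto simp: S.comm_prods_Suc)
  then show ?case using assms Suc.IH[of y] T.comm_prods_SucI[of a b y n]
    by (auto simp: comm_subgroup subset_iff)
qed (simp add: group.comm_prods_0[OF subgroup_group[OF assms(1)]] group.comm_prods_0[OF subgroup_group[OF assms(2)]])

section \<open>Balanced words\<close>

text \<open>Words in signed letters; \<open>(x, False)\<close> stands for the inverse of \<open>x\<close>.\<close>

definition letter_val :: "('g, 'b) monoid_scheme \<Rightarrow> 'g \<times> bool \<Rightarrow> 'g" where
  "letter_val G p = (if snd p then fst p else inv\<^bsub>G\<^esub> (fst p))"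

definition flip :: "'g \<times> bool \<Rightarrow> 'g \<times> bool" where
  "flip p = (fst p, \<not> snd p)"

text \<open>The letters are matched formally: two letters whose values happen to be inverse in the
  group are opposite only if they differ just in the sign.\<close>

definition balanced :: "('g \<times> bool) list \<Rightarrow> bool" where
  "balanced ps \<longleftrightarrow> (\<forall>p. count_list ps p = count_list ps (flip p))"

lemma flip_flip [simp]: "flip (flip p) = p"
  and flip_neq [simp]: "flip p \<noteq> p" "p \<noteq> flip p"
  and fst_flip [simp]: "fst (flip p) = fst p"
  and flip_eq_iff [simp]: "flip p = flip q \<longleftrightarrow> p = q"
  by (cases p; cases q; auto simp: flip_def)+

context group
begin

lemma letter_val_closed [simp]: "fst p \<in> carrier G \<Longrightarrow> letter_val G p \<in> carrier G"
  by (simp add: letter_val_def)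

lemma letter_vals_closed:
  "fst ` set ps \<subseteq> carrier G \<Longrightarrow> set (map (letter_val G) ps) \<subseteq> carrier G"
  using letter_val_closed by auto

lemma letter_val_flip [simp]: "fst p \<in> carrier G \<Longrightarrow> letter_val G (flip p) = inv (letter_val G p)"
  by (simp add: letter_val_def flip_def)

text \<open>The cut-and-paste move for surfaces: the linked edge pairs of \<open>x\<close> and
  \<open>y\<close> form a handle; cutting it off costs one commutator and leaves the remaining arcs
  in the order \<open>c b a d\<close>. With \<open>e = c b a\<close> the quotient of the two sides
  is the conjugate by \<open>e\<close> of \<open>[e^-1 x a, y b a]\<close>.\<close>

lemma extract_commutator:
  assumes "x \<in> carrier G" "y \<in> carrier G" "a \<in> carrier G" "b \<in> carrier G" "c \<in> carrier G" "d \<in> carrier G"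
  shows "near 1 (x \<otimes> (a \<otimes> (y \<otimes> (b \<otimes> (inv x \<otimes> (c \<otimes> (inv y \<otimes> d))))))) (c \<otimes> (b \<otimes> (a \<otimes> d)))"
proof -
  define e where "e = c \<otimes> b \<otimes> a"
  have "e \<otimes> comm G (inv e \<otimes> x \<otimes> a) (y \<otimes> b \<otimes> a) \<otimes> inv e \<in> comm_prods G 1"
    using assms by (intro comm_prods_conj comm_in_comm_prods) (auto simp: e_def)
  then show ?thesis using assms
    by (simp add: near_def e_def comm_def inv_mult_group m_assoc)
qed

text \<open>The boundary word of a polygon with edges glued in orientation reversing pairs: the genus of
  the resulting surface is at most a quarter of the number of edges.\<close>

lemma balanced_word_comm_prods:
  assumes "fst ` set ps \<subseteq> carrier G" "balanced ps"
  shows "lprod G (map (letter_val G) ps) \<in> comm_prods G (length ps div 4)"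
  using assms
proof (induction "length ps" arbitrary: ps rule: less_induct)
  case less
  let ?v = "\<lambda>ps. lprod G (map (letter_val G) ps)"
  have closed: "fst ` set qs \<subseteq> carrier G \<Longrightarrow> ?v qs \<in> carrier G" for qs
    by (intro lprod_closed) auto
  have app: "fst ` set (qs @ rs) \<subseteq> carrier G \<Longrightarrow> ?v (qs @ rs) = ?v qs \<otimes> ?v rs" for qs rs
    by (simp, intro lprod_append) auto
  show ?case
  proof (cases ps)
    case Nil
    then show ?thesis by simp
  next
    case (Cons p qs)
    then have "count_list ps p > 0" by simp
    then have "count_list ps (flip p) > 0" using less.prems(2) unfolding balanced_def by metis
    then have "flip p \<in> set qs" using Cons
      by (metis count_list.simps(2) count_list_0_iff flip_neq(2) less_numeral_extra(3))
    then obtain A B where AB: "qs = A @ flip p # B" by (meson split_list)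
    have ps: "ps = p # A @ flip p # B" using Cons AB by simp
    have bal: "count_list A q + count_list B q = count_list A (flip q) + count_list B (flip q)" for q
      using less.prems(2) unfolding balanced_def ps
      by (drule_tac spec[of _ q]) (auto split: if_splits)
    have carr: "fst p \<in> carrier G" "fst ` set A \<subseteq> carrier G" "fst ` set B \<subseteq> carrier G"
      using less.prems(1) by (auto simp: ps)
    show ?thesis
    \<comment> \<open>Either \<open>A\<close> is balanced, so that the pair \<open>p\<close>,
      \<open>flip p\<close> merely conjugates \<open>A\<close> and costs nothing, or some letter of
      \<open>A\<close> has its partner in \<open>B\<close>, which makes two linked pairs.\<close>
    proof (cases "balanced A")
      case True
      then have "balanced B" using bal by (auto simp: balanced_def)
      then have B: "?v B \<in> comm_prods G (length B div 4)" using carr less.hyps by (simp add: ps)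
      have "?v A \<in> comm_prods G (length A div 4)" using True carr less.hyps by (simp add: ps)
      then have "letter_val G p \<otimes> ?v A \<otimes> inv (letter_val G p) \<in> comm_prods G (length A div 4)"
        using carr by (intro comm_prods_conj) auto
      from comm_prods_mult[OF this B]
      have "?v ps \<in> comm_prods G (length A div 4 + length B div 4)"
        using carr closed[of A] closed[of B] app[of A "flip p # B"] by (simp add: ps m_assoc image_Un)
      then show ?thesis by (rule comm_prods_mono) (simp add: ps)
    next
      case False
      then obtain q' where q': "count_list A q' \<noteq> count_list A (flip q')" by (auto simp: balanced_def)
      define q where "q = (if count_list A q' > count_list A (flip q') then q' else flip q')"
      have q: "count_list A q > count_list A (flip q)" using q' by (auto simp: q_def)
      then have "count_list B (flip q) > 0" using bal[of q] by linarith
      then obtain B1 B2 where B: "B = B1 @ flip q # B2"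
        by (metis count_list_0_iff less_numeral_extra(3) split_list)
      obtain A1 A2 where A: "A = A1 @ q # A2"
        using q by (metis count_list_0_iff not_less_zero split_list)
      let ?ps = "B1 @ A2 @ A1 @ B2"
      have carr': "fst q \<in> carrier G" "fst ` set A1 \<subseteq> carrier G" "fst ` set A2 \<subseteq> carrier G"
         "fst ` set B1 \<subseteq> carrier G" "fst ` set B2 \<subseteq> carrier G"
        using carr by (auto simp: A B)
      have "balanced ?ps" unfolding balanced_def
      proof
        fix r show "count_list ?ps r = count_list ?ps (flip r)"
          using bal[of r] by (auto simp: A B split: if_splits)
      qed
      then have IH: "?v ?ps \<in> comm_prods G (length ?ps div 4)"
        using carr' by (intro less.hyps) (auto simp: ps A B)
      have "?v ps = letter_val G p \<otimes> (?v A1 \<otimes> (letter_val G q \<otimes> (?v A2 \<otimes>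
          (inv letter_val G p \<otimes> (?v B1 \<otimes> (inv letter_val G q \<otimes> ?v B2))))))"
        using carr carr' closed
          app[of A1 "q # A2 @ flip p # B1 @ flip q # B2"] app[of A2 "flip p # B1 @ flip q # B2"]
          app[of B1 "flip q # B2"] by (simp add: ps A B image_Un)
      moreover have "?v ?ps = ?v B1 \<otimes> (?v A2 \<otimes> (?v A1 \<otimes> ?v B2))"
        using carr' closed app[of B1 "A2 @ A1 @ B2"] app[of A2 "A1 @ B2"] app[of A1 B2] by (simp add: image_Un)
      ultimately have "near 1 (?v ps) (?v ?ps)"
        using extract_commutator[of "letter_val G p" "letter_val G q" "?v A1" "?v A2" "?v B1" "?v B2"]
          carr carr' closed by simp
      \<comment> \<open>Four letters disappear, so the floor of a quarter of the length drops by
        exactly one, which pays for the handle.\<close>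
      moreover have "1 + length ?ps div 4 = length ps div 4"
      proof -
        have "length ps = length ?ps + 4" by (simp add: ps A B)
        then show ?thesis by presburger
      qed
      ultimately show ?thesis using near_comm_prods[OF _ IH] by metis
    qed
  qed
qed

end

section \<open>Homomorphisms from amalgamated products\<close>

lemma successively_conv_nth:
  "successively P xs \<longleftrightarrow> (\<forall>i. Suc i < length xs \<longrightarrow> P (xs ! i) (xs ! Suc i))"
proof (induction P xs rule: successively.induct)
  case (3 P x y xs)
  show ?case
    unfolding successively.simps 3
  proof safe
    fix i assume "P x y" "\<forall>i. Suc i < length (y # xs) \<longrightarrow> P ((y # xs) ! i) ((y # xs) ! Suc i)"
      "Suc i < length (x # y # xs)"
    then show "P ((x # y # xs) ! i) ((x # y # xs) ! Suc i)" by (cases i) auto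
  qed fastforce+
qed auto

text \<open>Letters outside \<open>H \<inter> B\<close> lie in exactly one factor, so membership in
  \<open>H\<close> alone tells the factors apart.\<close>

definition reduced_word :: "'g set \<Rightarrow> 'g set \<Rightarrow> 'g list \<Rightarrow> bool" where
  "reduced_word H B xs \<longleftrightarrow> set xs \<subseteq> (H \<union> B) - (H \<inter> B) \<and> successively (\<lambda>x y. (x \<in> H) \<noteq> (y \<in> H)) xs"

lemma reduced_word_Nil [simp]: "reduced_word H B []"
  by (simp add: reduced_word_def)

text \<open>A letter of \<open>H \<inter> B\<close> shares a factor with any neighbour, so it can be
  merged unless it is the whole word.\<close>

lemma not_reduced_wordE:
  assumes "set xs \<subseteq> H \<union> B" "\<not> reduced_word H B xs"
  obtains (single) z where "z \<in> H \<inter> B" "xs = [z]"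
    | (merge) us x y vs where "xs = us @ [x, y] @ vs" "{x, y} \<subseteq> H \<or> {x, y} \<subseteq> B"
proof -
  have "(\<exists>z\<in>H \<inter> B. xs = [z]) \<or> (\<exists>us x y vs. xs = us @ [x, y] @ vs \<and> ({x, y} \<subseteq> H \<or> {x, y} \<subseteq> B))"
    using assms
  proof (induction xs rule: induct_list012)
    case (3 x y zs)
    show ?case
    proof (cases "{x, y} \<subseteq> H \<or> {x, y} \<subseteq> B")
      case True
      then show ?thesis by (metis append.left_neutral append_Cons)
    next
      case False
      then have "\<not> reduced_word H B (y # zs)"
        using 3 by (auto simp: reduced_word_def)
      then obtain us u v vs where "y # zs = us @ [u, v] @ vs" "{u, v} \<subseteq> H \<or> {u, v} \<subseteq> B"
        using 3 False by fastforce
      then show ?thesis by (metis append_Cons)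
    qed
  qed (auto simp: reduced_word_def)
  then show ?thesis using that by blast
qed

context group
begin

lemma internal_amalgamD:
  assumes "internal_amalgam G H B K"
  shows "subgroup H G" "subgroup B G" "subgroup K G" "H \<subseteq> K" "B \<subseteq> K" "K = generate G (H \<union> B)"
  using assms by (auto simp: internal_amalgam_def)

lemma reduced_word_neq_one:
  assumes "internal_amalgam G H B K" "reduced_word H B xs" "xs \<noteq> []"
  shows "lprod G xs \<noteq> \<one>"
proof -
  have 1: "set xs \<subseteq> (H - (H \<inter> B)) \<union> (B - (H \<inter> B))" using assms(2) by (auto simp: reduced_word_def)
  have "(xs ! i \<in> H \<and> xs ! Suc i \<in> B) \<or> (xs ! i \<in> B \<and> xs ! Suc i \<in> H)" if i: "Suc i < length xs" for i
  proof -
    have "(xs ! i \<in> H) \<noteq> (xs ! Suc i \<in> H)"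
      using assms(2) i by (simp add: reduced_word_def successively_conv_nth)
    moreover have "xs ! i \<in> H \<union> B" "xs ! Suc i \<in> H \<union> B"
      using 1 i nth_mem[of i xs] nth_mem[of "Suc i" xs] by (meson DiffD1 Suc_lessD UnCI UnE subsetD)+
    ultimately show ?thesis by blast
  qed
  with 1 show ?thesis using assms(1,3) by (simp add: internal_amalgam_def)
qed

lemma generate_lprod:
  assumes "subgroup H G" "subgroup B G" "x \<in> generate G (H \<union> B)"
  shows "\<exists>xs. set xs \<subseteq> H \<union> B \<and> lprod G xs = x"
  using assms(3)
proof (induction rule: generate.induct)
  case one
  show ?case by (intro exI[of _ "[]"]) simp
next
  case (incl h)
  then show ?case using assms(1,2) by (intro exI[of _ "[h]"]) (auto dest: subgroup.mem_carrier)
next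
  case (inv h)
  then show ?case using assms(1,2)
    by (intro exI[of _ "[inv h]"]) (auto dest: subgroup.mem_carrier subgroup.m_inv_closed)
next
  case (eng h1 h2)
  then obtain xs ys where "set xs \<subseteq> H \<union> B" "lprod G xs = h1" "set ys \<subseteq> H \<union> B" "lprod G ys = h2"
    by auto
  moreover have "H \<union> B \<subseteq> carrier G" using assms(1,2) by (simp add: subgroup.subset)
  ultimately show ?case using lprod_append[of xs ys] by (intro exI[of _ "xs @ ys"]) auto
qed

text \<open>The universal property, recovered from the normal form condition that serves as the
  definition of the amalgam. The map extends letterwise to words; the only question is whether the
  value depends on the word chosen.\<close>

lemma amalgam_hom:
  assumes am: "internal_amalgam G H B K" and "group L"
    and f: "f \<in> hom (G\<lparr>carrier := H\<rparr>) L" and g: "g \<in> hom (G\<lparr>carrier := B\<rparr>) L"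
    and agree: "\<And>z. z \<in> H \<inter> B \<Longrightarrow> f z = g z"
  obtains r where "r \<in> hom (G\<lparr>carrier := K\<rparr>) L" "\<And>h. h \<in> H \<Longrightarrow> r h = f h" "\<And>b. b \<in> B \<Longrightarrow> r b = g b"
proof -
  interpret L: group L by fact
  note sg = internal_amalgamD[OF am]
  interpret H: group "G\<lparr>carrier := H\<rparr>" using sg by (rule_tac subgroup_group)
  interpret B: group "G\<lparr>carrier := B\<rparr>" using sg by (rule_tac subgroup_group)
  interpret f: group_hom "G\<lparr>carrier := H\<rparr>" L f by unfold_locales (rule f)
  interpret g: group_hom "G\<lparr>carrier := B\<rparr>" L g by unfold_locales (rule g)
  have sub: "H \<union> B \<subseteq> carrier G" using sg by (simp add: subgroup.subset)
  define e where "e x = (if x \<in> H then f x else g x)" for x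
  have eH: "e x = f x" if "x \<in> H" for x using that by (simp add: e_def)
  have eB: "e x = g x" if "x \<in> B" for x using that agree by (simp add: e_def)
  have e_closed: "e x \<in> carrier L" if "x \<in> H \<union> B" for x
    using that f.hom_closed g.hom_closed by (auto simp: e_def)
  then have map_closed: "set (map e xs) \<subseteq> carrier L" if "set xs \<subseteq> H \<union> B" for xs using that by auto
  have e_mult: "e (x \<otimes> y) = e x \<otimes>\<^bsub>L\<^esub> e y" if "{x, y} \<subseteq> H \<or> {x, y} \<subseteq> B" for x y
    using that
  proof
    assume "{x, y} \<subseteq> H"
    then show ?thesis using f.hom_mult[of x y] sg(1) by (simp add: eH subgroup.m_closed)
  next
    assume "{x, y} \<subseteq> B"
    then show ?thesis using g.hom_mult[of x y] sg(2) by (simp add: eB subgroup.m_closed)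
  qed
  have e_one: "e \<one> = \<one>\<^bsub>L\<^esub>" using f.hom_one subgroup.one_closed[OF sg(1)] by (simp add: eH)
  have inv_in: "inv x \<in> H \<union> B" if "x \<in> H \<union> B" for x
    using that sg(1,2) by (auto dest: subgroup.m_inv_closed)
  have e_inv: "e (inv x) = inv\<^bsub>L\<^esub> e x" if "x \<in> H \<union> B" for x
  proof -
    have "{inv x, x} \<subseteq> H \<or> {inv x, x} \<subseteq> B" using that sg(1,2) by (auto dest: subgroup.m_inv_closed)
    moreover have "inv x \<otimes> x = \<one>" using that sub by (intro l_inv) auto
    ultimately have "e (inv x) \<otimes>\<^bsub>L\<^esub> e x = \<one>\<^bsub>L\<^esub>" using e_mult e_one by metis
    then show ?thesis using e_closed inv_in that by (metis L.inv_equality)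
  qed
  \<comment> \<open>A nonempty word with trivial product is not reduced, so two of its letters can
    be merged, or it is the single letter \<open>\<one>\<close>. Merging changes neither the product
    nor the image.\<close>
  have word: "lprod L (map e xs) = \<one>\<^bsub>L\<^esub>" if "set xs \<subseteq> H \<union> B" "lprod G xs = \<one>" for xs
    using that
  proof (induction "length xs" arbitrary: xs rule: less_induct)
    case less
    show ?case
    proof (cases "reduced_word H B xs")
      case True
      then have "xs = []" using reduced_word_neq_one[OF am True] less.prems by blast
      then show ?thesis by simp
    next
      case False
      from less.prems(1) this show ?thesis
      proof (cases rule: not_reduced_wordE)
        case (single z)
        then have "z = \<one>" using less.prems sub by auto
        then show ?thesis using single by (simp add: e_one)
      next
        case (merge us x y vs)
        let ?ys = "us @ [x \<otimes> y] @ vs"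
        have cl: "set us \<subseteq> H \<union> B" "set vs \<subseteq> H \<union> B" "x \<in> H \<union> B" "y \<in> H \<union> B"
          using less.prems(1) merge by auto
        then have G: "set us \<subseteq> carrier G" "set vs \<subseteq> carrier G" "x \<in> carrier G" "y \<in> carrier G"
          using sub by auto
        have xy: "x \<otimes> y \<in> H \<union> B" using merge(2) sg(1,2) by (auto simp: subgroup.m_closed)
        have "lprod G ?ys = lprod G xs"
          using G by (simp add: merge lprod_append m_assoc)
        then have "lprod L (map e ?ys) = \<one>\<^bsub>L\<^esub>"
          using less.prems cl xy by (intro less.hyps) (auto simp: merge)
        moreover have "lprod L (map e ?ys) = lprod L (map e xs)"
          using map_closed[of us] map_closed[of vs] e_closed cl xy e_mult[OF merge(2)]
          by (simp add: merge L.lprod_append L.m_assoc)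
        ultimately show ?thesis by simp
      qed
    qed
  qed
  \<comment> \<open>The value is read off from an arbitrary word for the element; comparing two
    words through the quotient word \<open>?zs\<close> makes it independent of the choice.\<close>
  define r where "r x = lprod L (map e (SOME xs. set xs \<subseteq> H \<union> B \<and> lprod G xs = x))" for x
  have r: "r (lprod G xs) = lprod L (map e xs)" if xs: "set xs \<subseteq> H \<union> B" for xs
  proof -
    define ys where "ys = (SOME ys. set ys \<subseteq> H \<union> B \<and> lprod G ys = lprod G xs)"
    have ys: "set ys \<subseteq> H \<union> B \<and> lprod G ys = lprod G xs"
      unfolding ys_def by (rule someI[of _ xs]) (simp add: xs)
    let ?zs = "xs @ rev (map (m_inv G) ys)"
    have G: "set xs \<subseteq> carrier G" "set ys \<subseteq> carrier G" using xs ys sub by auto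
    then have G': "set (rev (map (m_inv G) ys)) \<subseteq> carrier G" by auto
    have zs: "set ?zs \<subseteq> H \<union> B" using xs ys inv_in by auto
    moreover have "lprod G ?zs = \<one>"
      using G ys by (simp add: lprod_append[OF _ G'] lprod_rev_inv del: rev_map)
    ultimately have "lprod L (map e ?zs) = \<one>\<^bsub>L\<^esub>" by (rule word)
    moreover have "map e (rev (map (m_inv G) ys)) = rev (map (m_inv L) (map e ys))"
      using e_inv ys by (auto simp: rev_map[symmetric])
    ultimately have "lprod L (map e xs) \<otimes>\<^bsub>L\<^esub> inv\<^bsub>L\<^esub> lprod L (map e ys) = \<one>\<^bsub>L\<^esub>"
      using L.lprod_append[of "map e xs" "map e (rev (map (m_inv G) ys))"]
         L.lprod_rev_inv[of "map e ys"] map_closed xs ys zs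
      by (metis (no_types, lifting) le_sup_iff map_append set_append)
    then have "lprod L (map e xs) = lprod L (map e ys)"
      using map_closed xs ys by (metis L.inv_closed L.inv_equality L.inv_inv L.lprod_closed)
    then show ?thesis by (simp add: r_def ys_def)
  qed
  have single: "r x = e x" if "x \<in> H \<union> B" for x
    using r[of "[x]"] that e_closed[of x] sub by auto
  show ?thesis
  proof
    show "r \<in> hom (G\<lparr>carrier := K\<rparr>) L"
    proof (rule homI)
      fix x assume "x \<in> carrier (G\<lparr>carrier := K\<rparr>)"
      then obtain xs where "set xs \<subseteq> H \<union> B" "lprod G xs = x" using generate_lprod[OF sg(1,2), of x] sg(6) by auto
      then show "r x \<in> carrier L" using r map_closed by auto
    next
      fix x y assume "x \<in> carrier (G\<lparr>carrier := K\<rparr>)" "y \<in> carrier (G\<lparr>carrier := K\<rparr>)"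
      then obtain xs ys where xs: "set xs \<subseteq> H \<union> B" "lprod G xs = x" "set ys \<subseteq> H \<union> B" "lprod G ys = y"
        using generate_lprod[OF sg(1,2), of x] generate_lprod[OF sg(1,2), of y] sg(6) by auto
      then have "x \<otimes> y = lprod G (xs @ ys)" using sub by (simp add: lprod_append subset_trans)
      also have "r \<dots> = lprod L (map e xs) \<otimes>\<^bsub>L\<^esub> lprod L (map e ys)"
        using xs r map_closed L.lprod_append by simp
      finally show "r (x \<otimes>\<^bsub>G\<lparr>carrier := K\<rparr>\<^esub> y) = r x \<otimes>\<^bsub>L\<^esub> r y" using xs r by auto
    qed
  qed (auto simp: single eH eB)
qed

end

section \<open>Wreath products with cyclic groups\<close>

text \<open>Functions on the cyclic group of order k are kept as k-periodic functions on the
  integers, so that shifts need no reduction. The pair (f, s) is the map sending (x, i) to (f(i) x,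
  i + s), and the product is composition.\<close>

definition wreath :: "('g, 'b) monoid_scheme \<Rightarrow> nat \<Rightarrow> ((int \<Rightarrow> 'g) \<times> int) monoid" where
  "wreath G k = \<lparr>carrier = {(f, s). (\<forall>i. f i \<in> carrier G \<and> f (i mod int k) = f i) \<and> 0 \<le> s \<and> s < int k},
     monoid.mult = (\<lambda>(f, s) (f', s'). (\<lambda>i. f (i + s') \<otimes>\<^bsub>G\<^esub> f' i, (s + s') mod int k)),
     one = (\<lambda>_. \<one>\<^bsub>G\<^esub>, 0)\<rparr>"

lemma periodic_add_mod:
  fixes f :: "int \<Rightarrow> 'a"
  assumes "\<And>i. f (i mod k) = f i"
  shows "f (j + i mod k) = f (j + i)" "f (i mod k + j) = f (i + j)" "f (j - i mod k) = f (j - i)"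
    "f (i mod k - j) = f (i - j)"
  using assms by (metis mod_add_right_eq, metis mod_add_left_eq, metis mod_diff_right_eq, metis mod_diff_left_eq)

lemma sum_periodic_shift:
  fixes g :: "int \<Rightarrow> 'a::comm_monoid_add"
  assumes "k > 0" and g: "\<And>i. g (i mod int k) = g i"
  shows "(\<Sum>j<k. g (int j + s)) = (\<Sum>j<k. g (int j))"
proof (rule sum.reindex_bij_witness[of _ "\<lambda>j. nat ((int j - s) mod int k)" "\<lambda>j. nat ((int j + s) mod int k)"])
  fix j assume "j \<in> {..<k}"
  then show "nat ((int (nat ((int j + s) mod int k)) - s) mod int k) = j"
    "nat ((int (nat ((int j - s) mod int k)) + s) mod int k) = j"
    "nat ((int j + s) mod int k) \<in> {..<k}" "nat ((int j - s) mod int k) \<in> {..<k}"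
    "g (int (nat ((int j + s) mod int k))) = g (int j + s)"
    using assms by (auto simp: mod_simps nat_less_iff)
qed

lemma count_list_concat_map:
  "count_list (concat (map F [0..<n])) q = (\<Sum>j<n. count_list (F j) q)"
  by (induction n) auto

lemma (in group) wreath_group:
  assumes k: "k > 0"
  shows "group (wreath G k)"
proof (rule groupI)
  let ?L = "wreath G k"
  show "\<one>\<^bsub>?L\<^esub> \<in> carrier ?L" using k by (simp add: wreath_def)
  fix x assume x: "x \<in> carrier ?L"
  then show "\<one>\<^bsub>?L\<^esub> \<otimes>\<^bsub>?L\<^esub> x = x" by (auto simp: wreath_def)
  show "\<exists>y\<in>carrier ?L. y \<otimes>\<^bsub>?L\<^esub> x = \<one>\<^bsub>?L\<^esub>"
    using x k
    by (intro bexI[of _ "(\<lambda>i. inv (fst x (i - snd x)), (- snd x) mod int k)"])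
       (auto simp: wreath_def mod_simps periodic_add_mod)
  fix y assume y: "y \<in> carrier ?L"
  show "x \<otimes>\<^bsub>?L\<^esub> y \<in> carrier ?L" using x y k by (auto simp: wreath_def periodic_add_mod)
  fix z assume "z \<in> carrier ?L"
  then show "x \<otimes>\<^bsub>?L\<^esub> y \<otimes>\<^bsub>?L\<^esub> z = x \<otimes>\<^bsub>?L\<^esub> (y \<otimes>\<^bsub>?L\<^esub> z)"
    using x y by (auto simp: wreath_def periodic_add_mod m_assoc mod_simps algebra_simps)
qed

lemma (in group) inv_wreath:
  assumes "k > 0" and fs: "(f, s) \<in> carrier (wreath G k)"
  shows "inv\<^bsub>wreath G k\<^esub> (f, s) = (\<lambda>i. inv (f (i - s)), (- s) mod int k)"
proof -
  interpret L: group "wreath G k" using wreath_group assms by simp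
  show ?thesis using assms
    by (intro L.inv_equality) (auto simp: wreath_def mod_simps periodic_add_mod)
qed

text \<open>The cyclic quotient is abelian, so only the coordinates survive. As i runs over the
  residues, the value of f (or g) at each index occurs once with either sign, although not in the
  same coordinate.\<close>

lemma (in group) comm_wreath:
  assumes "k > 0" and fs: "(f, s) \<in> carrier (wreath G k)" and gt: "(g, t) \<in> carrier (wreath G k)"
  shows "comm (wreath G k) (f, s) (g, t) =
    (\<lambda>i. f (i - s) \<otimes> g (i - s - t) \<otimes> inv f (i - s - t) \<otimes> inv g (i - t), 0)"
proof -
  have f: "f i = f j" and g: "g i = g j" if "i mod int k = j mod int k" for i j
    using fs gt that by (auto simp: wreath_def, metis, metis)
  have m: "(i + (- t) mod int k + (- s) mod int k + t) mod int k = (i - s) mod int k"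
    "(i + (- t) mod int k + (- s) mod int k) mod int k = (i - s - t) mod int k"
    "(i + (- t) mod int k - s) mod int k = (i - s - t) mod int k" for i
  proof -
    have "\<exists>c. (- r) mod int k = - r + int k * c" for r
      by (intro exI[of _ "- ((- r) div int k)"]) (simp add: minus_mult_div_eq_mod[symmetric])
    then obtain c d where c: "(- s) mod int k = - s + int k * c" "(- t) mod int k = - t + int k * d"
      by metis
    have 1: "i + (- t) mod int k + (- s) mod int k + t = i - s + int k * (c + d)"
      "i + (- t) mod int k + (- s) mod int k = i - s - t + int k * (c + d)"
      "i + (- t) mod int k - s = i - s - t + int k * d"
      unfolding c by (simp_all add: algebra_simps)
    show "(i + (- t) mod int k + (- s) mod int k + t) mod int k = (i - s) mod int k"
      "(i + (- t) mod int k + (- s) mod int k) mod int k = (i - s - t) mod int k"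
      "(i + (- t) mod int k - s) mod int k = (i - s - t) mod int k"
      by (simp only: 1(1) mod_mult_self2, simp only: 1(2) mod_mult_self2, simp only: 1(3) mod_mult_self2)
  qed
  show ?thesis unfolding comm_def inv_wreath[OF assms(1) fs] inv_wreath[OF assms(1) gt]
    using m by (auto simp: wreath_def mod_simps f[OF m(1)] g[OF m(2)] f[OF m(3)])
qed

text \<open>A single word \<open>W i\<close> may fail to be balanced; only the k words together are,
  because the letters of a commutator move between coordinates. Hence the balance is stated for the
  sum over the coordinates.\<close>

lemma (in group) wreath_comm_prods:
  assumes k: "k > 0" and "p \<in> comm_prods (wreath G k) M"
  shows "snd p = 0 \<and> (\<exists>W. (\<forall>i. length (W i) = 4 * M \<and> fst ` set (W i) \<subseteq> carrier G \<and>
            lprod G (map (letter_val G) (W i)) = fst p i) \<and>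
          (\<forall>q. (\<Sum>j<k. count_list (W (int j)) q) = (\<Sum>j<k. count_list (W (int j)) (flip q))))"
  using assms(2)
proof (induction M arbitrary: p)
  case 0
  interpret L: group "wreath G k" using wreath_group assms by simp
  from 0 have "p = (\<lambda>_. \<one>, 0)" by (simp add: wreath_def[THEN arg_cong[of _ _ monoid.one]])
  then show ?case by (auto intro!: exI[of _ "\<lambda>_. []"])
next
  case (Suc M)
  interpret L: group "wreath G k" using wreath_group assms by simp
  from Suc.prems obtain a b y where ab: "a \<in> carrier (wreath G k)" "b \<in> carrier (wreath G k)"
    "y \<in> comm_prods (wreath G k) M" "p = comm (wreath G k) a b \<otimes>\<^bsub>wreath G k\<^esub> y"
    by (auto simp: L.comm_prods_Suc)
  obtain f s g t where [simp]: "a = (f, s)" "b = (g, t)" by (cases a, cases b)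
  have f: "\<And>i. f i \<in> carrier G" "\<And>i. f (i mod int k) = f i"
    and g: "\<And>i. g i \<in> carrier G" "\<And>i. g (i mod int k) = g i"
    using ab by (auto simp: wreath_def)
  from Suc.IH[OF ab(3)] obtain W where y: "snd y = 0"
    and W: "\<And>i. length (W i) = 4 * M \<and> fst ` set (W i) \<subseteq> carrier G \<and> lprod G (map (letter_val G) (W i)) = fst y i"
    and bal: "\<And>q. (\<Sum>j<k. count_list (W (int j)) q) = (\<Sum>j<k. count_list (W (int j)) (flip q))"
    by blast
  define V where "V i = [(f (i - s), True), (g (i - s - t), True), (f (i - s - t), False), (g (i - t), False)]" for i
  \<comment> \<open>A shift by s, t or s + t permutes the residues, so the shifts drop out of the
    count.\<close>
  have Vsum: "(\<Sum>j<k. count_list (V (int j)) q) =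
      (\<Sum>j<k. of_bool ((f (int j), True) = q) + of_bool ((g (int j), True) = q)
        + of_bool ((f (int j), False) = q) + of_bool ((g (int j), False) = q))" for q
  proof -
    have "(\<Sum>j<k. of_bool ((h (int j + r), c) = q)) = (\<Sum>j<k. of_bool ((h (int j), c) = q) :: nat)"
      if "\<And>i. h (i mod int k) = h i" for h :: "int \<Rightarrow> 'a" and r c
      using that by (intro sum_periodic_shift[OF k, of "\<lambda>i. of_bool ((h i, c) = q)"]) simp
    from this[of f "-s" True] this[of g "-s-t" True] this[of f "-s-t" False] this[of g "-t" False] f g
    have "(\<Sum>j<k. of_bool ((f (int j - s), True) = q) + of_bool ((g (int j - s - t), True) = q)
        + of_bool ((f (int j - s - t), False) = q) + of_bool ((g (int j - t), False) = q)) =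
      (\<Sum>j<k. of_bool ((f (int j), True) = q) + of_bool ((g (int j), True) = q)
        + of_bool ((f (int j), False) = q) + of_bool ((g (int j), False) = q) :: nat)"
      by (simp add: sum.distrib algebra_simps)
    moreover have "count_list (V i) q = of_bool ((f (i - s), True) = q) + of_bool ((g (i - s - t), True) = q)
        + of_bool ((f (i - s - t), False) = q) + of_bool ((g (i - t), False) = q)" for i
      by (auto simp: V_def)
    ultimately show ?thesis by simp
  qed
  have balV: "(\<Sum>j<k. count_list (V (int j)) q) = (\<Sum>j<k. count_list (V (int j)) (flip q))" for q
    unfolding Vsum by (intro sum.cong refl) (cases q, auto simp: flip_def)
  have comm: "comm (wreath G k) a b =
      (\<lambda>i. f (i - s) \<otimes> g (i - s - t) \<otimes> inv f (i - s - t) \<otimes> inv g (i - t), 0)"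
    using comm_wreath[OF k] ab by simp
  have py: "snd p = 0" "\<And>i. fst p i = (f (i - s) \<otimes> g (i - s - t) \<otimes> inv f (i - s - t) \<otimes> inv g (i - t)) \<otimes> fst y i"
    using y unfolding ab(4) comm by (cases y; auto simp: wreath_def)+
  have Wc: "set (map (letter_val G) (W i)) \<subseteq> carrier G" for i using W[of i] letter_vals_closed by blast
  have ey: "fst y i \<in> carrier G" for i using W[of i] Wc[of i] by (metis lprod_closed)
  show ?case
  proof (intro conjI exI[of _ "\<lambda>i. V i @ W i"] allI)
    fix i
    show "length (V i @ W i) = 4 * Suc M" using W by (simp add: V_def)
    show "fst ` set (V i @ W i) \<subseteq> carrier G" using W[of i] f g by (auto simp: V_def)
    show "lprod G (map (letter_val G) (V i @ W i)) = fst p i"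
      using W[of i] f g ey by (simp add: V_def py letter_val_def m_assoc)
  next
    fix q
    show "(\<Sum>j<k. count_list (V (int j) @ W (int j)) q) = (\<Sum>j<k. count_list (V (int j) @ W (int j)) (flip q))"
      using bal[of q] balV[of q] by (simp add: sum.distrib)
  qed (rule py)
qed

text \<open>Each of the k words represents \<open>x\<close>, so their concatenation represents
  \<open>x^k\<close>; it is balanced of length 4kM, which makes kM commutators. This is the transfer
  homomorphism carried out on words instead of in the abelianization.\<close>

lemma (in group) wreath_comm_prods_const:
  assumes k: "k > 0" and x: "x \<in> carrier G" and "(\<lambda>_. x, 0) \<in> comm_prods (wreath G k) M"
  shows "x [^] k \<in> comm_prods G (k * M)"
proof -
  from wreath_comm_prods[OF k assms(3)] obtain W where
    W: "\<And>i. length (W i) = 4 * M \<and> fst ` set (W i) \<subseteq> carrier G \<and> lprod G (map (letter_val G) (W i)) = x"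
    and bal: "\<And>q. (\<Sum>j<k. count_list (W (int j)) q) = (\<Sum>j<k. count_list (W (int j)) (flip q))"
    by auto
  let ?ps = "\<lambda>n. concat (map (\<lambda>j. W (int j)) [0..<n])"
  have "fst ` set (?ps n) \<subseteq> carrier G \<and> length (?ps n) = n * (4 * M) \<and> lprod G (map (letter_val G) (?ps n)) = x [^] n" for n
  proof (induction n)
    case (Suc n)
    have "set (map (letter_val G) (?ps n)) \<subseteq> carrier G" "set (map (letter_val G) (W (int n))) \<subseteq> carrier G"
      using Suc W[of "int n"] by (intro letter_vals_closed; blast)+
    then have "lprod G (map (letter_val G) (?ps n @ W (int n))) = x [^] n \<otimes> x"
      using Suc W[of "int n"] by (simp add: lprod_append)
    then show ?case using Suc W[of "int n"] by auto
  qed auto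
  moreover have "balanced (?ps k)"
    unfolding balanced_def count_list_concat_map using bal by blast
  ultimately have "x [^] k \<in> comm_prods G (length (?ps k) div 4)" "length (?ps k) = k * (4 * M)"
    using balanced_word_comm_prods[of "?ps k"] by auto
  then show ?thesis by (simp add: algebra_simps)
qed

section \<open>Commutator length in amalgamated products\<close>

text \<open>The exponent may depend on \<open>x\<close> and \<open>M\<close>. Only the ratio between
  the number of commutators and the exponent is controlled, which is what scl sees.\<close>

definition comm_length_transfer :: "('g, 'b) monoid_scheme \<Rightarrow> 'g set \<Rightarrow> 'g set \<Rightarrow> bool" where
  "comm_length_transfer U H K \<longleftrightarrow> (\<forall>x\<in>H. \<forall>M. x \<in> comm_prods (U\<lparr>carrier := K\<rparr>) M \<longrightarrow>
     (\<exists>k>0. x [^]\<^bsub>U\<^esub> (k::nat) \<in> comm_prods (U\<lparr>carrier := H\<rparr>) (k * M)))"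

text \<open>There is no bound on \<open>M'\<close>: the relation only decides which elements are
  boundaries, a point on which \<open>comm_length_transfer\<close> would allow passing to a proper
  power.\<close>

definition derived_transfer :: "('g, 'b) monoid_scheme \<Rightarrow> 'g set \<Rightarrow> 'g set \<Rightarrow> bool" where
  "derived_transfer U H K \<longleftrightarrow> (\<forall>x\<in>H. \<forall>M. x \<in> comm_prods (U\<lparr>carrier := K\<rparr>) M \<longrightarrow>
     (\<exists>M'. x \<in> comm_prods (U\<lparr>carrier := H\<rparr>) M'))"

context group
begin

text \<open>The exponents with \<open>c^j\<close> in \<open>Z\<close> form an ideal of the integers.
  The value k = 0 stands for the case that no nonzero power lies in \<open>Z\<close>, so that both
  cases share one divisibility criterion.\<close>

lemma int_pow_mem_generator:
  assumes "subgroup Z G" "c \<in> carrier G"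
  obtains k :: nat where "\<And>j :: int. c [^] j \<in> Z \<longleftrightarrow> int k dvd j"
proof -
  interpret Z: subgroup Z G by fact
  define P where "P n \<longleftrightarrow> n > 0 \<and> c [^] int n \<in> Z" for n :: nat
  have neg: "c [^] (- j) \<in> Z" if "c [^] j \<in> Z" for j :: int
    using that assms(2) by (simp add: int_pow_neg)
  show ?thesis
  proof (cases "\<exists>n. P n")
    case False
    have "c [^] j \<in> Z \<longleftrightarrow> int 0 dvd j" for j :: int
    proof
      assume j: "c [^] j \<in> Z"
      have "\<not> P (nat \<bar>j\<bar>)" using False by blast
      then show "int 0 dvd j" using j neg[OF j] by (auto simp: P_def abs_if split: if_splits)
    qed simp
    then show ?thesis by (rule that)
  next
    case True
    define k where "k = (LEAST n. P n)"
    have Pk: "P k" unfolding k_def using True by (rule LeastI_ex)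
    then have k: "k > 0" "c [^] int k \<in> Z" by (auto simp: P_def)
    have mult: "c [^] (int k * q) \<in> Z" for q
      using subgroup_int_pow_closed[OF assms(1) k(2), of q] int_pow_pow[OF assms(2), of "int k" q] by simp
    have "c [^] j \<in> Z \<longleftrightarrow> int k dvd j" for j
    proof
      assume j: "c [^] j \<in> Z"
      have "c [^] (j + int k * (- (j div int k))) \<in> Z"
        unfolding int_pow_mult[OF assms(2)] by (intro Z.m_closed j mult)
      moreover have "j + int k * (- (j div int k)) = j mod int k"
        by (simp add: minus_mult_div_eq_mod)
      ultimately have "c [^] int (nat (j mod int k)) \<in> Z" using k by simp
      moreover have "\<not> P (nat (j mod int k))"
      proof
        assume "P (nat (j mod int k))"
        then have "k \<le> nat (j mod int k)" unfolding k_def by (rule Least_le)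
        then show False using k pos_mod_bound[of "int k" j] by (simp add: le_nat_iff del: pos_mod_bound)
      qed
      ultimately have "nat (j mod int k) = 0" by (auto simp: P_def)
      then have "j mod int k = 0" using k pos_mod_sign[of "int k" j] by linarith
      then show "int k dvd j" by (rule dvd_eq_mod_eq_0[THEN iffD2])
    next
      assume "int k dvd j"
      then show "c [^] j \<in> Z" using mult by auto
    qed
    then show ?thesis by (rule that)
  qed
qed

text \<open>If \<open>H \<inter> B\<close> has finite index \<open>k\<close> in \<open>B\<close> with cyclic quotient, the amalgam maps to the wreath
  product of \<open>H\<close> with the cyclic group of order \<open>k\<close>: \<open>H\<close> goes to the constants, and \<open>B\<close> acts as
  on the representation induced from \<open>H \<inter> B\<close>.\<close>

lemma amalgam_transfer_cyclic:
  assumes am: "internal_amalgam G H B K"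
    and comm: "\<And>a b. a \<in> B \<Longrightarrow> b \<in> B \<Longrightarrow> a \<otimes> b = b \<otimes> a"
    and c: "c \<in> B" "\<And>b. b \<in> B \<Longrightarrow> \<exists>m::int. b \<otimes> c [^] (- m) \<in> H \<inter> B"
  shows "comm_length_transfer G H K"
  unfolding comm_length_transfer_def
proof (intro ballI allI impI)
  fix x M assume x: "x \<in> H" "x \<in> comm_prods (G\<lparr>carrier := K\<rparr>) M"
  note sg = internal_amalgamD[OF am]
  interpret H: group "G\<lparr>carrier := H\<rparr>" using sg by (rule_tac subgroup_group)
  interpret K: group "G\<lparr>carrier := K\<rparr>" using sg by (rule_tac subgroup_group)
  interpret SH: subgroup H G by (rule sg)
  interpret SB: subgroup B G by (rule sg)
  interpret SZ: subgroup "H \<inter> B" G using sg by (intro subgroups_Inter_pair) auto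
  have cG: "c \<in> carrier G" using c by simp
  have pow_B: "c [^] n \<in> B" for n :: int
    using c sg by (auto intro: subgroup_int_pow_closed)
  have lcomm: "a \<otimes> (b \<otimes> d) = b \<otimes> (a \<otimes> d)" if "a \<in> B" "b \<in> B" "d \<in> carrier G" for a b d
    using that comm[of a b] by (simp add: m_assoc[symmetric])
  have pow_comb: "c [^] m \<otimes> c [^] n = c [^] (m + n)" "c [^] m \<otimes> (c [^] n \<otimes> d) = c [^] (m + n) \<otimes> d"
    if "d \<in> carrier G" for m n :: int and d
    using that cG by (simp_all add: int_pow_mult m_assoc[symmetric])
  note pow_comb = pow_comb(1)[OF one_closed] pow_comb(2)
  obtain k where k: "\<And>j :: int. c [^] j \<in> H \<inter> B \<longleftrightarrow> int k dvd j"
    using int_pow_mem_generator[OF SZ.subgroup_axioms cG] by blast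
  \<comment> \<open>\<open>\<mu>\<close> is the projection of \<open>B\<close> to
    \<open>B / (H \<inter> B)\<close>, read in the residues 0, ..., k - 1. For k = 0 reduction
    modulo 0 is the identity, and \<open>\<mu>\<close> is the integer exponent itself.\<close>
  define \<mu> where "\<mu> b = (SOME m. b \<otimes> c [^] (- m) \<in> H \<inter> B) mod int k" for b
  have uniq: "m mod int k = n mod int k"
    if "b \<in> B" "b \<otimes> c [^] (- m) \<in> H \<inter> B" "b \<otimes> c [^] (- n) \<in> H \<inter> B" for b m n
  proof -
    have "inv (b \<otimes> c [^] (- n)) \<otimes> (b \<otimes> c [^] (- m)) \<in> H \<inter> B"
      by (rule SZ.m_closed[OF SZ.m_inv_closed[OF that(3)] that(2)])
    also have "inv (b \<otimes> c [^] (- n)) \<otimes> (b \<otimes> c [^] (- m)) = c [^] (n - m)"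
      using that pow_B cG by (simp add: inv_mult_group m_assoc int_pow_neg[symmetric] pow_comb)
    finally have "int k dvd n - m" using k by blast
    then have "n mod int k = m mod int k" by (simp add: mod_eq_dvd_iff)
    then show ?thesis ..
  qed
  have mod_ok: "b \<otimes> c [^] (- n) \<in> H \<inter> B" if b: "b \<in> B" "b \<otimes> c [^] (- m) \<in> H \<inter> B" "m mod int k = n mod int k" for b m n
  proof -
    have "b \<otimes> c [^] (- m) \<otimes> c [^] (m - n) \<in> H \<inter> B"
      by (rule SZ.m_closed[OF b(2)]) (use b(3) k[of "m - n"] in \<open>simp add: mod_eq_dvd_iff\<close>)
    then show ?thesis using b pow_B cG by (simp add: m_assoc pow_comb)
  qed
  have \<mu>_mem: "b \<otimes> c [^] (- \<mu> b) \<in> H \<inter> B" if "b \<in> B" for b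
  proof -
    define m where "m = (SOME m::int. b \<otimes> c [^] (- m) \<in> H \<inter> B)"
    have "b \<otimes> c [^] (- m) \<in> H \<inter> B" unfolding m_def by (rule someI_ex[OF c(2)[OF that]])
    moreover have "m mod int k = \<mu> b mod int k" by (simp add: \<mu>_def m_def)
    ultimately show ?thesis by (rule mod_ok[OF that])
  qed
  have \<mu>_eq: "\<mu> b = m mod int k" if "b \<in> B" "b \<otimes> c [^] (- m) \<in> H \<inter> B" for b m
    using uniq[OF that(1) \<mu>_mem[OF that(1)] that(2)] by (simp add: \<mu>_def)
  have \<mu>_Z: "\<mu> z = 0" if "z \<in> H \<inter> B" for z
    using \<mu>_eq[of z 0] that by simp
  have \<mu>_mult: "\<mu> (a \<otimes> b) = (\<mu> a + \<mu> b) mod int k" if "a \<in> B" "b \<in> B" for a b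
  proof (rule \<mu>_eq)
    have "(a \<otimes> c [^] (- \<mu> a)) \<otimes> (b \<otimes> c [^] (- \<mu> b)) \<in> H \<inter> B" using that \<mu>_mem by blast
    also have "(a \<otimes> c [^] (- \<mu> a)) \<otimes> (b \<otimes> c [^] (- \<mu> b)) = a \<otimes> b \<otimes> c [^] (- (\<mu> a + \<mu> b))"
      using that pow_B cG lcomm[of "c [^] (- \<mu> a)" b "c [^] (- \<mu> b)"] by (simp add: m_assoc pow_comb)
    finally show "a \<otimes> b \<otimes> c [^] (- (\<mu> a + \<mu> b)) \<in> H \<inter> B" .
  qed (use that in auto)
  show "\<exists>k>0. x [^] (k::nat) \<in> comm_prods (G\<lparr>carrier := H\<rparr>) (k * M)"
  proof (cases "k = 0")
    case True
    \<comment> \<open>No nonzero power of \<open>c\<close> lies in \<open>H \<inter> B\<close>, so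
      removing the \<open>c\<close>-part retracts \<open>B\<close> onto \<open>H \<inter> B\<close>;
      this glues with the identity of \<open>H\<close>.\<close>
    obtain r where r: "r \<in> hom (G\<lparr>carrier := K\<rparr>) (G\<lparr>carrier := H\<rparr>)" "\<And>h. h \<in> H \<Longrightarrow> r h = h"
    proof (rule amalgam_hom[OF am H.is_group, of "\<lambda>h. h" "\<lambda>b. b \<otimes> c [^] (- \<mu> b)"])
      show "(\<lambda>b. b \<otimes> c [^] (- \<mu> b)) \<in> hom (G\<lparr>carrier := B\<rparr>) (G\<lparr>carrier := H\<rparr>)"
      proof (rule homI)
        fix a b assume "a \<in> carrier (G\<lparr>carrier := B\<rparr>)" "b \<in> carrier (G\<lparr>carrier := B\<rparr>)"
        then have "a \<in> B" "b \<in> B" by auto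
        then show "a \<otimes>\<^bsub>G\<lparr>carrier := B\<rparr>\<^esub> b \<otimes> c [^] (- \<mu> (a \<otimes>\<^bsub>G\<lparr>carrier := B\<rparr>\<^esub> b)) =
          (a \<otimes> c [^] (- \<mu> a)) \<otimes>\<^bsub>G\<lparr>carrier := H\<rparr>\<^esub> (b \<otimes> c [^] (- \<mu> b))"
          using pow_B cG lcomm[of "c [^] (- \<mu> a)" b "c [^] (- \<mu> b)"]
          by (simp add: \<mu>_mult True m_assoc pow_comb)
      qed (use \<mu>_mem in auto)
    qed (use \<mu>_Z cG in \<open>auto simp: hom_def\<close>)
    interpret r: group_hom "G\<lparr>carrier := K\<rparr>" "G\<lparr>carrier := H\<rparr>" r
      by unfold_locales (rule r)
    show ?thesis using r.hom_comm_prods[OF x(2)] r(2)[OF x(1)] x by (intro exI[of _ 1]) simp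
  next
    case False
    then have k0: "k > 0" by simp
    \<comment> \<open>Multiplication by b on the cosets of \<open>H \<inter> B\<close> with
      representatives \<open>c^0, ..., c^(k-1)\<close>: for 0 \<le> i < k one has
      \<open>b c^i = (f b i) c^j\<close>, where j is i + \<open>\<mu> b\<close> reduced modulo
      k.\<close>
    define f where "f b i = b \<otimes> c [^] (i mod int k - (i + \<mu> b) mod int k)" for b i
    have f_mem: "f b i \<in> H \<inter> B" if "b \<in> B" for b i
      unfolding f_def
      using mod_ok[OF that \<mu>_mem[OF that], of "(i + \<mu> b) mod int k - i mod int k"] by (simp add: mod_simps)
    let ?L = "wreath (G\<lparr>carrier := H\<rparr>) k"
    interpret L: group ?L by (rule H.wreath_group[OF k0])
    obtain r where r: "r \<in> hom (G\<lparr>carrier := K\<rparr>) ?L" "\<And>h. h \<in> H \<Longrightarrow> r h = (\<lambda>_. h, 0)"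
    proof (rule amalgam_hom[OF am L.is_group, of "\<lambda>h. (\<lambda>_. h, 0)" "\<lambda>b. (f b, \<mu> b)"])
      show "(\<lambda>h. (\<lambda>_. h, 0)) \<in> hom (G\<lparr>carrier := H\<rparr>) ?L"
        using k0 by (auto simp: hom_def wreath_def)
      show "(\<lambda>b. (f b, \<mu> b)) \<in> hom (G\<lparr>carrier := B\<rparr>) ?L"
      proof (rule homI)
        fix a b assume "a \<in> carrier (G\<lparr>carrier := B\<rparr>)" "b \<in> carrier (G\<lparr>carrier := B\<rparr>)"
        then have ab: "a \<in> B" "b \<in> B" by auto
        have "f (a \<otimes> b) i = f a (i + \<mu> b) \<otimes> f b i" for i
          unfolding f_def using ab pow_B cG
            lcomm[of "c [^] ((i + \<mu> b) mod int k - (i + \<mu> b + \<mu> a) mod int k)" b]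
          by (simp add: \<mu>_mult m_assoc pow_comb mod_simps algebra_simps)
        then show "(f (a \<otimes>\<^bsub>G\<lparr>carrier := B\<rparr>\<^esub> b), \<mu> (a \<otimes>\<^bsub>G\<lparr>carrier := B\<rparr>\<^esub> b)) = (f a, \<mu> a) \<otimes>\<^bsub>?L\<^esub> (f b, \<mu> b)"
          using ab by (auto simp: wreath_def \<mu>_mult)
      next
        fix b assume "b \<in> carrier (G\<lparr>carrier := B\<rparr>)"
        then have "f b i \<in> H" "f b (i mod int k) = f b i" for i
          using f_mem[of b i] by (auto simp: f_def mod_simps)
        then show "(f b, \<mu> b) \<in> carrier ?L" using k0 by (simp add: wreath_def \<mu>_def)
      qed
      show "(\<lambda>_. z, 0) = (f z, \<mu> z)" if "z \<in> H \<inter> B" for z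
        using that by (simp add: f_def \<mu>_Z fun_eq_iff)
    qed blast
    interpret r: group_hom "G\<lparr>carrier := K\<rparr>" ?L r
      by unfold_locales (rule r)
    from r.hom_comm_prods[OF x(2)] r(2)[OF x(1)] H.wreath_comm_prods_const[OF k0 _ , of x M] x(1) k0
    show ?thesis by (intro exI[of _ k]) (auto simp: nat_pow_consistent[symmetric])
  qed
qed

text \<open>An expression by commutators involves finitely many elements, which lie in a common
  member of the directed family.\<close>

lemma comm_prods_Union:
  assumes "I \<noteq> {}" "\<And>i. i \<in> I \<Longrightarrow> subgroup (S i) G" "subgroup (\<Union>i\<in>I. S i) G"
    and directed: "\<And>i j. i \<in> I \<Longrightarrow> j \<in> I \<Longrightarrow> \<exists>l\<in>I. S i \<union> S j \<subseteq> S l"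
    and "x \<in> comm_prods (G\<lparr>carrier := \<Union>i\<in>I. S i\<rparr>) M"
  shows "\<exists>i\<in>I. x \<in> comm_prods (G\<lparr>carrier := S i\<rparr>) M"
  using assms(5)
proof (induction M arbitrary: x)
  case 0
  then show ?case using assms(1-3) group.comm_prods_0[OF subgroup_group] by fastforce
next
  case (Suc M)
  let ?K = "\<Union>i\<in>I. S i"
  from Suc.prems obtain a b y where ab: "a \<in> ?K" "b \<in> ?K" "y \<in> comm_prods (G\<lparr>carrier := ?K\<rparr>) M"
    "x = comm (G\<lparr>carrier := ?K\<rparr>) a b \<otimes> y"
    using group.comm_prods_Suc[OF subgroup_group[OF assms(3)]] by auto
  then have "x = comm G a b \<otimes> y" using comm_subgroup[OF assms(3)] by metis
  note ab = ab(1-3) this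
  then obtain i j l where "i \<in> I" "j \<in> I" "l \<in> I" "a \<in> S i" "b \<in> S j" "y \<in> comm_prods (G\<lparr>carrier := S l\<rparr>) M"
    using Suc.IH by blast
  moreover from this obtain i' where "i' \<in> I" "S i \<union> S j \<subseteq> S i'" using directed by meson
  moreover from this \<open>l \<in> I\<close> obtain n where "n \<in> I" "S i' \<union> S l \<subseteq> S n" using directed by meson
  ultimately have "n \<in> I" "a \<in> S n" "b \<in> S n" "y \<in> comm_prods (G\<lparr>carrier := S n\<rparr>) M"
    using comm_prods_subgroup_mono[of "S l" "S n"] assms(2) by auto
  then show ?case
    using group.comm_prods_SucI[OF subgroup_group[OF assms(2)], of n a b y M] comm_subgroup[OF assms(2), of n a b] ab(4)
    by auto
qed

end

lemma (in group_hom) hom_comm: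
  "a \<in> carrier G \<Longrightarrow> b \<in> carrier G \<Longrightarrow> h (comm G a b) = comm H (h a) (h b)"
  by (simp add: comm_def)

section \<open>Subgroups of the rationals: locally cyclic, abelian, torsion-free\<close>

lemma rat_common_multiple:
  fixes a b :: rat
  obtains u v m n :: int where
    "a = of_int m * (of_int u * a + of_int v * b)" "b = of_int n * (of_int u * a + of_int v * b)"
proof -
  obtain p q where a: "a = of_int p / of_int q" "q > 0" by (metis Rat_cases_nonzero quotient_of_div quotient_of_denom_pos surj_pair)
  obtain p' q' where b: "b = of_int p' / of_int q'" "q' > 0" by (metis Rat_cases_nonzero quotient_of_div quotient_of_denom_pos surj_pair)
  define x y d where "x = p * q'" and "y = p' * q" and "d = q * q'"
  have ab: "a = of_int x / of_int d" "b = of_int y / of_int d" "d > 0"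
    using a b by (auto simp: x_def y_def d_def)
  \<comment> \<open>Bezout over the common denominator: the generator is an integer combination of a
    and b, so it lies in every subgroup containing both.\<close>
  obtain u v where uv: "u * x + v * y = gcd x y" using bezout_int by blast
  define e where "e = gcd x y"
  obtain m n where mn: "x = e * m" "y = e * n" unfolding e_def by (meson gcd_dvd1 gcd_dvd2 dvdE)
  have "of_int u * a + of_int v * b = of_int (u * x + v * y) / of_int d"
    using ab by (simp add: add_divide_distrib)
  then have g: "of_int u * a + of_int v * b = of_int e / of_int d" using uv by (simp add: e_def)
  have "a = of_int m * (of_int e / of_int d)" "b = of_int n * (of_int e / of_int d)"
    using ab mn by simp_all
  then show ?thesis unfolding g[symmetric] by (rule that)
qed

context group
begin

lemma rat_subgroup_int_pow:
  assumes "group (rat_group A)" "subgroup B G" "\<phi> \<in> iso (rat_group A) (G\<lparr>carrier := B\<rparr>)"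
    and a: "a \<in> A"
  shows "of_int m * a \<in> A \<and> \<phi> (of_int m * a) = \<phi> a [^] (m::int)"
proof -
  interpret A: group "rat_group A" by fact
  interpret B: group "G\<lparr>carrier := B\<rparr>" using assms(2) by (rule subgroup_group)
  interpret B: subgroup B G by fact
  interpret \<phi>: group_hom "rat_group A" "G\<lparr>carrier := B\<rparr>" \<phi>
    using assms(3) by unfold_locales (simp add: iso_def)
  have add: "x + y \<in> A \<and> \<phi> (x + y) = \<phi> x \<otimes> \<phi> y" if "x \<in> A" "y \<in> A" for x y
    using \<phi>.hom_mult[of x y] A.m_closed[of x y] that by (simp add: rat_group_def)
  have zero: "0 \<in> A \<and> \<phi> 0 = \<one>"
    using \<phi>.hom_one A.one_closed by (simp add: rat_group_def)
  have \<phi>B: "\<phi> x \<in> carrier G" if "x \<in> A" for x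
    using \<phi>.hom_closed[of x] that by (simp add: rat_group_def)
  have neg: "- x \<in> A \<and> \<phi> (- x) = inv \<phi> x" if "x \<in> A" for x
  proof -
    have "inv\<^bsub>rat_group A\<^esub> x = - x"
      using A.r_inv[of x] that by (simp add: rat_group_def eq_neg_iff_add_eq_0 add.commute)
    then have "- x \<in> A" using A.inv_closed[of x] that by (simp add: rat_group_def)
    then show ?thesis using add[of "- x" x] zero that \<phi>B by (metis add.left_inverse inv_equality)
  qed
  have nat: "of_nat n * a \<in> A \<and> \<phi> (of_nat n * a) = \<phi> a [^] n" for n :: nat
  proof (induction n)
    case (Suc n)
    then show ?case using add[of "of_nat n * a" a] a by (simp add: algebra_simps)
  qed (simp add: zero)
  show ?thesis
  proof (cases "m \<ge> 0")
    case True
    then have "of_int m * a = of_nat (nat m) * a" "\<phi> a [^] m = \<phi> a [^] nat m"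
      by (simp, simp only: int_pow_def2 not_less[symmetric] if_False)
    then show ?thesis using nat[of "nat m"] by metis
  next
    case False
    then have "of_int m * a = - (of_nat (nat (- m)) * a)" by simp
    moreover have "\<phi> a [^] m = inv (\<phi> a [^] nat (- m))"
      using False by (simp only: int_pow_def2 not_le if_True)
    ultimately show ?thesis using neg[of "of_nat (nat (- m)) * a"] nat[of "nat (- m)"] by metis
  qed
qed

lemma rat_subgroup_locally_cyclic:
  assumes "group (rat_group A)" "subgroup B G" "\<phi> \<in> iso (rat_group A) (G\<lparr>carrier := B\<rparr>)"
    and "a \<in> B" "b \<in> B"
  obtains c and m n :: int where "c \<in> B" "a = c [^] m" "b = c [^] n"
proof -
  have img: "\<phi> ` A = B" using assms(3) by (auto simp: iso_def bij_betw_def rat_group_def)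
  obtain x y where xy: "x \<in> A" "y \<in> A" "\<phi> x = a" "\<phi> y = b" using assms(4,5) img by auto
  obtain u v m n where g: "x = of_int m * (of_int u * x + of_int v * y)" "y = of_int n * (of_int u * x + of_int v * y)"
    by (rule rat_common_multiple[of x y])
  note pow = rat_subgroup_int_pow[OF assms(1-3)]
  have "of_int u * x + of_int v * y \<in> A"
    using pow[OF xy(1), of u] pow[OF xy(2), of v] monoid.m_closed[OF group.is_monoid[OF assms(1)], of "of_int u * x" "of_int v * y"]
    by (simp add: rat_group_def)
  from pow[OF this, of m] pow[OF this, of n] g xy img this show ?thesis
    by (metis image_eqI that)
qed

lemma rat_subgroup_commute:
  assumes "group (rat_group A)" "subgroup B G" "\<phi> \<in> iso (rat_group A) (G\<lparr>carrier := B\<rparr>)"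
    and "a \<in> B" "b \<in> B"
  shows "a \<otimes> b = b \<otimes> a"
proof -
  obtain c and m n :: int where "c \<in> B" "a = c [^] m" "b = c [^] n"
    using rat_subgroup_locally_cyclic[OF assms] by blast
  moreover from this have "c \<in> carrier G" using assms(2) by (metis subgroup.mem_carrier)
  ultimately show ?thesis by (simp add: int_pow_mult[symmetric] add.commute)
qed

lemma rat_subgroup_torsion_free:
  assumes "group (rat_group A)" "subgroup B G" "\<phi> \<in> iso (rat_group A) (G\<lparr>carrier := B\<rparr>)"
    and "b \<in> B" "b [^] n = \<one>" "(n::nat) > 0"
  shows "b = \<one>"
proof -
  have bij: "bij_betw \<phi> A B" using assms(3) by (auto simp: iso_def rat_group_def)
  then obtain x where x: "x \<in> A" "\<phi> x = b" using assms(4) by (auto simp: bij_betw_def)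
  note pow = rat_subgroup_int_pow[OF assms(1-3) x(1)]
  have zero: "0 \<in> A" "\<phi> 0 = \<one>" using pow[of 0] by simp_all
  have "of_int (int n) * x \<in> A" "\<phi> (of_int (int n) * x) = \<one>"
    using pow[of "int n"] assms(5) x(2) unfolding int_pow_int by metis+
  then have "of_int (int n) * x = 0"
    using zero bij by (metis bij_betw_imp_inj_on inj_onD)
  then have "x = 0" using assms(6) by simp
  then show ?thesis using zero x by simp
qed

text \<open>An alternating word over \<open>H\<close> and \<open>C\<close> is also one over
  \<open>H\<close> and \<open>B\<close>, because both pairs have the same intersection; so normal
  forms restrict.\<close>

lemma restrict_amalgam:
  assumes am: "internal_amalgam G H B K" and C: "subgroup C G" "C \<subseteq> B" "H \<inter> B \<subseteq> C"
  shows "internal_amalgam G H C (generate G (H \<union> C))"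
proof -
  note sg = internal_amalgamD[OF am]
  have "H \<union> C \<subseteq> carrier G" using sg C by (meson Un_least subgroup.subset)
  then have "subgroup (generate G (H \<union> C)) G" by (rule generate_is_subgroup)
  moreover have "H \<inter> C = H \<inter> B" using C by auto
  moreover have "H \<union> C \<subseteq> generate G (H \<union> C)" by (auto intro: generate.incl)
  moreover have "lprod G xs \<noteq> \<one>"
    if "xs \<noteq> []" "set xs \<subseteq> (H - H \<inter> B) \<union> (C - H \<inter> B)"
      "\<forall>i. Suc i < length xs \<longrightarrow> (xs ! i \<in> H \<and> xs ! Suc i \<in> C) \<or> (xs ! i \<in> C \<and> xs ! Suc i \<in> H)" for xs
  proof -
    have "set xs \<subseteq> (H - H \<inter> B) \<union> (B - H \<inter> B)"
      "\<forall>i. Suc i < length xs \<longrightarrow> (xs ! i \<in> H \<and> xs ! Suc i \<in> B) \<or> (xs ! i \<in> B \<and> xs ! Suc i \<in> H)"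
      using that C(2) by blast+
    then show ?thesis using am that(1) by (simp add: internal_amalgam_def)
  qed
  ultimately show ?thesis using sg C by (simp add: internal_amalgam_def)
qed

lemma rational_ext_comm_length_transfer:
  assumes ext: "rational_ext mal G H K"
  shows "comm_length_transfer G H K"
proof -
  obtain A B \<phi> where A: "group (rat_group A)" and B: "subgroup B G"
    and \<phi>: "\<phi> \<in> iso (rat_group A) (G\<lparr>carrier := B\<rparr>)" and am: "internal_amalgam G H B K"
    using ext by (auto simp: rational_ext_def)
  note sg = internal_amalgamD[OF am]
  note comm = rat_subgroup_commute[OF A B \<phi>]
  interpret B: subgroup B G by fact
  interpret H: subgroup H G by (rule sg)
  \<comment> \<open>\<open>C c\<close> is generated by \<open>H \<inter> B\<close> and c, so its
    quotient by \<open>H \<inter> B\<close> is cyclic even when that of \<open>B\<close> is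
    not.\<close>
  define C where "C c = {z \<otimes> c [^] m | z m. z \<in> H \<inter> B \<and> m \<in> (UNIV :: int set)}" for c
  define S where "S c = generate G (H \<union> C c)" for c
  have pow_B: "c [^] m \<in> B" if "c \<in> B" for c and m :: int
    using that B by (auto intro: subgroup_int_pow_closed)
  have CI: "z \<otimes> c [^] m \<in> C c" if "z \<in> H \<inter> B" for z c and m :: int
    using that by (auto simp: C_def)
  have CB: "C c \<subseteq> B" if "c \<in> B" for c using that pow_B by (auto simp: C_def)
  have ZC: "H \<inter> B \<subseteq> C c" for c using CI[of _ c 0] by force
  have pow_C: "c [^] m \<in> C c" if "c \<in> B" for c and m :: int
    using CI[of \<one> c m] that by simp
  have C: "subgroup (C c) G" if c: "c \<in> B" for c
  proof (rule subgroupI)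
    show "C c \<subseteq> carrier G" using CB[OF c] B.subset by blast
    show "C c \<noteq> {}" using pow_C c by auto
    fix a assume "a \<in> C c"
    then obtain z m where z: "z \<in> H \<inter> B" "a = z \<otimes> c [^] (m::int)" by (auto simp: C_def)
    then have "inv a = inv z \<otimes> c [^] (- m)"
      using c pow_B comm[of "inv z" "c [^] (- m)"] by (simp add: inv_mult_group int_pow_neg)
    then show "inv a \<in> C c" using z CI by auto
    fix b assume "b \<in> C c"
    then obtain y n where y: "y \<in> H \<inter> B" "b = y \<otimes> c [^] (n::int)" by (auto simp: C_def)
    have "c [^] m \<otimes> y = y \<otimes> c [^] m" using comm y pow_B c by auto
    then have "c [^] m \<otimes> (y \<otimes> c [^] n) = y \<otimes> (c [^] m \<otimes> c [^] n)"
      using y c by (simp add: m_assoc[symmetric])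
    then have "a \<otimes> b = (z \<otimes> y) \<otimes> c [^] (m + n)"
      using z y c by (simp add: int_pow_mult m_assoc)
    then show "a \<otimes> b \<in> C c" using z y CI by auto
  qed
  have amC: "internal_amalgam G H (C c) (S c)" if "c \<in> B" for c
    unfolding S_def by (rule restrict_amalgam[OF am C[OF that] CB[OF that] ZC])
  have SK: "S c \<subseteq> K" if "c \<in> B" for c
    unfolding S_def sg(6) using CB[OF that] by (intro mono_generate) auto
  \<comment> \<open>Two elements of \<open>B\<close> are powers of a common c, since
    \<open>B\<close> is locally cyclic; this makes the subamalgams \<open>S c\<close> a directed
    family.\<close>
  have directed: "\<exists>l\<in>B. S i \<union> S j \<subseteq> S l" if ij: "i \<in> B" "j \<in> B" for i j
  proof -
    obtain c m n where c: "c \<in> B" "i = c [^] (m::int)" "j = c [^] (n::int)"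
      using rat_subgroup_locally_cyclic[OF A B \<phi> ij] by blast
    have "C i \<subseteq> C c" "C j \<subseteq> C c"
      using c CI by (auto simp: C_def int_pow_pow)
    then have "S i \<subseteq> S c" "S j \<subseteq> S c" unfolding S_def by (auto intro!: mono_generate)
    then show ?thesis using c by auto
  qed
  have sgS: "subgroup (S c) G" if "c \<in> B" for c using internal_amalgamD(3)[OF amC[OF that]] .
  have "x \<in> (\<Union>c\<in>B. S c)" if "x \<in> K" for x
    using that unfolding sg(6)
  proof (induction rule: generate.induct)
    case one
    then show ?case using subgroup.one_closed[OF sgS] B.one_closed by blast
  next
    case (incl h)
    have "h \<in> S h" if "h \<in> B" using that pow_C[OF that, of 1] unfolding S_def by (auto intro: generate.incl)
    moreover have "h \<in> S \<one>" if "h \<in> H" using that unfolding S_def by (auto intro: generate.incl)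
    ultimately show ?case using incl B.one_closed by blast
  next
    case (inv h)
    have "inv h \<in> S h" if "h \<in> B" using that pow_C[OF that, of 1] unfolding S_def by (auto intro: generate.inv)
    moreover have "inv h \<in> S \<one>" if "h \<in> H" using that unfolding S_def by (auto intro: generate.inv)
    ultimately show ?case using inv B.one_closed by blast
  next
    case (eng x y)
    then obtain i j where "i \<in> B" "j \<in> B" "x \<in> S i" "y \<in> S j" by auto
    moreover from directed[OF this(1,2)] obtain l where "l \<in> B" "S i \<union> S j \<subseteq> S l" by auto
    ultimately show ?case using subgroup.m_closed[OF sgS[of l], of x y] by auto
  qed
  then have K: "K = (\<Union>c\<in>B. S c)" using SK by auto
  have TC: "comm_length_transfer G H (S c)" if c: "c \<in> B" for c
  proof (rule amalgam_transfer_cyclic[OF amC[OF c]])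
    fix a b assume "a \<in> C c" "b \<in> C c"
    then show "a \<otimes> b = b \<otimes> a" using CB[OF c] comm by blast
  next
    show "c \<in> C c" using pow_C[OF c, of 1] c by simp
    fix b assume b: "b \<in> C c"
    then obtain z m where z: "z \<in> H \<inter> B" "b = z \<otimes> c [^] (m::int)" by (auto simp: C_def)
    then have "b \<otimes> c [^] (- m) = z" using c by (simp add: m_assoc int_pow_neg)
    then show "\<exists>m::int. b \<otimes> c [^] (- m) \<in> H \<inter> C c" using z ZC by (intro exI[of _ m]) auto
  qed
  show ?thesis
    unfolding comm_length_transfer_def
  proof (intro ballI allI impI)
    fix x M assume x: "x \<in> H" "x \<in> comm_prods (G\<lparr>carrier := K\<rparr>) M"
    have "\<exists>c\<in>B. x \<in> comm_prods (G\<lparr>carrier := S c\<rparr>) M"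
    proof (rule comm_prods_Union[OF _ sgS _ directed])
      show "B \<noteq> {}" using B.one_closed by blast
    qed (use x(2) sg(3) K in auto)
    then show "\<exists>k>0. x [^] k \<in> comm_prods (G\<lparr>carrier := H\<rparr>) (k * M)"
      using TC x(1) unfolding comm_length_transfer_def by blast
  qed
qed

text \<open>The abelianization of an amalgam is the pushout of the abelianizations, so that of \<open>H\<close> embeds
  in it when \<open>B\<close> is abelian. The pushout is \<open>(H \<times> B) / N\<close> below.\<close>

lemma amalgam_derived_transfer:
  assumes am: "internal_amalgam G H B K"
    and comm: "\<And>a b. a \<in> B \<Longrightarrow> b \<in> B \<Longrightarrow> a \<otimes> b = b \<otimes> a"
  shows "derived_transfer G H K"
proof -
  note sg = internal_amalgamD[OF am]
  interpret SH: subgroup H G by (rule sg)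
  interpret SB: subgroup B G by (rule sg)
  let ?H = "G\<lparr>carrier := H\<rparr>" and ?B = "G\<lparr>carrier := B\<rparr>"
  interpret H: group ?H using sg by (rule_tac subgroup_group)
  interpret B: group ?B using sg by (rule_tac subgroup_group)
  interpret K: group "G\<lparr>carrier := K\<rparr>" using sg by (rule_tac subgroup_group)
  let ?P = "?H \<times>\<times> ?B"
  interpret P: group ?P by (rule DirProd_group) unfold_locales
  \<comment> \<open>The relations of the pushout: \<open>(z, z^-1)\<close> for z in
    \<open>H \<inter> B\<close>, and the derived subgroup of \<open>H\<close> in the first
    factor.\<close>
  define N where "N = {(h, b). h \<in> H \<and> b \<in> H \<inter> B \<and> (\<exists>n. h \<otimes> b \<in> comm_prods ?H n)}"
  have inv_P: "inv\<^bsub>?P\<^esub> (h, b) = (inv h, inv b)" if "h \<in> H" "b \<in> B" for h b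
    using that sg inv_DirProd[OF H.is_group B.is_group, of h b] by simp
  have commH: "comm G a b \<in> comm_prods ?H 1" if "a \<in> H" "b \<in> H" for a b
    using H.comm_in_comm_prods[of a b] that sg(1) by (simp add: comm_subgroup)
  have N: "subgroup N ?P"
  proof (rule P.subgroupI)
    show "N \<subseteq> carrier ?P" by (auto simp: N_def)
    have "(\<one>, \<one>) \<in> N" by (auto simp: N_def intro!: exI[of _ 0])
    then show "N \<noteq> {}" by auto
    fix p assume "p \<in> N"
    then obtain h b n where p: "p = (h, b)" "h \<in> H" "b \<in> H" "b \<in> B" "h \<otimes> b \<in> comm_prods ?H n"
      by (auto simp: N_def)
    have "b \<otimes>\<^bsub>?H\<^esub> (h \<otimes> b) \<otimes>\<^bsub>?H\<^esub> inv\<^bsub>?H\<^esub> b \<in> comm_prods ?H n"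
      using p by (intro H.comm_prods_conj) auto
    from H.comm_prods_inv[OF this] have "inv\<^bsub>?H\<^esub> (b \<otimes> (h \<otimes> b) \<otimes> inv b) \<in> comm_prods ?H n"
      using p sg(1) by simp
    also have "inv\<^bsub>?H\<^esub> (b \<otimes> (h \<otimes> b) \<otimes> inv b) = inv h \<otimes> inv b"
      using p sg(1) by (subst m_inv_consistent) (simp_all add: m_assoc inv_mult_group)
    finally have "inv h \<otimes> inv b \<in> comm_prods ?H n" .
    then show "inv\<^bsub>?P\<^esub> p \<in> N" unfolding p(1) inv_P[OF p(2,4)] using p by (auto simp: N_def)
    fix q assume "q \<in> N"
    then obtain h' b' n' where q: "q = (h', b')" "h' \<in> H" "b' \<in> H" "b' \<in> B" "h' \<otimes> b' \<in> comm_prods ?H n'"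
      by (auto simp: N_def)
    \<comment> \<open>\<open>h h' b b' = (h b) [b^-1, h'] (h' b')\<close>, so one extra commutator
      pays for the exchange.\<close>
    have "(h \<otimes> b) \<otimes>\<^bsub>?H\<^esub> comm G (inv b) h' \<otimes>\<^bsub>?H\<^esub> (h' \<otimes> b') \<in> comm_prods ?H (n + 1 + n')"
      using p q by (intro H.comm_prods_mult commH) auto
    then have "h \<otimes> h' \<otimes> (b \<otimes> b') \<in> comm_prods ?H (n + 1 + n')"
      using p q by (simp add: comm_def m_assoc)
    then show "p \<otimes>\<^bsub>?P\<^esub> q \<in> N" using p q by (auto simp: N_def)
  qed
  have "N \<lhd> ?P"
  proof (rule P.normal_invI[OF N])
    fix q p assume "q \<in> carrier ?P" "p \<in> N"
    then obtain h b n x y where p: "p = (h, b)" "h \<in> H" "b \<in> H" "b \<in> B" "h \<otimes> b \<in> comm_prods ?H n"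
      and q: "q = (x, y)" "x \<in> H" "y \<in> B"
      by (auto simp: N_def)
    have "comm G x h \<otimes>\<^bsub>?H\<^esub> (h \<otimes> b) \<in> comm_prods ?H (1 + n)"
      using p q by (intro H.comm_prods_mult commH) auto
    then have "x \<otimes> h \<otimes> inv x \<otimes> b \<in> comm_prods ?H (1 + n)" using p q by (simp add: comm_def m_assoc)
    moreover have "y \<otimes> b \<otimes> inv y = b" using comm[of y b] p q by (simp add: m_assoc)
    ultimately show "q \<otimes>\<^bsub>?P\<^esub> p \<otimes>\<^bsub>?P\<^esub> inv\<^bsub>?P\<^esub> q \<in> N"
      unfolding q(1) p(1) inv_P[OF q(2,3)] using p q by (auto simp: N_def)
  qed
  then interpret N: normal N ?P .
  let ?L = "?P Mod N"
  interpret L: group ?L by (rule N.factorgroup_is_group)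
  interpret pr: group_hom ?P ?L "(#>\<^bsub>?P\<^esub>) N"
    using N.r_coset_hom_Mod by unfold_locales simp
  have pr_one: "N #>\<^bsub>?P\<^esub> p = \<one>\<^bsub>?L\<^esub> \<longleftrightarrow> p \<in> N" if "p \<in> carrier ?P" for p
    using P.coset_join1[OF _ that N] P.coset_join2[OF that N] by (auto simp: FactGroup_def)
  have L_abelian: "comm ?L c d = \<one>\<^bsub>?L\<^esub>" if cd: "c \<in> carrier ?L" "d \<in> carrier ?L" for c d
  proof -
    obtain p q where pq: "p \<in> carrier ?P" "q \<in> carrier ?P" "c = N #>\<^bsub>?P\<^esub> p" "d = N #>\<^bsub>?P\<^esub> q"
      using cd by (auto simp: FactGroup_def RCOSETS_def)
    then have "comm ?L c d = N #>\<^bsub>?P\<^esub> (comm ?P p q)" using pr.hom_comm by metis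
    moreover have "comm ?P p q \<in> N"
    proof -
      obtain h b x y where hb: "p = (h, b)" "q = (x, y)" "h \<in> H" "b \<in> B" "x \<in> H" "y \<in> B"
        using pq by auto
      have "b \<otimes> y \<otimes> inv b \<otimes> inv y = \<one>" using comm[of b y] hb by (simp add: m_assoc)
      then have "comm ?P p q = (comm G h x, \<one>)"
        unfolding comm_def hb(1,2) inv_P[OF hb(3,4)] inv_P[OF hb(5,6)] by simp
      then show ?thesis using commH[of h x] hb by (auto simp: N_def comm_def)
    qed
    ultimately show ?thesis using pr_one[OF P.comm_closed[OF pq(1,2)]] by metis
  qed
  obtain r where r: "r \<in> hom (G\<lparr>carrier := K\<rparr>) ?L" "\<And>h. h \<in> H \<Longrightarrow> r h = N #>\<^bsub>?P\<^esub> (h, \<one>)"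
  proof (rule amalgam_hom[OF am L.is_group, of "\<lambda>h. N #>\<^bsub>?P\<^esub> (h, \<one>)" "\<lambda>b. N #>\<^bsub>?P\<^esub> (\<one>, b)"])
    show "(\<lambda>h. N #>\<^bsub>?P\<^esub> (h, \<one>)) \<in> hom ?H ?L"
    proof (rule homI)
      fix a b assume "a \<in> carrier ?H" "b \<in> carrier ?H"
      then show "N #>\<^bsub>?P\<^esub> (a \<otimes>\<^bsub>?H\<^esub> b, \<one>) = (N #>\<^bsub>?P\<^esub> (a, \<one>)) \<otimes>\<^bsub>?L\<^esub> (N #>\<^bsub>?P\<^esub> (b, \<one>))"
        using pr.hom_mult[of "(a, \<one>)" "(b, \<one>)"] by simp
    qed (use pr.hom_closed in auto)
    show "(\<lambda>b. N #>\<^bsub>?P\<^esub> (\<one>, b)) \<in> hom ?B ?L"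
    proof (rule homI)
      fix a b assume "a \<in> carrier ?B" "b \<in> carrier ?B"
      then show "N #>\<^bsub>?P\<^esub> (\<one>, a \<otimes>\<^bsub>?B\<^esub> b) = (N #>\<^bsub>?P\<^esub> (\<one>, a)) \<otimes>\<^bsub>?L\<^esub> (N #>\<^bsub>?P\<^esub> (\<one>, b))"
        using pr.hom_mult[of "(\<one>, a)" "(\<one>, b)"] by simp
    qed (use pr.hom_closed in auto)
    fix z assume z: "z \<in> H \<inter> B"
    have q: "(\<one>, z) \<in> carrier ?P" "(z, \<one>) \<in> carrier ?P" using z by auto
    have inv_z: "inv\<^bsub>?P\<^esub> (\<one>, z) = (\<one>, inv z)" using z inv_P[of \<one> z] by (simp del: inv_DirProd)
    have "(z, \<one>) \<otimes>\<^bsub>?P\<^esub> inv\<^bsub>?P\<^esub> (\<one>, z) \<in> N"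
      unfolding inv_z using z by (auto simp: N_def intro!: exI[of _ 0])
    then have "N #>\<^bsub>?P\<^esub> ((z, \<one>) \<otimes>\<^bsub>?P\<^esub> inv\<^bsub>?P\<^esub> (\<one>, z)) = \<one>\<^bsub>?L\<^esub>"
      using pr_one[OF P.m_closed[OF q(2) P.inv_closed[OF q(1)]]] by blast
    then have "(N #>\<^bsub>?P\<^esub> (z, \<one>)) \<otimes>\<^bsub>?L\<^esub> inv\<^bsub>?L\<^esub> (N #>\<^bsub>?P\<^esub> (\<one>, z)) = \<one>\<^bsub>?L\<^esub>"
      using pr.hom_mult[OF q(2) P.inv_closed[OF q(1)]] pr.hom_inv[OF q(1)] by metis
    then show "N #>\<^bsub>?P\<^esub> (z, \<one>) = N #>\<^bsub>?P\<^esub> (\<one>, z)"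
      by (metis L.inv_closed L.inv_equality L.inv_inv pr.hom_closed[OF q(1)] pr.hom_closed[OF q(2)])
  qed blast
  interpret r: group_hom "G\<lparr>carrier := K\<rparr>" ?L r
    by unfold_locales (rule r)
  show ?thesis
    unfolding derived_transfer_def
  proof (intro ballI allI impI)
    fix x M assume x: "x \<in> H" "x \<in> comm_prods (G\<lparr>carrier := K\<rparr>) M"
    \<comment> \<open>The quotient is abelian, so \<open>x\<close> goes to the identity; membership
      of \<open>(x, \<one>)\<close> in \<open>N\<close> says just that \<open>x\<close> is a product
      of commutators of \<open>H\<close>.\<close>
    have "r x = \<one>\<^bsub>?L\<^esub>" using L.comm_prods_abelian[OF L_abelian r.hom_comm_prods[OF x(2)]] .
    then have "(x, \<one>) \<in> N" using r(2)[OF x(1)] pr_one[of "(x, \<one>)"] x(1) by simp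
    then show "\<exists>M'. x \<in> comm_prods (G\<lparr>carrier := H\<rparr>) M'" using x(1) by (auto simp: N_def)
  qed
qed

end

section \<open>Stable commutator length as a limit\<close>

text \<open>Fekete's subadditivity lemma. The limit is the infimum of the quotients, and it is the
  resulting bound at every single n that later turns limits into explicit inequalities.\<close>

lemma fekete:
  fixes a :: "nat \<Rightarrow> real"
  assumes nonneg: "\<And>n. a n \<ge> 0" and sub: "\<And>m n. m > 0 \<Longrightarrow> n > 0 \<Longrightarrow> a (m + n) \<le> a m + a n"
  obtains L where "(\<lambda>n. a (Suc n) / real (Suc n)) \<longlonglongrightarrow> L" "\<And>n. n > 0 \<Longrightarrow> L * real n \<le> a n" "L \<ge> 0"
proof -
  define S where "S = (\<lambda>n. a n / real n) ` {n. n > 0}"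
  define L where "L = Inf S"
  have ne: "S \<noteq> {}" by (auto simp: S_def intro!: exI[of _ 1])
  have bdd: "bdd_below S" by (rule bdd_belowI[of _ 0]) (auto simp: S_def nonneg)
  have L_le: "L \<le> a n / real n" if "n > 0" for n
    unfolding L_def using that by (intro cInf_lower bdd) (auto simp: S_def)
  have mult: "a (q * N + r) \<le> real q * a N + a r" if "N > 0" "r > 0" for q N r
  proof (induction q)
    case (Suc q)
    have "a (N + (q * N + r)) \<le> a N + a (q * N + r)" using that by (intro sub) auto
    then show ?case using Suc by (simp add: algebra_simps)
  qed simp
  have "(\<lambda>n. a (Suc n) / real (Suc n)) \<longlonglongrightarrow> L"
  proof (rule LIMSEQ_I)
    fix e :: real assume "e > 0"
    then have "\<exists>x\<in>S. x < L + e / 2" using cInf_lessD[OF ne, of "L + e / 2"] by (simp add: L_def)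
    then obtain N where N: "N > 0" "a N / real N < L + e / 2" by (auto simp: S_def)
    define C where "C = (\<Sum>r\<le>N. a r)"
    have C: "a r \<le> C" if "r \<le> N" for r
      unfolding C_def using that nonneg by (intro member_le_sum) auto
    obtain n0 :: nat where n0: "2 * C / e < real n0" using reals_Archimedean2 by blast
    show "\<exists>no. \<forall>n\<ge>no. norm (a (Suc n) / real (Suc n) - L) < e"
    proof (intro exI allI impI)
      fix n assume "n \<ge> n0"
      \<comment> \<open>The remainder runs through 1, ..., N instead of 0, ..., N - 1, because
        subadditivity is available only for positive arguments.\<close>
      define q r where "q = n div N" and "r = n mod N + 1"
      have n: "Suc n = q * N + r" by (simp add: q_def r_def)
      have "r \<le> N" using N by (simp add: r_def Suc_leI)
      have "a (Suc n) \<le> real q * a N + C"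
        unfolding n using mult[of N r q] N C[OF \<open>r \<le> N\<close>] by (simp add: r_def)
      moreover have "real q * a N \<le> real (Suc n) * (a N / real N)"
      proof -
        have "real q * real N \<le> real (Suc n)" using n by (metis le_add1 of_nat_le_iff of_nat_mult)
        then have "real q * real N * (a N / real N) \<le> real (Suc n) * (a N / real N)"
          using nonneg by (intro mult_right_mono) auto
        then show ?thesis using N by simp
      qed
      moreover have "real (Suc n) * (a N / real N) < real (Suc n) * (L + e / 2)"
        using N by (intro mult_strict_left_mono) auto
      moreover have "C < real (Suc n) * (e / 2)"
      proof -
        have "2 * C / e < real (Suc n)" using n0 \<open>n \<ge> n0\<close> by linarith
        then show ?thesis using \<open>e > 0\<close> by (simp add: field_simps)
      qed
      moreover have "real (Suc n) * (L + e) = real (Suc n) * (L + e / 2) + real (Suc n) * (e / 2)"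
        by (simp add: algebra_simps)
      ultimately have "a (Suc n) < real (Suc n) * (L + e)" by linarith
      then have "a (Suc n) / real (Suc n) < L + e" by (simp add: field_simps)
      then show "norm (a (Suc n) / real (Suc n) - L) < e" using L_le[of "Suc n"] by simp
    qed
  qed
  moreover have "L * real n \<le> a n" if "n > 0" for n using L_le[OF that] that by (simp add: field_simps)
  moreover have "L \<ge> 0" unfolding L_def by (rule cInf_greatest[OF ne]) (auto simp: S_def nonneg)
  ultimately show ?thesis using that by blast
qed

lemma tendsto_bounded_diff:
  fixes u v :: "nat \<Rightarrow> real"
  assumes "(\<lambda>n. u (Suc n) / real (Suc n)) \<longlonglongrightarrow> L" and "\<And>n. n > 0 \<Longrightarrow> \<bar>v n - u n\<bar> \<le> c"
  shows "(\<lambda>n. v (Suc n) / real (Suc n)) \<longlonglongrightarrow> L"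
proof -
  have "(\<lambda>n. c / real (Suc n)) \<longlonglongrightarrow> 0"
    using LIMSEQ_Suc[OF lim_const_over_n[of c]] by simp
  then have "(\<lambda>n. (v (Suc n) - u (Suc n)) / real (Suc n)) \<longlonglongrightarrow> 0"
    by (rule Lim_null_comparison[rotated]) (auto intro!: always_eventually divide_right_mono assms(2))
  from tendsto_add[OF assms(1) this] show ?thesis by (simp add: add_divide_distrib[symmetric])
qed

section \<open>Commutator length of chains up to a bounded error\<close>

lemma INF_enat:
  fixes A :: "nat set"
  shows "(INF n\<in>A. enat n) = (if A = {} then \<infinity> else enat (LEAST n. n \<in> A))"
proof (cases "A = {}")
  case False
  then have "(LEAST n. n \<in> A) \<in> A" by (auto intro: LeastI)
  then have "(INF n\<in>A. enat n) = enat (LEAST n. n \<in> A)"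
    by (intro antisym INF_lower INF_greatest) (auto intro: Least_le)
  with False show ?thesis by simp
qed (simp add: top_enat_def)

text \<open>Meaningful only for products of commutators. Infinite length stays with
  \<open>cl_elem\<close> and \<open>cl_chain\<close>, so that limits can be taken in the
  reals.\<close>

definition comm_len :: "('g, 'b) monoid_scheme \<Rightarrow> 'g \<Rightarrow> nat" where
  "comm_len G g = (LEAST n. g \<in> comm_prods G n)"

lemma comm_len_mem: "x \<in> comm_prods G n \<Longrightarrow> x \<in> comm_prods G (comm_len G x)"
  unfolding comm_len_def by (rule LeastI)

lemma comm_len_le: "x \<in> comm_prods G n \<Longrightarrow> comm_len G x \<le> n"
  unfolding comm_len_def by (rule Least_le)

lemma comm_prods_pairs:
  "x \<in> comm_prods G n \<longleftrightarrow> (\<exists>as bs. length as = n \<and> length bs = n \<and> set as \<subseteq> carrier G \<and>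
     set bs \<subseteq> carrier G \<and> lprod G (map2 (comm G) as bs) = x)"
proof
  assume "x \<in> comm_prods G n"
  then obtain ps where ps: "length ps = n" "set ps \<subseteq> carrier G \<times> carrier G"
    "x = lprod G (map (\<lambda>(a, b). comm G a b) ps)"
    by (auto simp: comm_prods_def)
  then show "\<exists>as bs. length as = n \<and> length bs = n \<and> set as \<subseteq> carrier G \<and>
     set bs \<subseteq> carrier G \<and> lprod G (map2 (comm G) as bs) = x"
    by (intro exI[of _ "map fst ps"] exI[of _ "map snd ps"]) (auto simp: zip_map_fst_snd)
next
  assume "\<exists>as bs. length as = n \<and> length bs = n \<and> set as \<subseteq> carrier G \<and>
     set bs \<subseteq> carrier G \<and> lprod G (map2 (comm G) as bs) = x"
  then obtain as bs where "length as = n" "length bs = n" "set as \<subseteq> carrier G"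
     "set bs \<subseteq> carrier G" "lprod G (map2 (comm G) as bs) = x" by blast
  then show "x \<in> comm_prods G n" unfolding comm_prods_def
    by (intro image_eqI[of _ _ "zip as bs"]) (auto dest: set_zip_leftD set_zip_rightD)
qed

lemma cl_elem_eq: "cl_elem G g = (if \<exists>n. g \<in> comm_prods G n then enat (comm_len G g) else \<infinity>)"
  unfolding cl_elem_def comm_prods_pairs[symmetric] INF_enat comm_len_def by auto

definition pow_prod :: "('g, 'b) monoid_scheme \<Rightarrow> 'g list \<Rightarrow> nat \<Rightarrow> 'g" where
  "pow_prod G hs n = lprod G (map (\<lambda>h. h [^]\<^bsub>G\<^esub> n) hs)"

context group
begin

lemma near_conj_prod:
  assumes "length ts = length xs" "set ts \<subseteq> carrier G" "set xs \<subseteq> carrier G"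
  shows "near (length xs) (lprod G (map2 (conj G) ts xs)) (lprod G xs)"
  using assms
proof (induction ts xs rule: list_induct2)
  case (Cons t ts x xs)
  then show ?case
    using near_mult[OF near_conj[of t x], of "length xs" "lprod G (map2 (conj G) ts xs)" "lprod G xs"]
    by (simp add: conj_def)
qed (simp add: near_refl)

text \<open>Bringing a letter to its new place moves it past one block, so each letter costs one
  commutator.\<close>

lemma near_perm:
  assumes "mset xs = mset ys" "set xs \<subseteq> carrier G"
  shows "near (length xs) (lprod G xs) (lprod G ys)"
  using assms
proof (induction xs arbitrary: ys)
  case (Cons x xs)
  then have "x \<in> set ys" by (metis list.set_intros(1) mset_eq_setD)
  then obtain A B where ys: "ys = A @ x # B" by (meson split_list)
  have AB: "mset xs = mset (A @ B)" using Cons.prems by (simp add: ys)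
  have carr: "x \<in> carrier G" "set A \<subseteq> carrier G" "set B \<subseteq> carrier G"
    using Cons.prems(2) mset_eq_setD[OF AB] by auto
  have "near (length xs) (lprod G xs) (lprod G A \<otimes> lprod G B)"
    using Cons.IH[OF AB] Cons.prems carr by (simp add: lprod_append)
  then have "near (0 + length xs) (x \<otimes> lprod G xs) (x \<otimes> (lprod G A \<otimes> lprod G B))"
    using carr by (intro near_mult near_refl) auto
  moreover have "near (1 + 0) (x \<otimes> lprod G A \<otimes> lprod G B) (lprod G A \<otimes> x \<otimes> lprod G B)"
    using carr by (intro near_mult near_refl near_commute) auto
  then have "near 1 (x \<otimes> (lprod G A \<otimes> lprod G B)) (lprod G ys)"
    using carr by (simp add: ys lprod_append m_assoc)
  ultimately show ?case using near_trans by fastforce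
qed (simp add: near_refl)

lemma pow_prod_closed [simp]: "set hs \<subseteq> carrier G \<Longrightarrow> pow_prod G hs n \<in> carrier G"
  unfolding pow_prod_def by (rule lprod_closed) auto

text \<open>Moving \<open>h^b\<close> behind the a-th powers of the remaining terms costs one
  commutator per term, independently of a and b.\<close>

lemma near_pow_prod_add:
  "set hs \<subseteq> carrier G \<Longrightarrow> near (length hs) (pow_prod G hs (a + b)) (pow_prod G hs a \<otimes> pow_prod G hs b)"
proof (induction hs)
  case Nil
  then show ?case by (simp add: near_refl pow_prod_def)
next
  case (Cons h hs)
  let ?a = "h [^] a" and ?b = "h [^] b" and ?A = "pow_prod G hs a" and ?B = "pow_prod G hs b"
  have carr: "?a \<in> carrier G" "?b \<in> carrier G" "?A \<in> carrier G" "?B \<in> carrier G"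
    using Cons.prems by auto
  have "near (0 + length hs) (?a \<otimes> ?b \<otimes> pow_prod G hs (a + b)) (?a \<otimes> ?b \<otimes> (?A \<otimes> ?B))"
    using Cons carr by (intro near_mult near_refl) auto
  moreover have "near (0 + (1 + 0)) (?a \<otimes> (?b \<otimes> ?A \<otimes> ?B)) (?a \<otimes> (?A \<otimes> ?b \<otimes> ?B))"
    using carr by (intro near_mult near_refl near_commute) auto
  ultimately have "near (length hs + 1) (?a \<otimes> ?b \<otimes> pow_prod G hs (a + b)) (?a \<otimes> (?A \<otimes> ?b \<otimes> ?B))"
    using near_trans[of "length hs" _ "?a \<otimes> ?b \<otimes> (?A \<otimes> ?B)" 1] carr by (simp add: m_assoc)
  then show ?case using Cons.prems carr
    by (simp add: pow_prod_def[of G "h # hs"] pow_prod_def[of G hs, symmetric] nat_pow_mult m_assoc)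
qed

lemma near_pow_prod_mult:
  assumes "set hs \<subseteq> carrier G"
  shows "near (k * length hs) (pow_prod G hs (a * k)) (pow_prod G hs a [^] k)"
proof (induction k)
  case 0
  have "pow_prod G hs 0 = \<one>" using assms by (induction hs) (auto simp: pow_prod_def)
  then show ?case by (simp add: near_refl)
next
  case (Suc k)
  have "near (length hs) (pow_prod G hs (a * k + a)) (pow_prod G hs (a * k) \<otimes> pow_prod G hs a)"
    by (rule near_pow_prod_add[OF assms])
  moreover have "near (k * length hs + 0) (pow_prod G hs (a * k) \<otimes> pow_prod G hs a) (pow_prod G hs a [^] k \<otimes> pow_prod G hs a)"
    using Suc assms by (intro near_mult near_refl) auto
  ultimately show ?case using near_trans by (fastforce simp: algebra_simps)
qed

lemma pow_prod_comm_prods_mult: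
  assumes "set hs \<subseteq> carrier G" "pow_prod G hs a [^] k \<in> comm_prods G n"
  shows "pow_prod G hs (a * k) \<in> comm_prods G (k * length hs + n)"
  using near_comm_prods[OF near_pow_prod_mult[OF assms(1)] assms(2)] .

lemma pow_prod_derived:
  assumes "set hs \<subseteq> carrier G" "pow_prod G hs 1 \<in> comm_prods G n"
  shows "\<exists>m. pow_prod G hs k \<in> comm_prods G m"
  using pow_prod_comm_prods_mult[OF assms(1) comm_prods_pow[OF assms(2), of k]] by auto

text \<open>Commutator length along n is subadditive only up to the number of terms; adding that
  number once gives a truly subadditive sequence.\<close>

lemma comm_len_limit:
  assumes hs: "set hs \<subseteq> carrier G" and fin: "pow_prod G hs 1 \<in> comm_prods G n"
  obtains L where "(\<lambda>n. real (comm_len G (pow_prod G hs (Suc n))) / real (Suc n)) \<longlonglongrightarrow> L"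
    "\<And>n M. n > 0 \<Longrightarrow> pow_prod G hs n \<in> comm_prods G M \<Longrightarrow> L * real n \<le> real (M + length hs)"
    "L \<ge> 0"
proof -
  let ?d = "\<lambda>n. comm_len G (pow_prod G hs n)"
  have d: "pow_prod G hs n \<in> comm_prods G (?d n)" for n
  proof -
    obtain m where "pow_prod G hs n \<in> comm_prods G m" using pow_prod_derived[OF hs fin] by blast
    then show ?thesis by (rule comm_len_mem)
  qed
  have "?d (m + n) + length hs \<le> (?d m + length hs) + (?d n + length hs)" for m n
    using comm_len_le[OF near_comm_prods[OF near_pow_prod_add[OF hs] comm_prods_mult[OF d[of m] d[of n]]]] by simp
  then have sub: "real (?d (m + n) + length hs) \<le> real (?d m + length hs) + real (?d n + length hs)" for m n
    by (metis of_nat_add of_nat_le_iff)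
  obtain L where L: "(\<lambda>n. real (?d (Suc n) + length hs) / real (Suc n)) \<longlonglongrightarrow> L"
    "\<And>n. n > 0 \<Longrightarrow> L * real n \<le> real (?d n + length hs)" "L \<ge> 0"
    by (rule fekete[of "\<lambda>n. real (?d n + length hs)"]) (use sub in auto)
  show ?thesis
  proof (rule that[OF _ _ L(3)])
    show "(\<lambda>n. real (?d (Suc n)) / real (Suc n)) \<longlonglongrightarrow> L"
      by (rule tendsto_bounded_diff[OF L(1), where c = "real (length hs)"]) simp
    fix n M assume "n > 0" "pow_prod G hs n \<in> comm_prods G M"
    then show "L * real n \<le> real (M + length hs)"
      using L(2)[of n] comm_len_le[of "pow_prod G hs n" G M] by linarith
  qed
qed

text \<open>The admissible numbers of commutators for the chain and for one fixed product are
  compared as sets, so that finiteness and numerical bounds can both be read off. Reordering and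
  removing conjugators cost \<open>length hs\<close> commutators each.\<close>

lemma cl_chain_set:
  assumes "set hs \<subseteq> carrier G" "mset hs = M"
  obtains A where "cl_chain G M = (INF n\<in>A. enat n)"
    "\<And>n. lprod G hs \<in> comm_prods G n \<Longrightarrow> n \<in> A"
    "\<And>n. n \<in> A \<Longrightarrow> lprod G hs \<in> comm_prods G (2 * length hs + n)"
proof
  let ?A = "{n. \<exists>xs ts. mset xs = M \<and> length ts = length xs \<and> set ts \<subseteq> carrier G \<and>
      lprod G (map2 (conj G) ts xs) \<in> comm_prods G n}"
  show "cl_chain G M = (INF n\<in>?A. enat n)"
    unfolding cl_chain_def by (intro arg_cong[of _ _ "\<lambda>A. INF n\<in>A. enat n"]) (auto simp: comm_prods_pairs; blast)
  have "map2 (conj G) (replicate (length xs) \<one>) xs = xs" if "set xs \<subseteq> carrier G" for xs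
    using that by (induction xs) (auto simp: conj_def)
  then show "n \<in> ?A" if "lprod G hs \<in> comm_prods G n" for n
    using assms that
    by (intro CollectI exI[of _ hs] exI[of _ "replicate (length hs) \<one>"] conjI) (auto simp del: map2_map_map)
  fix n assume "n \<in> ?A"
  then obtain xs ts where xs: "mset xs = mset hs" "length ts = length xs" "set ts \<subseteq> carrier G"
    "lprod G (map2 (conj G) ts xs) \<in> comm_prods G n" using assms(2) by auto
  have len: "length xs = length hs" using xs(1) by (metis size_mset)
  have "set xs \<subseteq> carrier G" using assms(1) xs(1) by (metis mset_eq_setD)
  then have "near (length hs) (lprod G (map2 (conj G) ts xs)) (lprod G xs)"
    using near_conj_prod xs len by metis
  from near_trans[OF near_perm[OF _ assms(1), of xs] near_sym[OF this]] xs(1)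
  have "near (length hs + length hs) (lprod G hs) (lprod G (map2 (conj G) ts xs))" by simp
  from near_comm_prods[OF this xs(4)]
  show "lprod G hs \<in> comm_prods G (2 * length hs + n)" by (simp add: mult_2)
qed

lemma cl_chain_finite_iff:
  assumes "set hs \<subseteq> carrier G"
  shows "cl_chain G (mset hs) \<noteq> \<infinity> \<longleftrightarrow> (\<exists>n. lprod G hs \<in> comm_prods G n)"
  by (rule cl_chain_set[OF assms refl]) (auto simp: INF_enat)

lemma cl_chain_bounds:
  assumes "set hs \<subseteq> carrier G" "lprod G hs \<in> comm_prods G n"
  shows "\<bar>real (the_enat (cl_chain G (mset hs))) - real (comm_len G (lprod G hs))\<bar> \<le> 2 * real (length hs)"
proof (rule cl_chain_set[OF assms(1) refl])
  fix A assume A: "cl_chain G (mset hs) = (INF n\<in>A. enat n)"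
    "\<And>n. lprod G hs \<in> comm_prods G n \<Longrightarrow> n \<in> A"
    "\<And>n. n \<in> A \<Longrightarrow> lprod G hs \<in> comm_prods G (2 * length hs + n)"
  let ?m = "LEAST n. n \<in> A"
  have "comm_len G (lprod G hs) \<in> A" using A(2) comm_len_mem[OF assms(2)] .
  then have "?m \<le> comm_len G (lprod G hs)" "?m \<in> A" by (auto intro: Least_le LeastI)
  moreover have "comm_len G (lprod G hs) \<le> 2 * length hs + ?m"
    using A(3)[OF \<open>?m \<in> A\<close>] by (rule comm_len_le)
  moreover have "the_enat (cl_chain G (mset hs)) = ?m"
    unfolding A(1) INF_enat using \<open>?m \<in> A\<close> by auto
  ultimately show ?thesis by simp
qed

lemma scl_int_limit:
  assumes hs: "set hs \<subseteq> carrier G" and fin: "pow_prod G hs 1 \<in> comm_prods G n"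
    and L: "(\<lambda>n. real (comm_len G (pow_prod G hs (Suc n))) / real (Suc n)) \<longlonglongrightarrow> L"
  shows "scl_int G (mset hs) = L"
  unfolding scl_int_def
proof (rule limI, rule tendsto_bounded_diff[OF L])
  fix n :: nat
  have "pow_chain G n (mset hs) = mset (map (\<lambda>h. h [^] n) hs)" by (simp add: pow_chain_def)
  moreover obtain k where "pow_prod G hs n \<in> comm_prods G k" using pow_prod_derived[OF hs fin] by blast
  moreover have "set (map (\<lambda>h. h [^] n) hs) \<subseteq> carrier G" using hs by auto
  ultimately show "\<bar>real (the_enat (cl_chain G (pow_chain G n (mset hs)))) - real (comm_len G (pow_prod G hs n))\<bar>
      \<le> 2 * real (length hs)"
    using cl_chain_bounds[of "map (\<lambda>h. h [^] n) hs" k] by (simp add: pow_prod_def)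
qed

end

section \<open>Positivity as linear growth of commutator length\<close>

lemma le_limit_const:
  fixes u :: "nat \<Rightarrow> real"
  assumes "(\<lambda>n. u (Suc n) / real (Suc n)) \<longlonglongrightarrow> L" "\<And>n. n > 0 \<Longrightarrow> l * real n \<le> u n + c"
  shows "l \<le> L"
proof (rule LIMSEQ_le_const)
  show "(\<lambda>n. (u (Suc n) + c) / real (Suc n)) \<longlonglongrightarrow> L"
    by (rule tendsto_bounded_diff[OF assms(1), of _ "\<bar>c\<bar>"]) simp
  show "\<exists>N. \<forall>n\<ge>N. l \<le> (u (Suc n) + c) / real (Suc n)"
    using assms(2)[of "Suc _"] by (auto simp: field_simps)
qed

text \<open>Used to remove additive errors: they become negligible on passing to ever higher
  powers.\<close>

lemma le_if_mult_le:
  fixes a b c :: real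
  assumes "\<And>r. r > 0 \<Longrightarrow> a * real r \<le> b * real r + c"
  shows "a \<le> b"
proof (rule ccontr)
  assume "\<not> a \<le> b"
  then have ab: "a - b > 0" by simp
  obtain r :: nat where "\<bar>c\<bar> / (a - b) < real r" using reals_Archimedean2 by blast
  then have r: "\<bar>c\<bar> < (a - b) * real r" using ab by (simp add: field_simps)
  then have "r > 0" by (cases r) auto
  then show False using assms[of r] r by (simp add: algebra_simps)
qed

text \<open>Positivity without limits. It holds vacuously when no positive power is a product of
  commutators, which is the case of infinite scl.\<close>

definition positive_scl :: "('g, 'b) monoid_scheme \<Rightarrow> 'g \<Rightarrow> bool" where
  "positive_scl G g \<longleftrightarrow> (\<exists>c>0. \<forall>n>0. \<forall>M. g [^]\<^bsub>G\<^esub> (n::nat) \<in> comm_prods G M \<longrightarrow> c * real n \<le> real M)"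

lemma (in group) scl_elem_pos_iff:
  assumes g: "g \<in> carrier G"
  shows "scl_elem G g > 0 \<longleftrightarrow> positive_scl G g"
proof (cases "\<exists>k>0. cl_elem G (g [^] (k::nat)) \<noteq> \<infinity>")
  case False
  then have "g [^] n \<notin> comm_prods G M" if "n > 0" for n :: nat and M
    using that by (auto simp: cl_elem_eq split: if_splits)
  then have "positive_scl G g" by (auto simp: positive_scl_def intro!: exI[of _ "1::real"])
  moreover have "scl_elem G g = \<infinity>" by (simp only: scl_elem_def False if_False)
  ultimately show ?thesis by simp
next
  case True
  define k where "k = (LEAST k::nat. k > 0 \<and> cl_elem G (g [^] k) \<noteq> \<infinity>)"
  have k: "k > 0" "cl_elem G (g [^] k) \<noteq> \<infinity>"
    using LeastI_ex[OF True] by (auto simp: k_def)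
  then obtain n0 where n0: "g [^] k \<in> comm_prods G n0" by (auto simp: cl_elem_eq split: if_splits)
  have pw: "pow_prod G [g [^] k] n = g [^] (k * n)" for n
    using g by (simp add: pow_prod_def nat_pow_pow)
  obtain L where L: "(\<lambda>n. real (comm_len G (pow_prod G [g [^] k] (Suc n))) / real (Suc n)) \<longlonglongrightarrow> L"
    "\<And>n M. n > 0 \<Longrightarrow> pow_prod G [g [^] k] n \<in> comm_prods G M \<Longrightarrow> L * real n \<le> real (M + length [g [^] k])" "L \<ge> 0"
    by (rule comm_len_limit[of "[g [^] k]" n0]) (use g n0 pw in auto)
  have fin: "\<exists>m. g [^] (k * n) \<in> comm_prods G m" for n
    using pow_prod_derived[of "[g [^] k]" n0 n] g n0 unfolding pw by auto
  have eq: "the_enat (cl_elem G (g [^] (k * n))) = comm_len G (g [^] (k * n))" for n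
  proof -
    obtain m where "g [^] (k * n) \<in> comm_prods G m" using fin by blast
    then have "cl_elem G (g [^] (k * n)) = enat (comm_len G (g [^] (k * n)))"
      unfolding cl_elem_eq by (intro if_P exI)
    then show ?thesis by simp
  qed
  have "lim (\<lambda>n. real (the_enat (cl_elem G (g [^] (k * Suc n)))) / real (Suc n)) = L"
    using L(1) unfolding pw by (intro limI) (simp only: eq)
  then have scl: "scl_elem G g = ereal (L / real k)"
    by (simp only: scl_elem_def True if_True Let_def k_def[symmetric])
  show ?thesis
  proof
    assume "scl_elem G g > 0"
    then have "L > 0" using scl k by (simp add: zero_less_divide_iff)
    have "L / real k * real n \<le> real M" if n: "n > 0" "g [^] n \<in> comm_prods G M" for n M
    proof -
      \<comment> \<open>The bound from the limit carries an error of 1, the length of the one-term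
        list; it is removed by raising to the power r and letting r grow.\<close>
      have "L * real n * real r \<le> real (k * M) * real r + 1" if "r > 0" for r
      proof -
        have "(g [^] n) [^] (k * r) \<in> comm_prods G (k * r * M)" using comm_prods_pow[OF n(2)] .
        then have "pow_prod G [g [^] k] (n * r) \<in> comm_prods G (k * r * M)"
          using g unfolding pw by (simp add: nat_pow_pow algebra_simps)
        from L(2)[OF _ this] n(1) that show ?thesis by (simp add: algebra_simps)
      qed
      then have "L * real n \<le> real (k * M)"
        by (rule le_if_mult_le)
      then show ?thesis using k by (simp add: field_simps)
    qed
    then show "positive_scl G g" using \<open>L > 0\<close> k unfolding positive_scl_def
      by (intro exI[of _ "L / real k"]) auto
  next
    assume "positive_scl G g"
    then obtain c where c: "c > 0" "\<And>n M. n > 0 \<Longrightarrow> g [^] (n::nat) \<in> comm_prods G M \<Longrightarrow> c * real n \<le> real M"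
      by (auto simp: positive_scl_def)
    have "c * real k \<le> L"
    proof (rule le_limit_const[where u = "\<lambda>n. real (comm_len G (pow_prod G [g [^] k] n))" and c = 0])
      fix n :: nat assume "n > 0"
      obtain m where "g [^] (k * n) \<in> comm_prods G m" using fin by blast
      from c(2)[OF _ comm_len_mem[OF this]] \<open>n > 0\<close> k
      show "c * real k * real n \<le> real (comm_len G (pow_prod G [g [^] k] n)) + 0" by (simp add: pw mult.assoc)
    qed (use L in simp)
    moreover have "c * real k > 0" using c k by simp
    ultimately have "L > 0" by linarith
    then show "scl_elem G g > 0" using scl k by simp
  qed
qed

section \<open>Reduced words\<close>

lemma successively_neq_rev: "successively (\<noteq>) (rev xs) \<longleftrightarrow> successively (\<noteq>) xs"
  unfolding successively_rev by (rule successively_cong) auto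

lemma alternating_glue:
  "successively (\<noteq>) (t # as) \<Longrightarrow> successively (\<noteq>) (t # bs) \<Longrightarrow> successively (\<noteq>) (rev as @ t # bs)"
  by (auto simp: successively_append_iff successively_Cons last_rev successively_neq_rev simp del: successively_rev)

locale amalgam = group G for G (structure) +
  fixes H B K :: "'a set"
  assumes am: "internal_amalgam G H B K"
begin

definition Z :: "'a set" where "Z = H \<inter> B"

definition letters :: "'a set" where "letters = (H \<union> B) - Z"

abbreviation reduced :: "'a list \<Rightarrow> bool" where "reduced \<equiv> reduced_word H B"

abbreviation kinds :: "'a list \<Rightarrow> bool list" where "kinds xs \<equiv> map (\<lambda>x. x \<in> H) xs"

definition word_inv :: "'a list \<Rightarrow> 'a list" where "word_inv xs = rev (map (m_inv G) xs)"

sublocale H: subgroup H G using am by (rule internal_amalgamD)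
sublocale B: subgroup B G using am by (rule internal_amalgamD)
sublocale K: subgroup K G using am by (rule internal_amalgamD)
sublocale Z: subgroup Z G
  unfolding Z_def by (intro subgroups_Inter_pair H.subgroup_axioms B.subgroup_axioms)

lemma HBK: "H \<subseteq> K" "B \<subseteq> K" "Z \<subseteq> K" using internal_amalgamD[OF am] by (auto simp: Z_def)

lemma reduced_iff: "reduced xs \<longleftrightarrow> set xs \<subseteq> letters \<and> successively (\<noteq>) (kinds xs)"
  by (simp add: reduced_word_def letters_def Z_def successively_map)

lemma letters_carrier: "x \<in> letters \<Longrightarrow> x \<in> carrier G"
  by (auto simp: letters_def)

lemma reduced_carrier: "reduced xs \<Longrightarrow> set xs \<subseteq> carrier G"
  by (auto simp: reduced_iff letters_carrier)

lemma letters_K: "letters \<subseteq> K" using HBK by (auto simp: letters_def)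

lemma reduced_K: "reduced xs \<Longrightarrow> lprod G xs \<in> K"
  using letters_K by (intro lprod_in_subgroup K.subgroup_axioms) (auto simp: reduced_iff)

lemma letters_cases: "x \<in> letters \<longleftrightarrow> (x \<in> H \<and> x \<notin> B) \<or> (x \<in> B \<and> x \<notin> H)"
  by (auto simp: letters_def Z_def)

lemma letters_inv:
  assumes "x \<in> letters"
  shows "inv x \<in> letters" "inv x \<in> H \<longleftrightarrow> x \<in> H"
proof -
  have "inv x \<in> S \<longleftrightarrow> x \<in> S" if "subgroup S G" for S
    using that assms letters_carrier[of x] subgroup.m_inv_closed[of S G x] subgroup.m_inv_closed[of S G "inv x"] by auto
  from this[OF H.subgroup_axioms] this[OF B.subgroup_axioms] assms
  show "inv x \<in> letters" "inv x \<in> H \<longleftrightarrow> x \<in> H" by (auto simp: letters_cases)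
qed

lemma mem_mult_left: "subgroup S G \<Longrightarrow> z \<in> S \<Longrightarrow> x \<in> carrier G \<Longrightarrow> z \<otimes> x \<in> S \<longleftrightarrow> x \<in> S"
  by (metis inv_mult_cancel(1) subgroup.m_closed subgroup.m_inv_closed subgroup.mem_carrier)

lemma mem_mult_right: "subgroup S G \<Longrightarrow> z \<in> S \<Longrightarrow> x \<in> carrier G \<Longrightarrow> x \<otimes> z \<in> S \<longleftrightarrow> x \<in> S"
  by (metis inv_closed inv_solve_right m_closed subgroup.m_closed subgroup.m_inv_closed subgroup.mem_carrier)

lemma letters_mult_Z:
  assumes "x \<in> letters" "z \<in> Z"
  shows "x \<otimes> z \<in> letters" "x \<otimes> z \<in> H \<longleftrightarrow> x \<in> H" "z \<otimes> x \<in> letters" "z \<otimes> x \<in> H \<longleftrightarrow> x \<in> H"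
  using assms mem_mult_left[OF H.subgroup_axioms, of z x] mem_mult_left[OF B.subgroup_axioms, of z x]
    mem_mult_right[OF H.subgroup_axioms, of z x] mem_mult_right[OF B.subgroup_axioms, of z x] letters_carrier[of x]
  by (auto simp: letters_cases Z_def)

lemma letters_mult:
  assumes "x \<in> letters" "y \<in> letters" "x \<in> H \<longleftrightarrow> y \<in> H" "x \<otimes> y \<notin> Z"
  shows "x \<otimes> y \<in> letters" "x \<otimes> y \<in> H \<longleftrightarrow> y \<in> H"
proof -
  have "x \<otimes> y \<in> H \<and> x \<in> H \<and> y \<in> H \<or> x \<otimes> y \<in> B \<and> x \<notin> H \<and> y \<notin> H"
    using assms H.m_closed B.m_closed by (auto simp: letters_cases)
  then show "x \<otimes> y \<in> letters" "x \<otimes> y \<in> H \<longleftrightarrow> y \<in> H"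
    using assms(4) by (auto simp: letters_cases Z_def)
qed

text \<open>An element of \<open>Z\<close> can be absorbed into the first letter, which would turn a
  reduced word for it into a reduced word for \<open>\<one>\<close>.\<close>

lemma reduced_not_in_Z:
  assumes "reduced xs" "xs \<noteq> []"
  shows "lprod G xs \<notin> Z"
proof
  assume Z: "lprod G xs \<in> Z"
  obtain x ys where xs: "xs = x # ys" using assms(2) by (cases xs) auto
  let ?z = "inv (lprod G xs)"
  have "x \<in> letters" using assms(1) by (simp add: reduced_iff xs)
  note l = letters_mult_Z(3,4)[OF this Z.m_inv_closed[OF Z]]
  then have "reduced ((?z \<otimes> x) # ys)" using assms(1) by (auto simp: reduced_iff xs)
  moreover have "lprod G ((?z \<otimes> x) # ys) = \<one>"
    using reduced_carrier[OF assms(1)] unfolding xs by (simp add: m_assoc inv_mult_group)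
  ultimately show False using reduced_word_neq_one[OF am] by blast
qed

lemma word_inv_simps [simp]:
  "word_inv [] = []" "word_inv (x # xs) = word_inv xs @ [inv x]" "word_inv (xs @ ys) = word_inv ys @ word_inv xs"
  by (simp_all add: word_inv_def)

lemma kinds_word_inv: "set xs \<subseteq> letters \<Longrightarrow> kinds (word_inv xs) = rev (kinds xs)"
  using letters_inv(2) by (induction xs) auto

lemma set_word_inv: "set xs \<subseteq> letters \<Longrightarrow> set (word_inv xs) \<subseteq> letters"
  using letters_inv(1) by (auto simp: word_inv_def)

lemma reduced_word_inv: "reduced xs \<Longrightarrow> reduced (word_inv xs)"
proof -
  assume "reduced xs"
  then have l: "set xs \<subseteq> letters" "successively (\<noteq>) (kinds xs)" by (simp_all only: reduced_iff)
  show ?thesis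
    unfolding reduced_iff kinds_word_inv[OF l(1)] successively_neq_rev by (intro conjI set_word_inv l)
qed

lemma lprod_word_inv: "set xs \<subseteq> carrier G \<Longrightarrow> lprod G (word_inv xs) = inv (lprod G xs)"
  unfolding word_inv_def by (rule lprod_rev_inv)

lemma set_letters_carrier: "set xs \<subseteq> letters \<Longrightarrow> set xs \<subseteq> carrier G"
  using letters_carrier by auto

lemma word_inv_carrier: "set xs \<subseteq> carrier G \<Longrightarrow> set (word_inv xs) \<subseteq> carrier G"
  by (auto simp: word_inv_def)

text \<open>Reduced words for the same element differ by elements of \<open>Z\<close> inserted
  between consecutive letters, with \<open>z\<close> and \<open>z'\<close> at the ends. The prefix
  form names the element inserted after each letter; quotients of prefixes then compare inner
  blocks.\<close>

lemma reduced_unique: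
  assumes "reduced xs" "reduced ys" "z \<in> Z" "z' \<in> Z" "lprod G xs = z \<otimes> lprod G ys \<otimes> z'"
  shows "kinds xs = kinds ys \<and> (\<forall>i\<le>length xs. \<exists>w\<in>Z. lprod G (take i xs) = z \<otimes> lprod G (take i ys) \<otimes> w)"
  using assms
proof (induction xs arbitrary: ys z)
  case Nil
  have "lprod G ys = inv z \<otimes> lprod G [] \<otimes> inv z'"
    using Nil reduced_carrier[OF Nil(2)] by (simp only: Nil(5)) (simp add: m_assoc)
  also have "\<dots> \<in> Z" using Nil(3,4) by simp
  finally have "ys = []" using reduced_not_in_Z[OF Nil(2)] by blast
  then show ?case using Nil(3) by (auto intro!: bexI[of _ "inv z"])
next
  case (Cons x xs)
  have "ys \<noteq> []"
    using reduced_not_in_Z[OF Cons.prems(1)] Cons.prems(3-5) by auto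
  then obtain y ys' where ys: "ys = y # ys'" by (cases ys) auto
  have xl: "x \<in> letters" "set xs \<subseteq> letters" "successively (\<noteq>) ((x \<in> H) # kinds xs)"
    and yl: "y \<in> letters" "set ys' \<subseteq> letters" "successively (\<noteq>) ((y \<in> H) # kinds ys')"
    using Cons.prems(1,2) by (auto simp: reduced_iff ys)
  have carr: "x \<in> carrier G" "y \<in> carrier G" "z \<in> carrier G" "z' \<in> carrier G"
    "set xs \<subseteq> carrier G" "set ys' \<subseteq> carrier G" "set (word_inv ys') \<subseteq> carrier G"
    using xl yl Cons.prems(3,4) letters_carrier set_letters_carrier word_inv_carrier by auto
  have eq: "x \<otimes> lprod G xs = z \<otimes> (y \<otimes> (lprod G ys' \<otimes> z'))"
    using Cons.prems(5) carr by (simp add: ys m_assoc)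
  let ?u = "inv y \<otimes> inv z"
  have ul: "?u \<in> letters" "?u \<in> H \<longleftrightarrow> y \<in> H"
    using letters_mult_Z(1,2)[OF letters_inv(1)[OF yl(1)] Z.m_inv_closed[OF Cons.prems(3)]] letters_inv(2)[OF yl(1)] by auto
  have prod: "inv (lprod G ys') \<otimes> (?u \<otimes> (x \<otimes> lprod G xs)) = z'"
    unfolding eq using carr by (simp add: m_assoc)
  \<comment> \<open>If the first letters came from different factors, \<open>ys'^-1 u x xs\<close>
    would be a nonempty reduced word with the value \<open>z'\<close> in \<open>Z\<close>. The same
    contradiction, with the merged letter \<open>?u \<otimes> x\<close>, then forces this letter
    into \<open>Z\<close>.\<close>
  have same: "x \<in> H \<longleftrightarrow> y \<in> H"
  proof (rule ccontr)
    assume ne: "\<not> (x \<in> H \<longleftrightarrow> y \<in> H)"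
    let ?w = "word_inv ys' @ ?u # x # xs"
    have "successively (\<noteq>) ((?u \<in> H) # (x \<in> H) # kinds xs)" using xl(3) ne ul by simp
    then have "successively (\<noteq>) (rev (kinds ys') @ (?u \<in> H) # (x \<in> H) # kinds xs)"
      using yl(3) ul by (intro alternating_glue) simp_all
    then have "reduced ?w"
      using xl yl ul set_word_inv by (simp add: reduced_iff kinds_word_inv)
    moreover have "lprod G ?w = z'"
      using carr prod by (simp add: lprod_append lprod_word_inv)
    ultimately show False using reduced_not_in_Z[of ?w] Cons.prems(4) by auto
  qed
  have m: "?u \<otimes> x \<in> Z"
  proof (rule ccontr)
    assume "?u \<otimes> x \<notin> Z"
    from letters_mult[OF ul(1) xl(1) _ this] have ml: "?u \<otimes> x \<in> letters" "?u \<otimes> x \<in> H \<longleftrightarrow> x \<in> H"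
      using ul same by auto
    let ?w = "word_inv ys' @ (?u \<otimes> x) # xs"
    have "successively (\<noteq>) (rev (kinds ys') @ (?u \<otimes> x \<in> H) # kinds xs)"
      using yl(3) xl(3) ml same by (intro alternating_glue) simp_all
    then have "reduced ?w"
      using xl yl ml set_word_inv by (simp add: reduced_iff kinds_word_inv)
    moreover have "lprod G ?w = z'"
      using carr prod by (simp add: lprod_append lprod_word_inv m_assoc)
    ultimately show False using reduced_not_in_Z[of ?w] Cons.prems(4) by auto
  qed
  \<comment> \<open>Since \<open>x = z y ?m\<close>, the tails are compared with the left factor
    \<open>inv ?m\<close>.\<close>
  let ?m = "?u \<otimes> x"
  have "lprod G xs = inv ?m \<otimes> (?u \<otimes> (x \<otimes> lprod G xs))"
    using carr by (simp add: m_assoc inv_mult_group)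
  also have "\<dots> = inv ?m \<otimes> lprod G ys' \<otimes> z'"
    unfolding eq using carr by (simp add: m_assoc)
  finally have "lprod G xs = inv ?m \<otimes> lprod G ys' \<otimes> z'" .
  moreover have "reduced xs" "reduced ys'"
    using xl yl by (auto simp: reduced_iff successively_Cons)
  ultimately have IH: "kinds xs = kinds ys'"
    "\<And>i. i \<le> length xs \<Longrightarrow> \<exists>w\<in>Z. lprod G (take i xs) = inv ?m \<otimes> lprod G (take i ys') \<otimes> w"
    using Cons.IH[of ys' "inv ?m"] m Cons.prems(4) by auto
  show ?case
  proof (intro conjI allI impI)
    show "kinds (x # xs) = kinds ys" using IH(1) same by (simp add: ys)
    fix i assume i: "i \<le> length (x # xs)"
    show "\<exists>w\<in>Z. lprod G (take i (x # xs)) = z \<otimes> lprod G (take i ys) \<otimes> w"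
    proof (cases i)
      case 0
      then show ?thesis using Cons.prems(3) by (auto intro!: bexI[of _ "inv z"])
    next
      case (Suc j)
      then obtain w where w: "w \<in> Z" "lprod G (take j xs) = inv ?m \<otimes> lprod G (take j ys') \<otimes> w"
        using IH(2)[of j] i by auto
      have "set (take j ys') \<subseteq> carrier G" using carr(6) set_take_subset by fast
      then have "lprod G (take j ys') \<in> carrier G" by simp
      then have "lprod G (take i (x # xs)) = z \<otimes> lprod G (take i ys) \<otimes> w"
        using w carr by (simp add: Suc ys m_assoc inv_mult_group)
      then show ?thesis using w by blast
    qed
  qed
qed

lemma reduced_unique_block:
  assumes "reduced xs" "reduced ys" "z \<in> Z" "z' \<in> Z" "lprod G xs = z \<otimes> lprod G ys \<otimes> z'"
    and "i + d \<le> length xs"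
  obtains v w where "v \<in> Z" "w \<in> Z"
    "lprod G (take d (drop i xs)) = v \<otimes> lprod G (take d (drop i ys)) \<otimes> w"
proof -
  have split: "lprod G (take (i + d) us) = lprod G (take i us) \<otimes> lprod G (take d (drop i us))"
    if "set us \<subseteq> carrier G" for us
    unfolding take_add using that by (intro lprod_append) (auto dest!: in_set_takeD in_set_dropD)
  have closed: "lprod G (take i us) \<in> carrier G" "lprod G (take d (drop i us)) \<in> carrier G"
    if "set us \<subseteq> carrier G" for us
    using that by (auto intro!: lprod_closed dest!: in_set_takeD in_set_dropD)
  note c = reduced_carrier[OF assms(1)] reduced_carrier[OF assms(2)]
  note * = reduced_unique[OF assms(1-5), THEN conjunct2, rule_format]
  obtain v where v: "v \<in> Z" "lprod G (take i xs) = z \<otimes> lprod G (take i ys) \<otimes> v"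
    using *[of i] assms(6) by auto
  obtain w where w: "w \<in> Z" "lprod G (take (i + d) xs) = z \<otimes> lprod G (take (i + d) ys) \<otimes> w"
    using *[of "i + d"] assms(6) by blast
  have "lprod G (take d (drop i xs)) = inv (lprod G (take i xs)) \<otimes> lprod G (take (i + d) xs)"
    using split[OF c(1)] closed[OF c(1)] by (simp add: m_assoc)
  also have "\<dots> = inv v \<otimes> lprod G (take d (drop i ys)) \<otimes> w"
    unfolding v(2) w(2) split[OF c(2)] using closed[OF c(2)] v(1) w(1) assms(3)
    by (simp add: m_assoc inv_mult_group)
  finally show ?thesis using that v(1) w(1) by blast
qed

lemma ex_reduced:
  assumes "x \<in> K"
  obtains xs z where "reduced xs" "z \<in> Z" "x = lprod G xs \<otimes> z"
proof -
  obtain ws where ws: "set ws \<subseteq> H \<union> B" "lprod G ws = x"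
    using assms generate_lprod[OF H.subgroup_axioms B.subgroup_axioms] internal_amalgamD(6)[OF am] by metis
  have "\<exists>xs z. reduced xs \<and> z \<in> Z \<and> lprod G ws = lprod G xs \<otimes> z" using ws(1)
  proof (induction "length ws" arbitrary: ws rule: less_induct)
    case less
    have c: "set ws \<subseteq> carrier G" using less.prems by auto
    show ?case
    proof (cases "reduced ws")
      case True
      then show ?thesis using c by (intro exI[of _ ws] exI[of _ \<one>]) simp
    next
      case False
      from less.prems this show ?thesis
      proof (cases rule: not_reduced_wordE)
        case (single z)
        then show ?thesis by (intro exI[of _ "[]"] exI[of _ z]) (auto simp: Z_def)
      next
        case (merge us a b vs)
        have "a \<otimes> b \<in> H \<union> B" using merge(2) H.m_closed B.m_closed by auto
        then have "set (us @ [a \<otimes> b] @ vs) \<subseteq> H \<union> B" using less.prems merge by auto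
        moreover have "lprod G (us @ [a \<otimes> b] @ vs) = lprod G ws"
          using c by (simp add: merge lprod_append m_assoc)
        ultimately show ?thesis using less.hyps[of "us @ [a \<otimes> b] @ vs"] merge by auto
      qed
    qed
  qed
  then show ?thesis using that ws(2) by blast
qed

text \<open>The product of two reduced words forms a tripod: \<open>vs\<close> cancels against its
  inverse, and at the centre at most one letter of each word remains, merging into
  \<open>ks\<close>. The element \<open>z\<close> between the words is part of the induction because
  each cancelled pair leaves an element of \<open>Z\<close>. Equal kinds let the decomposed words
  inherit reducedness.\<close>

lemma reduced_cancellation:
  assumes "reduced xs" "reduced ys" "z \<in> Z"
  shows "\<exists>us ms vs ns ws ks z1 z2. z1 \<in> Z \<and> z2 \<in> Z \<and> length ms \<le> 1 \<and> length ns \<le> 1 \<and> length ks \<le> 1 \<and>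
    set (us @ ms @ vs @ ns @ ws @ ks) \<subseteq> letters \<and>
    kinds (us @ ms @ vs) = kinds xs \<and> kinds (word_inv vs @ ns @ ws) = kinds ys \<and> reduced (us @ ks @ ws) \<and>
    lprod G xs \<otimes> z = z1 \<otimes> lprod G (us @ ms @ vs) \<and> lprod G ys = lprod G (word_inv vs @ ns @ ws) \<otimes> z2 \<and>
    lprod G ks = lprod G ms \<otimes> lprod G ns"
  using assms
proof (induction xs arbitrary: ys z rule: rev_induct)
  case Nil
  then show ?case using reduced_carrier[OF Nil(2)]
    by (rule_tac exI[of _ "[]"], rule_tac exI[of _ "[]"], rule_tac exI[of _ "[]"], rule_tac exI[of _ "[]"],
        rule_tac exI[of _ ys], rule_tac exI[of _ "[]"], rule_tac exI[of _ z], rule_tac exI[of _ \<one>])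
       (auto simp: reduced_iff)
next
  case (snoc p xs)
  have xl: "set xs \<subseteq> letters" "p \<in> letters" "reduced xs" using snoc.prems(1)
    by (auto simp: reduced_iff successively_append_iff)
  have zG: "z \<in> carrier G" using snoc.prems(3) by simp
  have pz: "p \<otimes> z \<in> letters" "p \<otimes> z \<in> H \<longleftrightarrow> p \<in> H"
    using letters_mult_Z[OF xl(2) snoc.prems(3)] by auto
  have c: "set xs \<subseteq> carrier G" "p \<in> carrier G" "lprod G xs \<in> carrier G"
    using xl set_letters_carrier letters_carrier lprod_closed by auto
  have eq: "lprod G (xs @ [p]) \<otimes> z = lprod G xs \<otimes> (p \<otimes> z)"
    using c zG by (simp add: lprod_append m_assoc)
  have eq': "lprod G (xs @ [p \<otimes> z]) = lprod G xs \<otimes> (p \<otimes> z)"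
    using c zG by (simp add: lprod_append)
  have rpz: "reduced (xs @ [p \<otimes> z])" using snoc.prems(1) pz by (simp add: reduced_iff)
  show ?case
  proof (cases ys)
    case Nil
    then show ?thesis using rpz xl pz eq eq' c zG
      by (rule_tac exI[of _ "xs @ [p \<otimes> z]"], rule_tac exI[of _ "[]"], rule_tac exI[of _ "[]"],
          rule_tac exI[of _ "[]"], rule_tac exI[of _ "[]"], rule_tac exI[of _ "[]"],
          rule_tac exI[of _ \<one>], rule_tac exI[of _ \<one>]) auto
  next
    case (Cons q ys')
    have yl: "q \<in> letters" "set ys' \<subseteq> letters" "reduced ys'" and alt: "successively (\<noteq>) ((q \<in> H) # kinds ys')"
      using snoc.prems(2) by (auto simp: Cons reduced_iff successively_Cons)
    have yc: "q \<in> carrier G" "set ys' \<subseteq> carrier G" "lprod G ys' \<in> carrier G"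
      using yl set_letters_carrier letters_carrier lprod_closed by auto
    have altx: "successively (\<noteq>) (kinds xs @ [p \<in> H])" using snoc.prems(1) by (simp add: reduced_iff)
    show ?thesis
    proof (cases "(p \<in> H) = (q \<in> H)")
      case False
      have "reduced ((xs @ [p \<otimes> z]) @ ys)"
        using rpz snoc.prems(2) False pz xl yl by (auto simp: reduced_iff Cons successively_append_iff)
      then show ?thesis using rpz xl pz eq eq' c zG yc yl
        by (rule_tac exI[of _ "xs @ [p \<otimes> z]"], rule_tac exI[of _ "[]"], rule_tac exI[of _ "[]"],
            rule_tac exI[of _ "[]"], rule_tac exI[of _ ys], rule_tac exI[of _ "[]"],
            rule_tac exI[of _ \<one>], rule_tac exI[of _ \<one>]) (auto simp: Cons)
    next
      case same: True
      show ?thesis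
      \<comment> \<open>Cancellation goes on exactly when the two facing letters multiply into
        \<open>Z\<close>; the product is then the new middle element.\<close>
      proof (cases "p \<otimes> z \<otimes> q \<in> Z")
        case False
        from letters_mult[OF pz(1) yl(1) _ False] pz same
        have k: "p \<otimes> z \<otimes> q \<in> letters" "p \<otimes> z \<otimes> q \<in> H \<longleftrightarrow> q \<in> H" by auto
        have "reduced (xs @ [p \<otimes> z \<otimes> q] @ ys')"
          using altx alt k xl yl same by (auto simp: reduced_iff successively_append_iff successively_Cons)
        then show ?thesis using xl pz eq eq' c zG yc yl k
          by (rule_tac exI[of _ xs], rule_tac exI[of _ "[p \<otimes> z]"], rule_tac exI[of _ "[]"],
              rule_tac exI[of _ "[q]"], rule_tac exI[of _ ys'], rule_tac exI[of _ "[p \<otimes> z \<otimes> q]"],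
              rule_tac exI[of _ \<one>], rule_tac exI[of _ \<one>]) (auto simp: Cons)
      next
        case True
        from snoc.IH[OF xl(3) yl(3) True] obtain us ms vs ns ws ks z1 z2 where
          IH: "z1 \<in> Z" "z2 \<in> Z" "length ms \<le> 1" "length ns \<le> 1" "length ks \<le> 1"
            "set (us @ ms @ vs @ ns @ ws @ ks) \<subseteq> letters"
            "kinds (us @ ms @ vs) = kinds xs" "kinds (word_inv vs @ ns @ ws) = kinds ys'" "reduced (us @ ks @ ws)"
            "lprod G xs \<otimes> (p \<otimes> z \<otimes> q) = z1 \<otimes> lprod G (us @ ms @ vs)"
            "lprod G ys' = lprod G (word_inv vs @ ns @ ws) \<otimes> z2"
            "lprod G ks = lprod G ms \<otimes> lprod G ns"
          by blast
        have ic: "set (us @ ms @ vs) \<subseteq> carrier G" "set (word_inv vs @ ns @ ws) \<subseteq> carrier G"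
          using IH(6) letters_carrier set_word_inv[of vs] by auto
        have ic': "lprod G (us @ ms @ vs) \<in> carrier G" "lprod G (word_inv vs @ ns @ ws) \<in> carrier G"
          using ic lprod_closed by blast+
        have "lprod G (xs @ [p]) \<otimes> z = lprod G xs \<otimes> (p \<otimes> z \<otimes> q) \<otimes> inv q"
          unfolding eq using c zG yc by (simp add: m_assoc)
        also have "\<dots> = z1 \<otimes> lprod G ((us @ ms @ vs) @ [inv q])"
          unfolding IH(10) using ic ic' IH(1) yc by (subst lprod_append) (auto simp: m_assoc)
        finally have 1: "lprod G (xs @ [p]) \<otimes> z = z1 \<otimes> lprod G (us @ ms @ vs @ [inv q])" by simp
        have 2: "lprod G ys = lprod G (q # word_inv vs @ ns @ ws) \<otimes> z2"
          using IH(2,11) yc ic' by (simp add: Cons m_assoc)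
        have "kinds (us @ ms @ vs @ [inv q]) = kinds (xs @ [p])"
          using IH(7) letters_inv(2)[OF yl(1)] same by simp
        moreover have "kinds (word_inv (vs @ [inv q]) @ ns @ ws) = kinds ys"
          using IH(8) yc by (simp add: Cons)
        moreover have "lprod G ys = lprod G (word_inv (vs @ [inv q]) @ ns @ ws) \<otimes> z2" using 2 yc by simp
        moreover have "set (us @ ms @ (vs @ [inv q]) @ ns @ ws @ ks) \<subseteq> letters"
          using IH(6) letters_inv(1)[OF yl(1)] by auto
        ultimately show ?thesis using IH(1-5,9,12) 1
          by (rule_tac exI[of _ us], rule_tac exI[of _ ms], rule_tac exI[of _ "vs @ [inv q]"],
              rule_tac exI[of _ ns], rule_tac exI[of _ ws], rule_tac exI[of _ ks],
              rule_tac exI[of _ z1], rule_tac exI[of _ z2]) (intro conjI; assumption)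
      qed
    qed
  qed
qed


end

section \<open>Counting quasimorphisms\<close>

fun window_sum :: "('a list \<Rightarrow> real) \<Rightarrow> nat \<Rightarrow> 'a list \<Rightarrow> real" where
  "window_sum F L [] = 0"
| "window_sum F L (x # xs) = (if L \<le> Suc (length xs) then F (take L (x # xs)) else 0) + window_sum F L xs"

text \<open>The discrepancy comes from windows that start in \<open>us\<close> and reach into
  \<open>vs\<close>, of which there are at most L.\<close>

lemma window_sum_append:
  assumes "\<And>l. \<bar>F l\<bar> \<le> 1"
  shows "\<bar>window_sum F L (us @ vs) - window_sum F L us - window_sum F L vs\<bar> \<le> real (min L (length us))"
proof (induction us)
  case (Cons x us)
  show ?case
  proof (cases "L \<le> Suc (length us)")
    case True
    then show ?thesis using Cons by (cases L) (simp_all add: min_def split: if_splits)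
  next
    case False
    then show ?thesis using Cons assms[of "take L (x # us @ vs)"] by (auto simp: min_def)
  qed
qed simp

lemma window_sum_cong:
  assumes "length us = length vs" "\<And>j. j + L \<le> length us \<Longrightarrow> F (take L (drop j us)) = F (take L (drop j vs))"
  shows "window_sum F L us = window_sum F L vs"
  using assms
proof (induction us vs rule: list_induct2)
  case (Cons x us y vs)
  have "F (take L (drop j us)) = F (take L (drop j vs))" if "j + L \<le> length us" for j
    using Cons.prems[of "Suc j"] that by simp
  then show ?case using Cons.IH Cons.prems[of 0] Cons.hyps by simp
qed simp

lemma window_sum_single: "(\<And>l. \<bar>F l\<bar> \<le> 1) \<Longrightarrow> length ms \<le> 1 \<Longrightarrow> \<bar>window_sum F L ms\<bar> \<le> 1"
  by (cases ms) (auto simp: le_Suc_eq)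

lemma window_sum_append3:
  assumes F: "\<And>l. \<bar>F l\<bar> \<le> 1" and "length ms \<le> 1"
  shows "\<bar>window_sum F L (us @ ms @ vs) - window_sum F L us - window_sum F L vs\<bar> \<le> 2 * real L + 1"
  using window_sum_append[of F L us "ms @ vs", OF F] window_sum_append[of F L ms vs, OF F]
    window_sum_single[of F ms L, OF assms] by (auto simp: min_def split: if_splits)

lemma window_sum_snoc:
  assumes "L > 0"
  shows "window_sum F L (xs @ [x]) = window_sum F L xs +
    (if L \<le> Suc (length xs) then F (drop (Suc (length xs) - L) (xs @ [x])) else 0)"
proof (induction xs)
  case Nil
  then show ?case using assms by (auto simp: le_Suc_eq)
next
  case (Cons y xs)
  consider "L \<le> Suc (length xs)" | "L = Suc (Suc (length xs))" | "L > Suc (Suc (length xs))" by linarith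
  then show ?case
  proof cases
    case 1
    then have "Suc (Suc (length xs)) - L = Suc (Suc (length xs) - L)" by simp
    then show ?thesis using 1 Cons by (simp add: take_Cons' split: if_splits)
  next
    case 2
    then show ?thesis using Cons by simp
  next
    case 3
    then show ?thesis using Cons by simp
  qed
qed

text \<open>The induction matches the first window of \<open>xs\<close> with the last window of the
  inverted word.\<close>

lemma window_sum_rev:
  assumes "L > 0" and F: "\<And>l. set l \<subseteq> S \<Longrightarrow> F (rev (map i l)) = - F l" and "set xs \<subseteq> S"
  shows "window_sum F L (rev (map i xs)) = - window_sum F L xs"
  using assms(3)
proof (induction xs)
  case (Cons x xs)
  have "drop (Suc (length xs) - L) (rev (map i (x # xs))) = rev (map i (take L (x # xs)))"
    by (simp only: take_map[symmetric] rev_take length_map list.size add_Suc_right add_0_right)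
  moreover have "set (take L (x # xs)) \<subseteq> S" using Cons.prems set_take_subset by fast
  ultimately show ?case
    using Cons F[of "take L (x # xs)"] window_sum_snoc[OF assms(1), of F "rev (map i xs)" "i x"] by simp
qed simp

lemma window_sum_suffix:
  assumes "\<And>j. j + L \<le> length (us @ vs) \<Longrightarrow> F (take L (drop j (us @ vs))) \<ge> 0"
  shows "window_sum F L vs \<le> window_sum F L (us @ vs)"
  using assms
proof (induction us)
  case (Cons x us)
  have "F (take L (drop j (us @ vs))) \<ge> 0" if "j + L \<le> length (us @ vs)" for j
    using Cons.prems[of "Suc j"] that by simp
  then show ?case using Cons.IH Cons.prems[of 0] by fastforce
qed simp

lemma alternating_nth:
  "successively (\<noteq>) bs \<Longrightarrow> i < length bs \<Longrightarrow> bs ! i = (hd bs = even i)"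
proof (induction i)
  case (Suc i)
  then have "bs ! i \<noteq> bs ! Suc i" unfolding successively_conv_nth by blast
  then show ?case using Suc by auto
qed (cases bs; simp)

lemma nth_concat_replicate:
  "i < N * length xs \<Longrightarrow> concat (replicate N xs) ! i = xs ! (i mod length xs)"
proof (induction N arbitrary: i)
  case (Suc N)
  show ?case
  proof (cases "i < length xs")
    case False
    then show ?thesis using Suc.IH[of "i - length xs"] Suc.prems by (simp add: nth_append le_mod_geq)
  qed (simp add: nth_append)
qed simp

lemma length_concat_replicate [simp]: "length (concat (replicate N xs)) = N * length xs"
  by (induction N) auto

text \<open>The easy half of Bavard duality: an antisymmetric quasimorphism is at most 3D on a
  commutator, hence at most 4DM on a product of M commutators, so linear growth on the powers of
  \<open>g\<close> forces M to grow linearly.\<close>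

lemma (in group) quasimorphism_positive_scl:
  assumes D: "\<And>x y. x \<in> carrier G \<Longrightarrow> y \<in> carrier G \<Longrightarrow> \<bar>\<phi> (x \<otimes> y) - \<phi> x - \<phi> y\<bar> \<le> D"
    and inv: "\<And>x. x \<in> carrier G \<Longrightarrow> \<phi> (inv x) = - \<phi> x"
    and g: "g \<in> carrier G" and growth: "\<And>n. n \<ge> 2 \<Longrightarrow> \<phi> (g [^] (n::nat)) \<ge> real n - c"
    and "D > 0"
  shows "positive_scl G g"
proof -
  have comm: "\<bar>\<phi> (comm G a b)\<bar> \<le> 3 * D" if "a \<in> carrier G" "b \<in> carrier G" for a b
    using D[of a b] D[of "inv a" "inv b"] D[of "a \<otimes> b" "inv a \<otimes> inv b"] inv[of a] inv[of b] that
    by (simp add: comm_def m_assoc abs_le_iff)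
  have prods: "\<bar>\<phi> x\<bar> \<le> 4 * D * real M" if "x \<in> comm_prods G M" for x M
    using that
  proof (induction M arbitrary: x)
    case 0
    then show ?case using inv[of \<one>] by simp
  next
    case (Suc M)
    then obtain a b y where ab: "a \<in> carrier G" "b \<in> carrier G" "y \<in> comm_prods G M" "x = comm G a b \<otimes> y"
      by (auto simp: comm_prods_Suc)
    from Suc.IH[OF ab(3)] comm[OF ab(1,2)] D[of "comm G a b" y] ab comm_prods_closed[OF ab(3)]
    show ?case by (simp add: algebra_simps abs_le_iff)
  qed
  have "real n \<le> 4 * D * real M" if n: "n > 0" "g [^] n \<in> comm_prods G M" for n M
  \<comment> \<open>The constant c and the exceptional range below 2 are absorbed by applying the
    bound to r-th powers with r growing.\<close>
  proof (rule le_if_mult_le[where c = "\<bar>c\<bar> + 2"])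
    fix r :: nat assume "r > 0"
    have "(g [^] n) [^] r \<in> comm_prods G (r * M)" using comm_prods_pow[OF n(2)] .
    then have "g [^] (n * r) \<in> comm_prods G (r * M)" using g by (simp add: nat_pow_pow)
    from prods[OF this] growth[of "n * r"]
    have "n * r \<ge> 2 \<Longrightarrow> real (n * r) \<le> 4 * D * real (r * M) + c" by linarith
    moreover have "4 * D * real (r * M) \<ge> 0" using \<open>D > 0\<close> by simp
    ultimately have "real (n * r) \<le> 4 * D * real (r * M) + (\<bar>c\<bar> + 2)"
    proof (cases "n * r \<ge> 2")
      case False
      then have "real (n * r) \<le> real 2" by (intro of_nat_mono) linarith
      then have "real (n * r) \<le> 2" by simp
      then show ?thesis using \<open>4 * D * real (r * M) \<ge> 0\<close> by linarith
    qed linarith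
    then show "real n * real r \<le> 4 * D * real M * real r + (\<bar>c\<bar> + 2)" by (simp add: algebra_simps)
  qed
  then show ?thesis unfolding positive_scl_def using \<open>D > 0\<close>
    by (intro exI[of _ "1 / (4 * D)"]) (simp add: field_simps)
qed

context amalgam
begin

section \<open>The quasimorphism counting windows up to double cosets\<close>

definition dcoset :: "'a \<Rightarrow> 'a set" where
  "dcoset w = {z \<otimes> w \<otimes> z' | z z'. z \<in> Z \<and> z' \<in> Z}"

text \<open>Odd under inversion and invariant under \<open>Z\<close> on both sides, which makes
  window sums independent of the reduced word. It vanishes identically if \<open>w\<close> and its
  inverse have the same double coset, the one danger for linear growth.\<close>

definition dcoset_sign :: "'a \<Rightarrow> 'a \<Rightarrow> real" where
  "dcoset_sign w y = of_bool (y \<in> dcoset w) - of_bool (y \<in> dcoset (inv w))"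

lemma dcoset_refl: "w \<in> carrier G \<Longrightarrow> w \<in> dcoset w"
  by (auto simp: dcoset_def intro!: exI[of _ \<one>])

lemma dcoset_biinvariant:
  assumes "w \<in> carrier G" "y \<in> carrier G" "z \<in> Z" "z' \<in> Z"
  shows "z \<otimes> y \<otimes> z' \<in> dcoset w \<longleftrightarrow> y \<in> dcoset w"
proof -
  have *: "a \<otimes> x \<otimes> b \<in> dcoset w" if x: "x \<in> dcoset w" and ab: "a \<in> Z" "b \<in> Z" for a b x
  proof -
    from x obtain c d where "c \<in> Z" "d \<in> Z" "x = c \<otimes> w \<otimes> d" by (auto simp: dcoset_def)
    then have "a \<otimes> x \<otimes> b = (a \<otimes> c) \<otimes> w \<otimes> (d \<otimes> b)" "a \<otimes> c \<in> Z" "d \<otimes> b \<in> Z"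
      using ab assms(1) by (auto simp: m_assoc)
    then show ?thesis unfolding dcoset_def by blast
  qed
  have "inv z \<otimes> (z \<otimes> y \<otimes> z') \<otimes> inv z' = y" using assms by (simp add: m_assoc)
  then show ?thesis using *[of "z \<otimes> y \<otimes> z'" "inv z" "inv z'"] *[of y z z'] assms by auto
qed

lemma dcoset_inv:
  assumes "w \<in> carrier G" "y \<in> carrier G"
  shows "inv y \<in> dcoset (inv w) \<longleftrightarrow> y \<in> dcoset w"
proof -
  have *: "inv x \<in> dcoset (inv v)" if v: "v \<in> carrier G" and "x \<in> dcoset v" for v x
  proof -
    from that obtain c d where "c \<in> Z" "d \<in> Z" "x = c \<otimes> v \<otimes> d" by (auto simp: dcoset_def)
    then have "inv x = inv d \<otimes> inv v \<otimes> inv c" "inv d \<in> Z" "inv c \<in> Z"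
      using v by (auto simp: inv_mult_group m_assoc)
    then show ?thesis unfolding dcoset_def by blast
  qed
  show ?thesis using *[of w y] *[of "inv w" "inv y"] assms by auto
qed

lemma dcoset_sign_biinvariant:
  "w \<in> carrier G \<Longrightarrow> y \<in> carrier G \<Longrightarrow> z \<in> Z \<Longrightarrow> z' \<in> Z \<Longrightarrow>
   dcoset_sign w (z \<otimes> y \<otimes> z') = dcoset_sign w y"
  by (simp add: dcoset_sign_def dcoset_biinvariant)

lemma dcoset_sign_inv:
  "w \<in> carrier G \<Longrightarrow> y \<in> carrier G \<Longrightarrow> dcoset_sign w (inv y) = - dcoset_sign w y"
  using dcoset_inv[of w y] dcoset_inv[of "inv w" y] by (simp add: dcoset_sign_def)

definition word_count :: "nat \<Rightarrow> 'a \<Rightarrow> 'a list \<Rightarrow> real" where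
  "word_count L w = window_sum (\<lambda>l. dcoset_sign w (lprod G l)) L"

lemma dcoset_sign_bound: "\<bar>dcoset_sign w (lprod G l)\<bar> \<le> 1"
  by (simp add: dcoset_sign_def)

lemma word_count_unique:
  assumes w: "w \<in> carrier G" and "reduced xs" "reduced ys" "z \<in> Z" "z' \<in> Z" "lprod G xs = z \<otimes> lprod G ys \<otimes> z'"
  shows "word_count L w xs = word_count L w ys"
proof -
  have kinds: "kinds xs = kinds ys" using reduced_unique[OF assms(2-6)] by blast
  then have len: "length xs = length ys" by (metis length_map)
  have "dcoset_sign w (lprod G (take L (drop j xs))) = dcoset_sign w (lprod G (take L (drop j ys)))"
    if j: "j + L \<le> length xs" for j
  proof -
    have "lprod G (take L (drop j ys)) \<in> carrier G"
      using reduced_carrier[OF assms(3)] by (auto intro!: lprod_closed dest!: in_set_takeD in_set_dropD)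
    with reduced_unique_block[OF assms(2-6) j] show ?thesis
      using dcoset_sign_biinvariant[OF w] by metis
  qed
  then show ?thesis unfolding word_count_def by (rule window_sum_cong[OF len])
qed

lemma word_count_inv:
  assumes w: "w \<in> carrier G" and "set xs \<subseteq> carrier G" "L > 0"
  shows "word_count L w (word_inv xs) = - word_count L w xs"
  unfolding word_count_def word_inv_def
proof (rule window_sum_rev[OF assms(3) _ assms(2)])
  fix l assume "set l \<subseteq> carrier G"
  then show "dcoset_sign w (lprod G (rev (map (m_inv G) l))) = - dcoset_sign w (lprod G l)"
    using w by (simp add: lprod_rev_inv dcoset_sign_inv del: rev_map)
qed

text \<open>Elements of \<open>Z\<close> are allowed on both sides of the word, so the count is
  insensitive to such factors; the choice is harmless by \<open>word_count_unique\<close>.\<close>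

definition count_qm :: "nat \<Rightarrow> 'a \<Rightarrow> 'a \<Rightarrow> real" where
  "count_qm L w x = word_count L w (SOME xs. reduced xs \<and> (\<exists>z\<in>Z. \<exists>z'\<in>Z. x = z \<otimes> lprod G xs \<otimes> z'))"

lemma count_qm_eq:
  assumes w: "w \<in> carrier G" and xs: "reduced xs" "z \<in> Z" "z' \<in> Z" "x = z \<otimes> lprod G xs \<otimes> z'"
  shows "count_qm L w x = word_count L w xs"
proof -
  define ys where "ys = (SOME xs. reduced xs \<and> (\<exists>z\<in>Z. \<exists>z'\<in>Z. x = z \<otimes> lprod G xs \<otimes> z'))"
  have "reduced ys \<and> (\<exists>z\<in>Z. \<exists>z'\<in>Z. x = z \<otimes> lprod G ys \<otimes> z')"
    unfolding ys_def by (rule someI[of _ xs]) (use xs in blast)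
  then obtain u u' where ys: "reduced ys" "u \<in> Z" "u' \<in> Z" "x = u \<otimes> lprod G ys \<otimes> u'" by blast
  have c: "lprod G xs \<in> carrier G" "lprod G ys \<in> carrier G" using xs ys reduced_carrier by auto
  have "lprod G ys = inv u \<otimes> (u \<otimes> lprod G ys \<otimes> u') \<otimes> inv u'" using ys c by (simp add: m_assoc)
  also have "\<dots> = (inv u \<otimes> z) \<otimes> lprod G xs \<otimes> (z' \<otimes> inv u')"
    unfolding ys(4)[symmetric] xs(4) using xs ys c by (simp add: m_assoc)
  finally have "word_count L w ys = word_count L w xs"
    using ys xs by (intro word_count_unique[OF w]) auto
  then show ?thesis by (simp add: count_qm_def ys_def)
qed

lemma count_qm_inv:
  assumes w: "w \<in> carrier G" and x: "x \<in> K" and "L > 0"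
  shows "count_qm L w (inv x) = - count_qm L w x"
proof -
  obtain xs z where xs: "reduced xs" "z \<in> Z" "x = lprod G xs \<otimes> z" using ex_reduced[OF x] by blast
  have c: "set xs \<subseteq> carrier G" using reduced_carrier[OF xs(1)] .
  have 1: "count_qm L w x = word_count L w xs"
    using xs c by (intro count_qm_eq[OF w xs(1), of \<one> z]) auto
  have "inv x = inv z \<otimes> lprod G (word_inv xs) \<otimes> \<one>"
    using xs c by (simp add: lprod_word_inv inv_mult_group)
  then have "count_qm L w (inv x) = word_count L w (word_inv xs)"
    using xs by (intro count_qm_eq[OF w reduced_word_inv[OF xs(1)], of "inv z" \<one>]) auto
  also have "\<dots> = - word_count L w xs" by (rule word_count_inv[OF w c \<open>L > 0\<close>])
  finally show ?thesis using 1 by simp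
qed

text \<open>The counts on the three legs of the tripod cancel by antisymmetry. What remains is the
  junction error 2L + 1 for each of the three words.\<close>

lemma count_qm_defect:
  assumes w: "w \<in> carrier G" and xy: "x \<in> K" "y \<in> K" and "L > 0"
  shows "\<bar>count_qm L w (x \<otimes> y) - count_qm L w x - count_qm L w y\<bar> \<le> 6 * real L + 3"
proof -
  let ?c = "word_count L w"
  obtain xs z where xs: "reduced xs" "z \<in> Z" "x = lprod G xs \<otimes> z" using ex_reduced[OF xy(1)] by blast
  obtain ys z' where ys: "reduced ys" "z' \<in> Z" "y = lprod G ys \<otimes> z'" using ex_reduced[OF xy(2)] by blast
  obtain us ms vs ns ws ks z1 z2 where
    *: "z1 \<in> Z" "z2 \<in> Z" "length ms \<le> 1" "length ns \<le> 1" "length ks \<le> 1" and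
    letters: "set (us @ ms @ vs @ ns @ ws @ ks) \<subseteq> letters" and
    kinds: "kinds (us @ ms @ vs) = kinds xs" "kinds (word_inv vs @ ns @ ws) = kinds ys" and
    k: "reduced (us @ ks @ ws)" and
    eqs: "lprod G xs \<otimes> z = z1 \<otimes> lprod G (us @ ms @ vs)" "lprod G ys = lprod G (word_inv vs @ ns @ ws) \<otimes> z2"
      "lprod G ks = lprod G ms \<otimes> lprod G ns"
    using reduced_cancellation[OF xs(1) ys(1) xs(2)] by blast
  have m: "reduced (us @ ms @ vs)" using letters kinds(1) xs(1) unfolding reduced_iff by auto
  have n: "reduced (word_inv vs @ ns @ ws)"
    using letters kinds(2) ys(1) set_word_inv[of vs] unfolding reduced_iff by auto
  note * = * m n k eqs
  have c: "set us \<subseteq> carrier G" "set ms \<subseteq> carrier G" "set vs \<subseteq> carrier G" "set ns \<subseteq> carrier G"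
    "set ws \<subseteq> carrier G" "set ks \<subseteq> carrier G" "set (word_inv vs) \<subseteq> carrier G"
    using reduced_carrier[OF *(6)] reduced_carrier[OF *(7)] reduced_carrier[OF *(8)] by auto
  have x: "x = z1 \<otimes> lprod G (us @ ms @ vs) \<otimes> \<one>" using xs *(1,9) c by (simp add: lprod_append)
  have y: "y = \<one> \<otimes> lprod G (word_inv vs @ ns @ ws) \<otimes> (z2 \<otimes> z')"
    using ys *(2,10) c by (simp add: lprod_append m_assoc)
  have "x \<otimes> y = z1 \<otimes> lprod G (us @ ks @ ws) \<otimes> (z2 \<otimes> z')"
    unfolding x y using *(1,2,11) ys(2) c by (simp add: lprod_append lprod_word_inv m_assoc)
  then have "count_qm L w (x \<otimes> y) = ?c (us @ ks @ ws)"
    using * ys by (intro count_qm_eq[OF w *(8), of z1 "z2 \<otimes> z'"]) auto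
  moreover have "count_qm L w x = ?c (us @ ms @ vs)"
    using * x by (intro count_qm_eq[OF w *(6), of z1 \<one>]) auto
  moreover have "count_qm L w y = ?c (word_inv vs @ ns @ ws)"
    using * ys y by (intro count_qm_eq[OF w *(7), of \<one> "z2 \<otimes> z'"]) auto
  moreover have "?c (word_inv vs) = - ?c vs" by (rule word_count_inv[OF w c(3) \<open>L > 0\<close>])
  moreover have "\<bar>?c (us @ ks @ ws) - ?c us - ?c ws\<bar> \<le> 2 * real L + 1"
    "\<bar>?c (us @ ms @ vs) - ?c us - ?c vs\<bar> \<le> 2 * real L + 1"
    "\<bar>?c (word_inv vs @ ns @ ws) - ?c (word_inv vs) - ?c ws\<bar> \<le> 2 * real L + 1"
    unfolding word_count_def using * by (intro window_sum_append3 dcoset_sign_bound; simp)+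
  ultimately show ?thesis by linarith
qed

end

section \<open>Positivity in malnormal amalgamated products\<close>

lemma (in group) positive_scl_power:
  assumes "g \<in> carrier G" "r > 0" "positive_scl G (g [^] (r::nat))"
  shows "positive_scl G g"
proof -
  obtain c where c: "c > 0" "\<And>n M. n > 0 \<Longrightarrow> (g [^] r) [^] (n::nat) \<in> comm_prods G M \<Longrightarrow> c * real n \<le> real M"
    using assms(3) by (auto simp: positive_scl_def)
  have "c / real r * real n \<le> real M" if n: "n > 0" "g [^] n \<in> comm_prods G M" for n M
  proof -
    have "(g [^] n) [^] r \<in> comm_prods G (r * M)" using comm_prods_pow[OF n(2)] .
    then have "(g [^] r) [^] n \<in> comm_prods G (r * M)"
      using assms(1) by (simp add: nat_pow_pow mult.commute)
    from c(2)[OF n(1) this] show ?thesis using assms(2) by (simp add: field_simps)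
  qed
  then show ?thesis using c(1) assms(2) unfolding positive_scl_def by (intro exI[of _ "c / real r"]) auto
qed

lemma (in group) positive_scl_conj:
  assumes "g \<in> carrier G" "t \<in> carrier G" "positive_scl G (t \<otimes> g \<otimes> inv t)"
  shows "positive_scl G g"
proof -
  have "(t \<otimes> g \<otimes> inv t) [^] n \<in> comm_prods G M" if "g [^] n \<in> comm_prods G M" for n :: nat and M
    using comm_prods_pow_conj[of "inv t" "t \<otimes> g \<otimes> inv t" n M] assms that by (simp add: m_assoc)
  then show ?thesis using assms(3) unfolding positive_scl_def by blast
qed

text \<open>The same constant serves both groups, since the transfer preserves the ratio of
  commutators to exponent.\<close>

lemma (in group) positive_scl_transfer:
  assumes H: "subgroup H G" "subgroup K G" and T: "comm_length_transfer G H K"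
    and g: "g \<in> H" "positive_scl (G\<lparr>carrier := H\<rparr>) g"
  shows "positive_scl (G\<lparr>carrier := K\<rparr>) g"
proof -
  interpret H: group "G\<lparr>carrier := H\<rparr>" using H(1) by (rule subgroup_group)
  interpret SH: subgroup H G by fact
  obtain c where c: "c > 0" "\<And>n M. n > 0 \<Longrightarrow> g [^] (n::nat) \<in> comm_prods (G\<lparr>carrier := H\<rparr>) M \<Longrightarrow> c * real n \<le> real M"
    using g(2) by (auto simp: positive_scl_def nat_pow_consistent[symmetric])
  have "c * real n \<le> real M" if n: "n > 0" "g [^] n \<in> comm_prods (G\<lparr>carrier := K\<rparr>) M" for n M
  proof -
    have "g [^] n \<in> H" using H.nat_pow_closed[of g n] g(1) by (simp add: nat_pow_consistent[symmetric])
    then obtain k where k: "k > 0" "(g [^] n) [^] k \<in> comm_prods (G\<lparr>carrier := H\<rparr>) (k * M)"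
      using T n(2) unfolding comm_length_transfer_def by blast
    then have "g [^] (n * k) \<in> comm_prods (G\<lparr>carrier := H\<rparr>) (k * M)" using g(1) by (simp add: nat_pow_pow)
    from c(2)[OF _ this] n(1) k(1) show ?thesis by (simp add: algebra_simps)
  qed
  then show ?thesis using c(1) unfolding positive_scl_def nat_pow_consistent[symmetric] by blast
qed

text \<open>In the application, torsion-freeness of \<open>H\<close> comes from positivity of scl on
  \<open>H\<close>, that of \<open>B\<close> from the rationals.\<close>

locale malnormal_amalgam = amalgam +
  assumes mal: "malnormal G Z H"
    and torsion_free_H: "\<And>h n. h \<in> H \<Longrightarrow> h [^] (n::nat) = \<one> \<Longrightarrow> n > 0 \<Longrightarrow> h = \<one>"
    and torsion_free_B: "\<And>b n. b \<in> B \<Longrightarrow> b [^] (n::nat) = \<one> \<Longrightarrow> n > 0 \<Longrightarrow> b = \<one>"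
begin

lemma malnormalD:
  "h \<in> H \<Longrightarrow> h \<notin> Z \<Longrightarrow> v \<in> Z \<Longrightarrow> h \<otimes> v \<otimes> inv h \<in> Z \<Longrightarrow> v = \<one>"
proof -
  assume h: "h \<in> H" "h \<notin> Z" "v \<in> Z" "h \<otimes> v \<otimes> inv h \<in> Z"
  then have "h \<otimes> v \<otimes> inv h \<in> Z \<inter> {h \<otimes> z \<otimes> inv h | z. z \<in> Z}" by blast
  then have "h \<otimes> v \<otimes> inv h = \<one>" using mal h unfolding malnormal_def by blast
  then have "inv h \<otimes> (h \<otimes> v \<otimes> inv h) \<otimes> h = \<one>" using h by simp
  then show "v = \<one>" using h by (simp add: m_assoc)
qed

text \<open>With \<open>y = z'^-1 Y\<close>, being self-inverse up to \<open>Z\<close> means that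
  the square of \<open>y\<close> lies in \<open>Z\<close>. This square is centralised by
  \<open>y\<close>, which is the situation that malnormality can exploit.\<close>

lemma dcoset_self_inverse:
  assumes "Y \<in> carrier G" "z \<in> Z" "z' \<in> Z" "Y = z \<otimes> inv Y \<otimes> z'"
  shows "(inv z' \<otimes> Y) \<otimes> (inv z' \<otimes> Y) = inv z' \<otimes> z"
    "(inv z' \<otimes> Y) \<otimes> (inv z' \<otimes> z) \<otimes> inv (inv z' \<otimes> Y) = inv z' \<otimes> z"
proof -
  have "Y \<otimes> (inv z' \<otimes> Y) = z \<otimes> inv Y \<otimes> z' \<otimes> (inv z' \<otimes> Y)"
    by (subst (1) assms(4)) simp
  also have "\<dots> = z" using assms(1-3) by (simp add: m_assoc)
  finally have eq: "Y \<otimes> (inv z' \<otimes> Y) = z" .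
  then show 1: "(inv z' \<otimes> Y) \<otimes> (inv z' \<otimes> Y) = inv z' \<otimes> z" using assms(1-3) by (simp add: m_assoc)
  show "(inv z' \<otimes> Y) \<otimes> (inv z' \<otimes> z) \<otimes> inv (inv z' \<otimes> Y) = inv z' \<otimes> z"
    unfolding 1[symmetric] using assms(1-3) by (simp add: m_assoc inv_mult_group)
qed

text \<open>Here \<open>y\<close> lies in \<open>H\<close> outside \<open>Z\<close> and centralises
  its square in \<open>Z\<close>, which is therefore trivial; an involution contradicts
  torsion-freeness.\<close>

lemma H_letter_not_self_inverse:
  assumes "h \<in> H" "h \<notin> Z" "z \<in> Z" "z' \<in> Z"
  shows "h \<noteq> z \<otimes> inv h \<otimes> z'"
proof
  assume h: "h = z \<otimes> inv h \<otimes> z'"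
  let ?y = "inv z' \<otimes> h"
  note sq = dcoset_self_inverse[OF _ assms(3,4) h]
  have zH: "inv z' \<in> H" using assms(4) by (simp add: Z_def)
  have y: "?y \<in> H" "?y \<notin> Z" using assms zH mem_mult_left[OF Z.subgroup_axioms, of "inv z'" h] by auto
  have "inv z' \<otimes> z = \<one>"
    by (rule malnormalD[OF y]) (use sq assms in auto)
  then have "?y [^] (2::nat) = \<one>" using sq(1) assms y(1) by (simp add: numeral_2_eq_2)
  then have "?y = \<one>" using torsion_free_H[OF y(1), of 2] by simp
  then show False using y(2) by simp
qed

text \<open>Malnormality speaks of \<open>H\<close>, and \<open>B\<close> is abelian in the
  application, so a centre in \<open>B\<close> gives nothing by itself; its two neighbours in
  \<open>H\<close> are therefore included.\<close>

lemma HBH_block_not_self_inverse: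
  assumes h: "h \<in> letters" "h \<in> H" and a: "a \<in> letters" "a \<notin> H" and k: "k \<in> letters" "k \<in> H"
    and z: "z \<in> Z" "z' \<in> Z"
  shows "h \<otimes> a \<otimes> k \<noteq> z \<otimes> inv (h \<otimes> a \<otimes> k) \<otimes> z'"
proof
  let ?Y = "h \<otimes> a \<otimes> k"
  assume Y: "?Y = z \<otimes> inv ?Y \<otimes> z'"
  have c: "h \<in> carrier G" "a \<in> carrier G" "k \<in> carrier G" "z \<in> carrier G" "z' \<in> carrier G"
    using h a k z letters_carrier by auto
  define h' where "h' = inv z' \<otimes> h"
  define v where "v = inv z' \<otimes> z"
  have h': "h' \<in> letters" "h' \<in> H" using letters_mult_Z[OF h(1), of "inv z'"] h(2) z by (auto simp: h'_def)
  have v: "v \<in> Z" using z by (simp add: v_def)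
  have c': "h' \<in> carrier G" "v \<in> carrier G" using h' v by auto
  have y: "inv z' \<otimes> ?Y = h' \<otimes> a \<otimes> k" using c by (simp add: h'_def m_assoc)
  note sq = dcoset_self_inverse[OF _ z Y, unfolded y v_def[symmetric]]
  have aB: "a \<in> B" "a \<notin> Z" using a by (auto simp: letters_cases Z_def)
  have kZ: "k \<notin> Z" using k by (auto simp: letters_def)
  \<comment> \<open>If the square \<open>v\<close> were nontrivial, \<open>k v k^-1\<close> would be
    a letter, and the conjugate of \<open>v\<close> by \<open>h' a k\<close> a reduced word of
    length five with value \<open>v\<close>.\<close>
  have "v = \<one>"
  proof (rule ccontr)
    assume "v \<noteq> \<one>"
    then have u: "k \<otimes> v \<otimes> inv k \<notin> Z" using malnormalD[OF k(2) kZ v] by blast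
    have "k \<otimes> v \<otimes> inv k \<in> H" using k(2) v by (simp add: Z_def)
    then have ul: "k \<otimes> v \<otimes> inv k \<in> letters" "k \<otimes> v \<otimes> inv k \<in> H" using u by (auto simp: letters_def)
    have "reduced [h', a, k \<otimes> v \<otimes> inv k, inv a, inv h']"
      using ul h' a letters_inv[OF a(1)] letters_inv[OF h'(1)] by (simp add: reduced_iff)
    moreover have "lprod G [h', a, k \<otimes> v \<otimes> inv k, inv a, inv h'] = v"
      using sq(2) c c' by (simp add: m_assoc inv_mult_group)
    ultimately show False using reduced_not_in_Z[of "[h', a, k \<otimes> v \<otimes> inv k, inv a, inv h']"] v by auto
  qed
  then have one: "h' \<otimes> (a \<otimes> (k \<otimes> (h' \<otimes> (a \<otimes> k)))) = \<one>" using sq(1) c c' by (simp add: m_assoc)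
  show False
  \<comment> \<open>Now \<open>(h' a k)^2 = \<one>\<close>; the middle product \<open>k h'\<close>
    decides whether the left side is a reduced word of length six or collapses towards
    \<open>B\<close>.\<close>
  proof (cases "k \<otimes> h' \<in> Z")
    case False
    then have "k \<otimes> h' \<in> letters" "k \<otimes> h' \<in> H" using k(2) h'(2) by (auto simp: letters_def)
    then have "reduced [h', a, k \<otimes> h', a, k]" using h' a k by (simp add: reduced_iff)
    moreover have "lprod G [h', a, k \<otimes> h', a, k] = \<one>" using one c c' by (simp add: m_assoc)
    ultimately show False using reduced_word_neq_one[OF am] by blast
  next
    case True
    let ?b = "a \<otimes> (k \<otimes> h') \<otimes> a"
    have bB: "?b \<in> B" using True aB by (simp add: Z_def)
    have hbk: "h' \<otimes> (?b \<otimes> k) = \<one>" using one c c' by (simp add: m_assoc)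
    have "?b \<in> Z"
    proof (rule ccontr)
      assume "?b \<notin> Z"
      then have "reduced [h', ?b, k]" using bB h' k by (auto simp: reduced_iff letters_cases Z_def)
      moreover have "lprod G [h', ?b, k] = \<one>" using hbk c by simp
      ultimately show False using reduced_word_neq_one[OF am] by blast
    qed
    \<comment> \<open>Conjugation by \<open>k\<close> turns the relation into
      \<open>(k h' a)^2 = \<one>\<close> with \<open>k h' a\<close> in \<open>B\<close>, so that
      \<open>a\<close> would lie in \<open>Z\<close>.\<close>
    have "k \<otimes> (h' \<otimes> (?b \<otimes> k)) \<otimes> inv k = \<one>" using hbk c by simp
    then have "k \<otimes> h' \<otimes> a \<otimes> (k \<otimes> h' \<otimes> a) = \<one>" using c c' by (simp add: m_assoc)
    then have "(k \<otimes> h' \<otimes> a) [^] (2::nat) = \<one>" using c c' by (simp add: numeral_2_eq_2)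
    moreover have "k \<otimes> h' \<otimes> a \<in> B" using True aB by (simp add: Z_def)
    ultimately have "k \<otimes> h' \<otimes> a = \<one>" using torsion_free_B[of _ 2] by simp
    then have "k \<otimes> h' \<otimes> a \<in> Z" by simp
    then show False using mem_mult_left[OF Z.subgroup_axioms True] aB by auto
  qed
qed

text \<open>Even length puts the first and the last letter into different factors, so copies can be
  concatenated.\<close>

lemma even_reduced_power:
  assumes "reduced xs" "even (length xs)"
  shows "reduced (concat (replicate N xs))"
proof (induction N)
  case (Suc N)
  show ?case
  proof (cases "xs = [] \<or> N = 0")
    case True
    then show ?thesis using assms by (cases N) auto
  next
    case False
    then obtain N' where N: "N = Suc N'" by (cases N) auto
    have "last (kinds xs) = (hd (kinds xs) = even (length xs - 1))"
      using alternating_nth[of "kinds xs" "length xs - 1"] assms False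
      by (simp add: reduced_iff last_conv_nth)
    then have "last (kinds xs) \<noteq> hd (kinds xs)" using assms(2) False by (cases xs) auto
    then have "successively (\<noteq>) (kinds xs @ kinds (concat (replicate N xs)))"
      using assms(1) Suc False unfolding successively_append_iff
      by (auto simp: reduced_iff N hd_append)
    then show ?thesis using assms(1) Suc unfolding reduced_iff by auto
  qed
qed simp

text \<open>A window of a periodic word matching the inverse of another one gives a reflection of the
  period; its centre is a letter or a block of three letters that is inverse to itself modulo \<open>Z\<close>.\<close>

lemma periodic_window_not_inverse:
  assumes xs: "reduced xs" "even (length xs)" "xs \<noteq> []"
    and L: "L = 2 * length xs + 1"
    and i: "i + L \<le> N * length xs"
  shows "lprod G (take L (drop i (concat (replicate N xs)))) \<notin>
    dcoset (inv (lprod G (take L (concat (replicate 3 xs)))))"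
proof
  let ?p = "length xs"
  define A where "A = take L (drop i (concat (replicate N xs)))"
  define V where "V = take L (concat (replicate 3 xs))"
  have p: "?p \<ge> 2" using xs(2,3) by (cases xs; cases "tl xs") auto
  have len: "length A = L" "length V = L" using i p by (auto simp: A_def V_def L)
  have "reduced A" "reduced V"
  proof -
    have "reduced (take a (drop b us))" if "reduced us" for us a b
    proof -
      have us: "us = take b us @ take a (drop b us) @ drop a (drop b us)" by (metis append_take_drop_id)
      have "reduced (take b us @ take a (drop b us) @ drop a (drop b us))" using that us by metis
      then show ?thesis by (simp only: reduced_word_def successively_append_iff set_append) auto
    qed
    from this[OF even_reduced_power[OF xs(1,2)], of L i N] this[OF even_reduced_power[OF xs(1,2)], of L 0 3]
    show "reduced A" "reduced V" by (simp_all add: A_def V_def)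
  qed
  have A_nth: "A ! t = xs ! ((i + t) mod ?p)" if "t < L" for t
    using that i by (simp add: A_def nth_concat_replicate)
  have V_nth: "V ! t = xs ! (t mod ?p)" if "t < L" for t
    using that p by (simp add: V_def nth_concat_replicate L)
  have Vc: "set V \<subseteq> carrier G" using reduced_carrier \<open>reduced V\<close> .
  have W_len: "length (word_inv V) = L" using len by (simp add: word_inv_def)
  \<comment> \<open>\<open>L - 1 = 2p\<close> is a multiple of the period p, so inverting
    \<open>V\<close> reflects the indices at 0: position t carries the inverse of the letter of
    index -t modulo p.\<close>
  have W_nth: "word_inv V ! t = inv (xs ! ((2 * ?p - t) mod ?p))" if "t < L" for t
    using that len V_nth[of "2 * ?p - t"] by (simp add: word_inv_def rev_nth L)
  assume "lprod G (take L (drop i (concat (replicate N xs)))) \<in>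
    dcoset (inv (lprod G (take L (concat (replicate 3 xs)))))"
  then obtain z z' where z: "z \<in> Z" "z' \<in> Z" "lprod G A = z \<otimes> lprod G (word_inv V) \<otimes> z'"
    using lprod_word_inv[OF Vc] by (auto simp: dcoset_def A_def V_def)
  note unique = reduced_unique[OF \<open>reduced A\<close> reduced_word_inv[OF \<open>reduced V\<close>] z]
  note block = reduced_unique_block[OF \<open>reduced A\<close> reduced_word_inv[OF \<open>reduced V\<close>] z, unfolded len]
  have xl: "set xs \<subseteq> letters" using xs(1) by (simp add: reduced_iff)
  have kind_xs: "(xs ! t \<in> H) = ((xs ! 0 \<in> H) = even t)" if "t < ?p" for t
    using alternating_nth[of "kinds xs" t] xs that by (simp add: reduced_iff hd_conv_nth)
  have p0: "xs ! 0 \<in> letters" using xl xs(3) by (cases xs) auto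
  \<comment> \<open>Matching letters have the same kind, kinds follow the parity of the index, and p
    is even. So the reflection moves indices by an even amount, and its centre is a letter rather
    than a gap.\<close>
  have even_i: "even (i mod ?p)"
  proof -
    have "kinds A ! 0 = kinds (word_inv V) ! 0" using unique by simp
    then have "(A ! 0 \<in> H) = (word_inv V ! 0 \<in> H)" using len W_len L by (simp add: nth_map)
    then have "(xs ! (i mod ?p) \<in> H) = (xs ! 0 \<in> H)"
      using A_nth[of 0] W_nth[of 0] letters_inv(2)[OF p0] L by simp
    moreover have "i mod ?p < ?p" using xs(3) by simp
    ultimately show ?thesis using kind_xs[of "i mod ?p"] by auto
  qed
  \<comment> \<open>Letter i + t is matched with the inverse of letter -t, so the centre solves i +
    2c = 0 modulo p. The solution in 1, ..., p keeps both c - 1 and c + 1 inside the window of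
    length 2p + 1.\<close>
  define c where "c = ?p - (i mod ?p) div 2"
  have c: "c \<ge> 1" "c \<le> ?p" and ic: "(i + 2 * c) mod ?p = 0"
  proof -
    have lt: "i mod ?p < ?p" using xs(3) by simp
    then have half: "(i mod ?p) div 2 < ?p" by linarith
    then show "c \<ge> 1" "c \<le> ?p" unfolding c_def by linarith+
    have "2 * ((i mod ?p) div 2) = i mod ?p" using even_i by simp
    then have "i mod ?p + 2 * c = 2 * ?p" using half unfolding c_def by linarith
    then have "(i mod ?p + 2 * c) mod ?p = 0" by simp
    then show "(i + 2 * c) mod ?p = 0" by (simp add: mod_simps)
  qed
  \<comment> \<open>Around the centre the reflection swaps the positions c - 1 and c + 1 and fixes
    c, up to inversion of the letters.\<close>
  have refl: "word_inv V ! (c + 1 - t) = inv (A ! (c - 1 + t))" if "t \<le> 2" for t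
  proof -
    have "(2 * ?p - (c + 1 - t)) mod ?p = (i + (c - 1 + t)) mod ?p"
    proof -
      obtain q where q: "i + 2 * c = ?p * q" using ic by (meson mod_0_imp_dvd dvdE)
      have "int (2 * ?p - (c + 1 - t)) - int (i + (c - 1 + t)) = int ?p * (2 - int q)"
      proof -
        have "int i + 2 * int c = int ?p * int q" using q by (metis of_nat_add of_nat_mult of_nat_numeral)
        moreover have "int (2 * ?p - (c + 1 - t)) = 2 * int ?p - (int c + 1 - int t)"
          using that c p by (simp add: of_nat_diff)
        moreover have "int (i + (c - 1 + t)) = int i + (int c - 1 + int t)" using c by simp
        ultimately show ?thesis by (simp add: algebra_simps)
      qed
      then have "int (2 * ?p - (c + 1 - t)) mod int ?p = int (i + (c - 1 + t)) mod int ?p"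
        by (simp add: mod_eq_dvd_iff)
      then show ?thesis by (metis zmod_int of_nat_eq_iff)
    qed
    moreover have "c + 1 - t < L" "c - 1 + t < L" using c that p by (auto simp: L)
    ultimately show ?thesis using A_nth W_nth by simp
  qed
  define a b d where "a = A ! (c - 1)" and "b = A ! c" and "d = A ! (c + 1)"
  have "A ! t \<in> letters" if "t < L" for t
    using \<open>reduced A\<close> len that nth_mem[of t A] by (auto simp: reduced_iff)
  then have l: "a \<in> letters" "b \<in> letters" "d \<in> letters" using c p by (auto simp: a_def b_def d_def L)
  have "(A ! t \<in> H) \<noteq> (A ! Suc t \<in> H)" if "Suc t < L" for t
    using \<open>reduced A\<close> len that by (simp add: reduced_word_def successively_conv_nth)
  from this[of "c - 1"] this[of c] have alt: "(a \<in> H) \<noteq> (b \<in> H)" "(b \<in> H) \<noteq> (d \<in> H)"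
    using c p by (auto simp: a_def b_def d_def L)
  have take_block: "take 3 (drop (c - 1) us) = [us ! (c - 1), us ! c, us ! (c + 1)]"
    "take 1 (drop c us) = [us ! c]" if "length us = L" for us :: "'a list"
  proof -
    have "c + 1 < length us" using that c p by (simp add: L)
    then show "take 3 (drop (c - 1) us) = [us ! (c - 1), us ! c, us ! (c + 1)]" "take 1 (drop c us) = [us ! c]"
      using c by (auto simp: list_eq_iff_nth_eq nth_Cons' less_Suc_eq numeral_3_eq_3)
  qed
  have Wabd: "word_inv V ! (c - 1) = inv d" "word_inv V ! c = inv b" "word_inv V ! (c + 1) = inv a"
    using refl[of 0] refl[of 1] refl[of 2] c by (auto simp: a_def b_def d_def)
  have Aabd: "take 3 (drop (c - 1) A) = [a, b, d]" "take 1 (drop c A) = [b]"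
    using take_block[OF len(1)] by (simp_all add: a_def b_def d_def)
  have cl: "a \<in> carrier G" "b \<in> carrier G" "d \<in> carrier G" using l letters_carrier by auto
  show False
  \<comment> \<open>A centre in \<open>H\<close> suffices alone; a centre in \<open>B\<close> is
    taken with both neighbours, which lie in \<open>H\<close>.\<close>
  proof (cases "b \<in> H")
    case True
    obtain u w where "u \<in> Z" "w \<in> Z" "lprod G (take 1 (drop c A)) = u \<otimes> lprod G (take 1 (drop c (word_inv V))) \<otimes> w"
      by (rule block[of c 1]) (use c p L in auto)
    then have "u \<in> Z" "w \<in> Z" "b = u \<otimes> inv b \<otimes> w"
      using cl unfolding Aabd take_block[OF W_len] Wabd by simp_all
    moreover have "b \<notin> Z" using l by (simp add: letters_def)
    ultimately show False using H_letter_not_self_inverse[OF True] by blast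
  next
    case False
    obtain u w where uw: "u \<in> Z" "w \<in> Z" "lprod G (take 3 (drop (c - 1) A)) = u \<otimes> lprod G (take 3 (drop (c - 1) (word_inv V))) \<otimes> w"
      by (rule block[of "c - 1" 3]) (use c p L in auto)
    moreover have "lprod G [a, b, d] = a \<otimes> b \<otimes> d" using cl by (simp add: m_assoc)
    moreover have "lprod G [inv d, inv b, inv a] = inv (a \<otimes> b \<otimes> d)"
      using cl by (simp add: m_assoc inv_mult_group)
    ultimately have "a \<otimes> b \<otimes> d = u \<otimes> inv (a \<otimes> b \<otimes> d) \<otimes> w"
      unfolding Aabd take_block[OF W_len] Wabd by simp
    then show False using HBH_block_not_self_inverse[of a b d u w] l alt False uw by auto
  qed
qed

text \<open>No window of the periodic word counts negatively, and those starting at the beginning of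
  a period count 1, so the count grows by at least one per period.\<close>

lemma hyperbolic_positive_scl:
  assumes xs: "reduced xs" "even (length xs)" "xs \<noteq> []"
  shows "positive_scl (G\<lparr>carrier := K\<rparr>) (lprod G xs)"
proof -
  interpret GK: group "G\<lparr>carrier := K\<rparr>" by (rule subgroup_group[OF K.subgroup_axioms])
  let ?p = "length xs" and ?W = "\<lambda>N. concat (replicate N xs)"
  define L where "L = 2 * ?p + 1"
  define w where "w = lprod G (take L (?W 3))"
  have p: "?p \<ge> 2" using xs(2,3) by (cases xs; cases "tl xs") auto
  have red: "reduced (?W N)" for N using even_reduced_power[OF xs(1,2)] .
  have xc: "set xs \<subseteq> carrier G" using reduced_carrier[OF xs(1)] .
  have w: "w \<in> carrier G"
    unfolding w_def using reduced_carrier[OF red[of 3]] by (intro lprod_closed) (meson set_take_subset subset_trans)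
  have nonneg: "dcoset_sign w (lprod G (take L (drop i (?W N)))) \<ge> 0" if "i + L \<le> length (?W N)" for i N
    using periodic_window_not_inverse[OF xs L_def, of i N] that by (simp add: dcoset_sign_def w_def)
  have first: "dcoset_sign w w = 1"
    using periodic_window_not_inverse[OF xs L_def, of 0 3] p dcoset_refl[OF w]
    by (simp add: dcoset_sign_def w_def L_def)
  \<comment> \<open>N \<ge> 2 makes a window of length 2p + 1 fit into N + 1 periods. Prepending a
    period adds a window with product \<open>w\<close>, and no negative ones.\<close>
  have step: "word_count L w (?W (Suc N)) \<ge> word_count L w (?W N) + 1" if N: "N \<ge> 2" for N
  proof -
    obtain x ys where x: "xs = x # ys" using xs(3) by (cases xs) auto
    have LN: "L \<le> Suc N * ?p"
    proof -
      have "3 * ?p \<le> Suc N * ?p" using N by (intro mult_right_mono) auto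
      then show ?thesis using p unfolding L_def by linarith
    qed
    have "take L (?W (Suc N)) = take L (?W 3)"
    proof (rule nth_equalityI)
      show "length (take L (?W (Suc N))) = length (take L (?W 3))" using LN p by (simp add: L_def)
      fix t assume "t < length (take L (?W (Suc N)))"
      then have "t < L" "t < Suc N * ?p" "t < 3 * ?p" using LN p by (auto simp: L_def)
      then show "take L (?W (Suc N)) ! t = take L (?W 3) ! t"
        using nth_concat_replicate[of t "Suc N" xs] nth_concat_replicate[of t 3 xs] by (metis nth_take)
    qed
    then have "lprod G (take L (?W (Suc N))) = w" by (simp only: w_def)
    moreover have W: "?W (Suc N) = x # (ys @ ?W N)" by (simp add: x)
    moreover have "L \<le> Suc (length (ys @ ?W N))" using LN by (simp add: x)
    ultimately have "word_count L w (?W (Suc N)) = dcoset_sign w w + word_count L w (ys @ ?W N)"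
      unfolding word_count_def by (simp only: W window_sum.simps if_True)
    moreover have "word_count L w (?W N) \<le> word_count L w (ys @ ?W N)"
      unfolding word_count_def
    proof (rule window_sum_suffix)
      fix j assume "j + L \<le> length (ys @ ?W N)"
      then show "dcoset_sign w (lprod G (take L (drop j (ys @ ?W N)))) \<ge> 0"
        using nonneg[of "Suc j" "Suc N"] by (simp add: x)
    qed
    ultimately show ?thesis using first by simp
  qed
  have growth: "word_count L w (?W N) \<ge> real N - 2" if "N \<ge> 2" for N
    using that
  proof (induction N rule: nat_induct_at_least)
    case base
    have "window_sum (\<lambda>l. dcoset_sign w (lprod G l)) L [] \<le> window_sum (\<lambda>l. dcoset_sign w (lprod G l)) L (?W 2 @ [])"
      by (rule window_sum_suffix) (use nonneg[of _ 2] in simp)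
    then show ?case by (simp add: word_count_def)
  next
    case (Suc N)
    then show ?case using step[of N] by simp
  qed
  have pow: "lprod G (?W N) = lprod G xs [^] N" for N
  proof (induction N)
    case (Suc N)
    have "lprod G (?W (Suc N)) = lprod G xs \<otimes> lprod G (?W N)"
      using reduced_carrier[OF red[of N]] xc by (simp add: lprod_append)
    then show ?case using Suc nat_pow_Suc2[OF lprod_closed[OF xc], of N] by simp
  qed simp
  have "L > 0" by (simp add: L_def)
  show ?thesis
  proof (rule GK.quasimorphism_positive_scl[where \<phi> = "count_qm L w" and D = "6 * real L + 3" and c = 2])
    fix n :: nat assume "n \<ge> 2"
    have "count_qm L w (lprod G xs [^] n) = word_count L w (?W n)"
      using reduced_carrier[OF red[of n]] by (intro count_qm_eq[OF w red[of n], of \<one> \<one>]) (auto simp: pow[symmetric])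
    then show "count_qm L w (lprod G xs [^]\<^bsub>G\<lparr>carrier := K\<rparr>\<^esub> n) \<ge> real n - 2"
      using growth[OF \<open>n \<ge> 2\<close>] by (simp add: nat_pow_consistent[symmetric])
  qed (use w \<open>L > 0\<close> count_qm_defect count_qm_inv reduced_K[OF xs(1)] m_inv_consistent[OF K.subgroup_axioms] in auto)
qed

text \<open>Conjugation by the last letter shortens a word of odd length at least three; what
  remains are single letters and words of even length, which are cyclically reduced.\<close>

lemma amalgam_positive_scl:
  assumes H: "\<And>h. h \<in> H \<Longrightarrow> h \<noteq> \<one> \<Longrightarrow> positive_scl (G\<lparr>carrier := K\<rparr>) h"
    and B: "\<And>b. b \<in> B \<Longrightarrow> b \<noteq> \<one> \<Longrightarrow> positive_scl (G\<lparr>carrier := K\<rparr>) b"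
    and g: "g \<in> K" "g \<noteq> \<one>"
  shows "positive_scl (G\<lparr>carrier := K\<rparr>) g"
proof -
  interpret GK: group "G\<lparr>carrier := K\<rparr>" by (rule subgroup_group[OF K.subgroup_axioms])
  have conj: "positive_scl (G\<lparr>carrier := K\<rparr>) x"
    if "x \<in> K" "t \<in> K" "positive_scl (G\<lparr>carrier := K\<rparr>) (t \<otimes> x \<otimes> inv t)" for x t
    using GK.positive_scl_conj[of x t] that by (simp add: m_inv_consistent[OF K.subgroup_axioms])
  have words: "positive_scl (G\<lparr>carrier := K\<rparr>) (lprod G xs)" if "reduced xs" "xs \<noteq> []" for xs
    using that
  proof (induction "length xs" arbitrary: xs rule: less_induct)
    case less
    have xl: "set xs \<subseteq> letters" using less.prems(1) by (simp add: reduced_iff)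
    consider "even (length xs)" | x where "xs = [x]" | x ys y where "odd (length xs)" "xs = x # ys @ [y]" "ys \<noteq> []"
    proof (cases xs)
      case (Cons x us)
      then show ?thesis using that by (cases us rule: rev_cases) (auto, fastforce)
    qed (use less.prems in auto)
    then show ?case
    proof cases
      case 1
      then show ?thesis using hyperbolic_positive_scl less.prems by blast
    next
      case (2 x)
      then have x: "x \<in> letters" using xl by simp
      then have "x \<noteq> \<one>" using Z.one_closed by (auto simp: letters_def)
      then show ?thesis using H[of x] B[of x] x letters_carrier[OF x] by (auto simp: 2 letters_def)
    next
      case (3 x ys y)
      have l: "x \<in> letters" "y \<in> letters" "set ys \<subseteq> letters" using xl by (auto simp: 3)
      have c: "x \<in> carrier G" "y \<in> carrier G" "set ys \<subseteq> carrier G" "lprod G ys \<in> carrier G"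
        using l letters_carrier set_letters_carrier lprod_closed by auto
      have "kinds xs ! (length xs - 1) = (hd (kinds xs) = even (length xs - 1))"
        using less.prems by (intro alternating_nth) (auto simp: reduced_iff)
      then have same: "(y \<in> H) = (x \<in> H)" using 3(1) by (simp add: 3(2) nth_append)
      have alt: "successively (\<noteq>) ((x \<in> H) # kinds ys)" "reduced ys"
        using less.prems(1) by (auto simp: reduced_iff 3(2) successively_Cons successively_append_iff)
      have eq: "y \<otimes> lprod G xs \<otimes> inv y = (y \<otimes> x) \<otimes> lprod G ys"
        using c by (simp add: 3(2) lprod_append m_assoc)
      have "positive_scl (G\<lparr>carrier := K\<rparr>) (y \<otimes> lprod G xs \<otimes> inv y)"
      \<comment> \<open>If \<open>y x\<close> lies in \<open>Z\<close>, it is absorbed into the next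
        letter, and the word loses two letters instead of one.\<close>
      proof (cases "y \<otimes> x \<in> Z")
        case False
        have "y \<otimes> x \<in> letters" "y \<otimes> x \<in> H \<longleftrightarrow> x \<in> H" using letters_mult[OF l(2,1) same False] by auto
        then have "reduced ((y \<otimes> x) # ys)" using alt l by (simp add: reduced_iff)
        then have "positive_scl (G\<lparr>carrier := K\<rparr>) (lprod G ((y \<otimes> x) # ys))"
          by (intro less.hyps) (auto simp: 3(2))
        then show ?thesis unfolding eq by simp
      next
        case True
        obtain u us where ys: "ys = u # us" using 3(3) by (cases ys) auto
        have u: "u \<in> letters" using l by (simp add: ys)
        from letters_mult_Z(3,4)[OF u True]
        have "reduced ((y \<otimes> x \<otimes> u) # us)" using alt(2) by (simp add: reduced_iff ys)
        then have "positive_scl (G\<lparr>carrier := K\<rparr>) (lprod G ((y \<otimes> x \<otimes> u) # us))"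
          by (intro less.hyps) (auto simp: 3(2) ys)
        moreover have "lprod G ((y \<otimes> x \<otimes> u) # us) = y \<otimes> lprod G xs \<otimes> inv y"
          unfolding eq using c by (simp add: ys m_assoc)
        ultimately show ?thesis by simp
      qed
      moreover have "y \<in> K" using l letters_K by blast
      ultimately show ?thesis using conj[OF reduced_K[OF less.prems(1)]] by blast
    qed
  qed
  obtain xs z where xs: "reduced xs" "z \<in> Z" "g = lprod G xs \<otimes> z" using ex_reduced[OF g(1)] by blast
  show ?thesis
  proof (cases xs rule: rev_cases)
    case Nil
    then show ?thesis using H[of g] g xs by (simp add: Z_def)
  next
    case (snoc ys y)
    have y: "y \<in> letters" using xs(1) by (simp add: reduced_iff snoc)
    have "reduced (ys @ [y \<otimes> z])"
      using xs(1) letters_mult_Z(1,2)[OF y xs(2)] by (simp add: reduced_iff snoc)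
    moreover have "lprod G (ys @ [y \<otimes> z]) = g"
      using reduced_carrier[OF xs(1)] xs(2,3) by (simp add: snoc lprod_append m_assoc)
    ultimately show ?thesis using words[of "ys @ [y \<otimes> z]"] by simp
  qed
qed

end

section \<open>Iterated rational extensions\<close>

context group
begin

lemma comm_length_transfer_refl:
  assumes "subgroup H G"
  shows "comm_length_transfer G H H"
  unfolding comm_length_transfer_def
  using subgroup.mem_carrier[OF assms] by (auto intro!: exI[of _ "1::nat"])

lemma comm_length_transfer_trans:
  assumes "subgroup H G" "subgroup K G" "H \<subseteq> K"
    and "comm_length_transfer G H K" "comm_length_transfer G K L"
  shows "comm_length_transfer G H L"
  unfolding comm_length_transfer_def
proof (intro ballI allI impI)
  interpret H: group "G\<lparr>carrier := H\<rparr>" by (rule subgroup_group[OF assms(1)])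
  fix x M assume x: "x \<in> H" "x \<in> comm_prods (G\<lparr>carrier := L\<rparr>) M"
  then obtain k where k: "k > 0" "x [^] (k::nat) \<in> comm_prods (G\<lparr>carrier := K\<rparr>) (k * M)"
    using assms(3,5) unfolding comm_length_transfer_def by blast
  have "x [^] k \<in> H" using H.nat_pow_closed[of x k] x(1) by (simp add: nat_pow_consistent[symmetric])
  then obtain l where l: "l > 0" "(x [^] k) [^] (l::nat) \<in> comm_prods (G\<lparr>carrier := H\<rparr>) (l * (k * M))"
    using assms(4) k(2) unfolding comm_length_transfer_def by blast
  have "x \<in> carrier G" using x(1) by (rule subgroup.mem_carrier[OF assms(1)])
  then have "x [^] (k * l) \<in> comm_prods (G\<lparr>carrier := H\<rparr>) (k * l * M)"
    using l(2) by (simp add: nat_pow_pow algebra_simps)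
  then show "\<exists>k>0. x [^] (k::nat) \<in> comm_prods (G\<lparr>carrier := H\<rparr>) (k * M)"
    using k(1) l(1) by (intro exI[of _ "k * l"]) simp
qed

lemma derived_transfer_trans:
  "H \<subseteq> K \<Longrightarrow> derived_transfer G H K \<Longrightarrow> derived_transfer G K L \<Longrightarrow> derived_transfer G H L"
  unfolding derived_transfer_def by blast

lemma rational_ext_derived_transfer:
  assumes "rational_ext mal G H K"
  shows "derived_transfer G H K"
proof -
  obtain A B \<phi> where "group (rat_group A)" "subgroup B G" "\<phi> \<in> iso (rat_group A) (G\<lparr>carrier := B\<rparr>)"
    "internal_amalgam G H B K"
    using assms by (auto simp: rational_ext_def)
  then show ?thesis using rat_subgroup_commute by (blast intro: amalgam_derived_transfer)
qed

lemma rational_ext_positive_scl: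
  assumes ext: "rational_ext True G H K"
    and pos: "\<And>h. h \<in> H \<Longrightarrow> h \<noteq> \<one> \<Longrightarrow> positive_scl (G\<lparr>carrier := H\<rparr>) h"
    and g: "g \<in> K" "g \<noteq> \<one>"
  shows "positive_scl (G\<lparr>carrier := K\<rparr>) g"
proof -
  obtain A B \<phi> where A: "group (rat_group A)" and B: "subgroup B G"
    and \<phi>: "\<phi> \<in> iso (rat_group A) (G\<lparr>carrier := B\<rparr>)" and am: "internal_amalgam G H B K"
    and mal: "malnormal G (H \<inter> B) H"
    using ext by (auto simp: rational_ext_def)
  interpret amalgam G H B K by unfold_locales (rule am)
  interpret GH: group "G\<lparr>carrier := H\<rparr>" by (rule subgroup_group[OF H.subgroup_axioms])
  interpret GB: group "G\<lparr>carrier := B\<rparr>" by (rule subgroup_group[OF B.subgroup_axioms])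
  interpret GK: group "G\<lparr>carrier := K\<rparr>" by (rule subgroup_group[OF K.subgroup_axioms])
  note torsion_free_B = rat_subgroup_torsion_free[OF A B \<phi>]
  interpret malnormal_amalgam G H B K
  proof unfold_locales
    show "malnormal G Z H" using mal by (simp add: Z_def)
    fix h and n :: nat assume h: "h \<in> H" "h [^] n = \<one>" "n > 0"
    show "h = \<one>"
    proof (rule ccontr)
      assume "h \<noteq> \<one>"
      then obtain c where c: "c > 0" "\<And>n M. n > 0 \<Longrightarrow> h [^] (n::nat) \<in> comm_prods (G\<lparr>carrier := H\<rparr>) M \<Longrightarrow> c * real n \<le> real M"
        using pos[OF h(1)] by (auto simp: positive_scl_def nat_pow_consistent[symmetric])
      \<comment> \<open>A torsion element has a power that is the empty product of commutators,
        which positivity excludes.\<close>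
      have "h [^] n \<in> comm_prods (G\<lparr>carrier := H\<rparr>) 0" using h(2) GH.comm_prods_0 by simp
      from c(2)[OF h(3) this] c(1) h(3) show False by (simp add: mult_le_0_iff)
    qed
  qed (rule torsion_free_B)
  have posH: "positive_scl (G\<lparr>carrier := K\<rparr>) h" if "h \<in> H" "h \<noteq> \<one>" for h
    using positive_scl_transfer[OF H.subgroup_axioms K.subgroup_axioms
        rational_ext_comm_length_transfer[OF ext]] pos that by blast
  have posB: "positive_scl (G\<lparr>carrier := K\<rparr>) b" if b: "b \<in> B" "b \<noteq> \<one>" for b
  \<comment> \<open>If the intersection is trivial, \<open>K\<close> retracts onto the abelian group
    \<open>B\<close>, so no positive power of b is a product of commutators. Otherwise
    \<open>B\<close> having rank one puts a nontrivial power of b into \<open>H\<close>, where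
    positivity is known.\<close>
  proof (cases "H \<inter> B = {\<one>}")
    case True
    obtain r where r: "r \<in> hom (G\<lparr>carrier := K\<rparr>) (G\<lparr>carrier := B\<rparr>)" "\<And>b. b \<in> B \<Longrightarrow> r b = b"
      by (rule amalgam_hom[OF am GB.is_group, of "\<lambda>_. \<one>" "\<lambda>b. b"])
        (use True in \<open>auto simp: hom_def\<close>)
    interpret r: group_hom "G\<lparr>carrier := K\<rparr>" "G\<lparr>carrier := B\<rparr>" r by unfold_locales (rule r)
    have abelian: "comm (G\<lparr>carrier := B\<rparr>) x y = \<one>\<^bsub>G\<lparr>carrier := B\<rparr>\<^esub>"
      if "x \<in> carrier (G\<lparr>carrier := B\<rparr>)" "y \<in> carrier (G\<lparr>carrier := B\<rparr>)" for x y
    proof -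
      have xy: "x \<in> B" "y \<in> B" using that by auto
      then have "comm G x y = \<one>"
        using rat_subgroup_commute[OF A B \<phi>, of x y] by (simp add: comm_def m_assoc)
      then show ?thesis using comm_subgroup[OF B xy] by simp
    qed
    have "b [^] n \<notin> comm_prods (G\<lparr>carrier := K\<rparr>) M" if n: "n > 0" for n :: nat and M
    proof
      assume *: "b [^] n \<in> comm_prods (G\<lparr>carrier := K\<rparr>) M"
      have "b [^] n \<in> B" using GB.nat_pow_closed[of b n] b(1) by (simp add: nat_pow_consistent[symmetric])
      then have "b [^] n \<in> comm_prods (G\<lparr>carrier := B\<rparr>) M" using r.hom_comm_prods[OF *] r(2) by simp
      then have "b [^] n = \<one>" using GB.comm_prods_abelian[OF abelian] by simp
      then show False using torsion_free_B[OF b(1) _ n] b(2) by blast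
    qed
    then show ?thesis unfolding positive_scl_def nat_pow_consistent[symmetric]
      by (intro exI[of _ 1]) auto
  next
    case False
    then obtain z where z: "z \<in> H" "z \<in> B" "z \<noteq> \<one>" using H.one_closed B.one_closed by blast
    obtain c and m n :: int where c: "c \<in> B" "b = c [^] m" "z = c [^] n"
      using rat_subgroup_locally_cyclic[OF A B \<phi> b(1) z(2)] by blast
    have cG: "c \<in> carrier G" using c(1) by simp
    have "n \<noteq> 0" using z(3) c(3) by auto
    \<comment> \<open>With b and z powers of a common c, the exponent |n| makes \<open>b^r\<close> a
      power of z; the sign of n is carried along because r is a natural number.\<close>
    define r where "r = nat \<bar>n\<bar>"
    have r: "r > 0" "int r = n * sgn n"
      unfolding r_def using \<open>n \<noteq> 0\<close> abs_sgn[of n] by linarith+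
    have "b [^] r = b [^] int r" by (simp add: int_pow_int)
    also have "\<dots> = c [^] (m * (n * sgn n))" unfolding r(2) c(2) by (rule int_pow_pow[OF cG])
    also have "m * (n * sgn n) = n * (m * sgn n)" by simp
    also have "c [^] (n * (m * sgn n)) = z [^] (m * sgn n)" unfolding c(3) by (rule int_pow_pow[OF cG, symmetric])
    also have "\<dots> \<in> H" using subgroup_int_pow_closed[OF H.subgroup_axioms z(1)] .
    finally have "b [^] r \<in> H" .
    moreover have "b [^] r \<noteq> \<one>" using torsion_free_B[OF b(1) _ r(1)] b(2) by blast
    ultimately have "positive_scl (G\<lparr>carrier := K\<rparr>) (b [^]\<^bsub>G\<lparr>carrier := K\<rparr>\<^esub> r)"
      using posH by (simp add: nat_pow_consistent[symmetric])
    moreover have "b \<in> carrier (G\<lparr>carrier := K\<rparr>)" using b(1) HBK(2) by auto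
    ultimately show ?thesis by (rule_tac GK.positive_scl_power[OF _ r(1)])
  qed
  show ?thesis using amalgam_positive_scl[OF posH posB g] .
qed

section \<open>Comparison of scl on chains\<close>

lemma pow_prod_subgroup: "pow_prod (G\<lparr>carrier := S\<rparr>) hs n = pow_prod G hs n"
  by (simp add: pow_prod_def nat_pow_consistent[symmetric])

text \<open>One inequality is monotonicity in the group. For the other, the product of N-th powers
  is an element of \<open>H\<close> to which the transfer applies; the commutators obtained and the
  error for rearranging its k-th power are both proportional to k, so k cancels.\<close>

lemma scl_int_transfer:
  assumes sub: "subgroup H G" "subgroup K G" "H \<subseteq> K" and T: "comm_length_transfer G H K"
    and hs: "set hs \<subseteq> H" and fin: "lprod G hs \<in> comm_prods (G\<lparr>carrier := H\<rparr>) n"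
  shows "scl_int (G\<lparr>carrier := K\<rparr>) (mset hs) = scl_int (G\<lparr>carrier := H\<rparr>) (mset hs)"
proof -
  let ?H = "G\<lparr>carrier := H\<rparr>" and ?K = "G\<lparr>carrier := K\<rparr>"
  interpret H: group ?H by (rule subgroup_group[OF sub(1)])
  interpret K: group ?K by (rule subgroup_group[OF sub(2)])
  let ?m = "length hs"
  have mono: "x \<in> comm_prods ?K m" if "x \<in> comm_prods ?H m" for x m
    using comm_prods_subgroup_mono[OF sub(1-3)] that by blast
  have hG: "set hs \<subseteq> carrier G" using hs subgroup.subset[OF sub(1)] by blast
  have "map (\<lambda>h. h [^] (1::nat)) hs = hs" using hG by (induction hs) auto
  then have pw1: "pow_prod G hs 1 = lprod G hs" by (simp add: pow_prod_def)
  have finH: "pow_prod ?H hs 1 \<in> comm_prods ?H n" using fin by (simp only: pow_prod_subgroup pw1)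
  have finK: "pow_prod ?K hs 1 \<in> comm_prods ?K n" using mono[OF fin] by (simp only: pow_prod_subgroup pw1)
  have hH: "set hs \<subseteq> carrier ?H" "set hs \<subseteq> carrier ?K" using hs sub(3) by auto
  obtain L where L: "(\<lambda>n. real (comm_len ?H (pow_prod ?H hs (Suc n))) / real (Suc n)) \<longlonglongrightarrow> L"
    "\<And>n M. n > 0 \<Longrightarrow> pow_prod ?H hs n \<in> comm_prods ?H M \<Longrightarrow> L * real n \<le> real (M + ?m)" "L \<ge> 0"
    by (rule H.comm_len_limit[OF hH(1) finH]) (rule that; assumption)
  obtain L' where L': "(\<lambda>n. real (comm_len ?K (pow_prod ?K hs (Suc n))) / real (Suc n)) \<longlonglongrightarrow> L'"
    "\<And>n M. n > 0 \<Longrightarrow> pow_prod ?K hs n \<in> comm_prods ?K M \<Longrightarrow> L' * real n \<le> real (M + ?m)" "L' \<ge> 0"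
    by (rule K.comm_len_limit[OF hH(2) finK]) (rule that; assumption)
  have "L' \<le> L"
  proof (rule le_limit_const[OF L(1), where c = "real ?m"])
    fix N :: nat assume "N > 0"
    obtain k where "pow_prod ?H hs N \<in> comm_prods ?H k" using H.pow_prod_derived[OF hH(1) finH] by blast
    from L'(2)[OF \<open>N > 0\<close>, unfolded pow_prod_subgroup, OF mono[OF comm_len_mem[OF this[unfolded pow_prod_subgroup]]]]
    show "L' * real N \<le> real (comm_len ?H (pow_prod ?H hs N)) + real ?m" by (simp add: pow_prod_subgroup)
  qed
  moreover have "L \<le> L'"
  \<comment> \<open>In 2m, with m the number of terms, one m comes from rearranging the k-th power,
    the other from the limit bound, enlarged to km before dividing by k.\<close>
  proof (rule le_limit_const[OF L'(1), where c = "2 * real ?m"])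
    fix N :: nat assume N: "N > 0"
    obtain k0 where "pow_prod ?K hs N \<in> comm_prods ?K k0" using K.pow_prod_derived[OF hH(2) finK] by blast
    from comm_len_mem[OF this] have d: "pow_prod G hs N \<in> comm_prods ?K (comm_len ?K (pow_prod ?K hs N))"
      by (simp only: pow_prod_subgroup)
    let ?d = "comm_len ?K (pow_prod ?K hs N)"
    have "pow_prod G hs N \<in> H"
      using H.pow_prod_closed[OF hH(1), of N] by (simp add: pow_prod_subgroup)
    then obtain k where k: "k > 0" "pow_prod G hs N [^] k \<in> comm_prods ?H (k * ?d)"
      using T d unfolding comm_length_transfer_def by blast
    then have "pow_prod ?H hs N [^]\<^bsub>?H\<^esub> k \<in> comm_prods ?H (k * ?d)"
      by (simp add: pow_prod_subgroup nat_pow_consistent[symmetric])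
    from L(2)[OF _ H.pow_prod_comm_prods_mult[OF hH(1) this]] N k(1)
    have "L * real (N * k) \<le> real (k * ?m + k * ?d + ?m)" by simp
    also have "\<dots> \<le> real (k * ?m + k * ?d + k * ?m)" using k(1) by (intro of_nat_mono) simp
    finally have "real k * (L * real N) \<le> real k * (real ?d + 2 * real ?m)" by (simp add: algebra_simps)
    then show "L * real N \<le> real ?d + 2 * real ?m" using k(1) by simp
  qed
  ultimately have "L' = L" by simp
  then show ?thesis
    using H.scl_int_limit[OF hH(1) finH L(1)] K.scl_int_limit[OF hH(2) finK L'(1)] by simp
qed

lemma int_chain_mset_subgroup:
  assumes "subgroup S G" "is_chain S c"
  shows "int_chain_mset (G\<lparr>carrier := S\<rparr>) c = int_chain_mset G c" "set_mset (int_chain_mset G c) \<subseteq> S"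
proof -
  have S: "supp c \<subseteq> S" "finite (supp c)" using assms(2) by (auto simp: is_chain_def)
  then show "int_chain_mset (G\<lparr>carrier := S\<rparr>) c = int_chain_mset G c"
    unfolding int_chain_mset_def using m_inv_consistent[OF assms(1)] by (intro sum.cong refl) auto
  show "set_mset (int_chain_mset G c) \<subseteq> S"
    unfolding int_chain_mset_def using S subgroup.m_inv_closed[OF assms(1)]
    by (auto simp: set_mset_sum split: if_splits)
qed

text \<open>\<open>scl_rat\<close> normalises by the least multiple that is a boundary. Both groups
  choose the same one, because \<open>derived_transfer\<close> makes their boundaries supported in
  \<open>H\<close> agree.\<close>

lemma scl_rat_transfer:
  assumes sub: "subgroup H G" "subgroup K G" "H \<subseteq> K" and T: "comm_length_transfer G H K"
    and D: "derived_transfer G H K" and c: "is_chain H c"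
  shows "scl_rat (G\<lparr>carrier := K\<rparr>) c = scl_rat (G\<lparr>carrier := H\<rparr>) c"
proof -
  let ?H = "G\<lparr>carrier := H\<rparr>" and ?K = "G\<lparr>carrier := K\<rparr>"
  interpret H: group ?H by (rule subgroup_group[OF sub(1)])
  interpret K: group ?K by (rule subgroup_group[OF sub(2)])
  define M where "M k = int_chain_mset G (\<lambda>g. real k * c g)" for k :: nat
  have chain: "is_chain H (\<lambda>g. real k * c g)" for k
    using c unfolding is_chain_def supp_def by (auto intro: finite_subset[of _ "{g. c g \<noteq> 0}"])
  then have "is_chain K (\<lambda>g. real k * c g)" for k using sub(3) unfolding is_chain_def by blast
  then have M: "int_chain_mset ?H (\<lambda>g. real k * c g) = M k" "int_chain_mset ?K (\<lambda>g. real k * c g) = M k" for k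
    using int_chain_mset_subgroup(1)[OF sub(1) chain] int_chain_mset_subgroup(1)[OF sub(2)] by (auto simp: M_def)
  have "\<exists>hs. mset hs = M k \<and> set hs \<subseteq> H" for k
    using int_chain_mset_subgroup(2)[OF sub(1) chain, of k] ex_mset[of "M k"] by (auto simp: M_def) (metis set_mset_mset)
  then obtain hs where hs: "\<And>k. mset (hs k) = M k" "\<And>k. set (hs k) \<subseteq> H" by metis
  have cH: "cl_chain ?H (M k) \<noteq> \<infinity> \<longleftrightarrow> (\<exists>n. lprod G (hs k) \<in> comm_prods ?H n)" for k
    using H.cl_chain_finite_iff[of "hs k"] hs by simp
  have cK: "cl_chain ?K (M k) \<noteq> \<infinity> \<longleftrightarrow> (\<exists>n. lprod G (hs k) \<in> comm_prods ?K n)" for k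
    using K.cl_chain_finite_iff[of "hs k"] hs sub(3) by auto
  have fin: "cl_chain ?K (M k) \<noteq> \<infinity> \<longleftrightarrow> cl_chain ?H (M k) \<noteq> \<infinity>" for k
  proof -
    have "lprod G (hs k) \<in> H" using lprod_in_subgroup[OF sub(1) hs(2)] .
    then have "lprod G (hs k) \<in> comm_prods ?K n \<Longrightarrow> \<exists>n'. lprod G (hs k) \<in> comm_prods ?H n'" for n
      using D unfolding derived_transfer_def by blast
    then show ?thesis unfolding cH cK using comm_prods_subgroup_mono[OF sub] by blast
  qed
  have int: "scl_int ?K (M k) = scl_int ?H (M k)" if "cl_chain ?H (M k) \<noteq> \<infinity>" for k
  proof -
    obtain n where "lprod G (hs k) \<in> comm_prods ?H n" using \<open>cl_chain ?H (M k) \<noteq> \<infinity>\<close> unfolding cH by blast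
    from scl_int_transfer[OF sub T hs(2) this] show ?thesis by (simp add: hs(1))
  qed
  show ?thesis
  proof (cases "\<exists>k::nat. k > 0 \<and> (\<forall>g. real k * c g \<in> \<int>) \<and> cl_chain ?H (M k) \<noteq> \<infinity>")
    case True
    define k where "k = (LEAST k::nat. k > 0 \<and> (\<forall>g. real k * c g \<in> \<int>) \<and> cl_chain ?H (M k) \<noteq> \<infinity>)"
    have "cl_chain ?H (M k) \<noteq> \<infinity>" using LeastI_ex[OF True] unfolding k_def by blast
    then have eq: "scl_int ?K (M k) = scl_int ?H (M k)" by (rule int)
    show ?thesis
      unfolding scl_rat_def M fin if_P[OF True] Let_def k_def[symmetric] eq ..
  next
    case False
    then show ?thesis unfolding scl_rat_def M fin by (simp only: if_False)
  qed
qed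

text \<open>The rational chains approximating a real chain have support inside that of
  \<open>c\<close>, hence in \<open>H\<close>; so the two lower limits run over the same set, on
  which the functions agree.\<close>

lemma scl_transfer:
  assumes sub: "subgroup H G" "subgroup K G" "H \<subseteq> K" and T: "comm_length_transfer G H K"
    and D: "derived_transfer G H K" and c: "is_chain H c"
  shows "scl (G\<lparr>carrier := K\<rparr>) c = scl (G\<lparr>carrier := H\<rparr>) c"
proof -
  let ?H = "G\<lparr>carrier := H\<rparr>" and ?K = "G\<lparr>carrier := K\<rparr>"
  have rat: "scl_rat ?K c' = scl_rat ?H c'" if "supp c' \<subseteq> supp c" for c'
    using c that by (intro scl_rat_transfer[OF sub T D]) (auto simp: is_chain_def intro: finite_subset)
  define S where "S = {c'. (\<forall>g. c' g \<in> \<rat>) \<and> supp c' \<subseteq> supp c \<and> scl_rat ?H c' < \<infinity>}"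
  have S: "{c'. (\<forall>g. c' g \<in> \<rat>) \<and> supp c' \<subseteq> supp c \<and> scl_rat ?K c' < \<infinity>} = S"
    using rat by (auto simp: S_def)
  have "Liminf (at c within S) (scl_rat ?K) = Liminf (at c within S) (scl_rat ?H)"
    by (rule Liminf_eq) (simp add: eventually_at_filter rat S_def)
  then show ?thesis using rat[of c] unfolding scl_def S S_def[symmetric] by simp
qed

section \<open>Transfinite induction along the extension\<close>

lemma ordinal_cases:
  fixes j :: "'i::wellorder"
  obtains "j = ord_zero" | j' where "is_succ j' j" | "is_limit j"
proof -
  have "ord_zero \<le> j" unfolding ord_zero_def by (rule Least_le) simp
  then have "is_limit j" if "j \<noteq> ord_zero" "\<nexists>j'. is_succ j' j"
    using that unfolding is_limit_def is_succ_def by (metis order_le_imp_less_or_eq)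
  then show ?thesis using that by blast
qed

lemma ord_zero_le: "ord_zero \<le> (j :: 'i::wellorder)"
  unfolding ord_zero_def by (rule Least_le) simp

text \<open>The lower index is arbitrary, because positivity at a limit is transferred from an
  intermediate stage.\<close>

lemma iterated_transfer:
  fixes S :: "'i::wellorder \<Rightarrow> 'a set"
  assumes it: "iterated_rational_ext mal G S alpha" and "i \<le> j" "j \<le> alpha"
  shows "comm_length_transfer G (S i) (S j) \<and> derived_transfer G (S i) (S j)"
  using assms(2,3)
proof (induction j rule: less_induct)
  case (less j)
  have sub: "subgroup (S l) G" if "l \<le> alpha" for l using it that by (simp add: iterated_rational_ext_def)
  have mono: "S k \<subseteq> S l" if "k \<le> l" "l \<le> alpha" for k l using it that by (simp add: iterated_rational_ext_def)
  have ia: "i \<le> alpha" using less.prems by simp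
  show ?case
  proof (cases "i = j")
    case True
    then show ?thesis using comm_length_transfer_refl[OF sub[OF ia]] by (auto simp: derived_transfer_def)
  next
    case False
    then have ij: "i < j" using less.prems by simp
    show ?thesis
    proof (cases rule: ordinal_cases[of j])
      case 1
      then show ?thesis using ij ord_zero_le[of i] by simp
    next
      case (2 j')
      then have j': "j' < j" "i \<le> j'" using ij unfolding is_succ_def by (blast, meson not_le)
      have ja: "j' \<le> alpha" using j'(1) less.prems(2) by simp
      have ext: "rational_ext mal G (S j') (S j)"
        using it 2 less.prems(2) by (simp add: iterated_rational_ext_def)
      from less.IH[OF j' ja] show ?thesis
        using comm_length_transfer_trans[OF sub[OF ia] sub[OF ja] mono[OF j'(2) ja] _ rational_ext_comm_length_transfer[OF ext]]
          derived_transfer_trans[OF mono[OF j'(2) ja] _ rational_ext_derived_transfer[OF ext]] by blast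
    next
      case 3
      then have Sj: "S j = (\<Union>l\<in>{l. l < j}. S l)"
        using it less.prems(2) by (simp add: iterated_rational_ext_def)
      have "\<exists>l. i \<le> l \<and> l < j \<and> x \<in> comm_prods (G\<lparr>carrier := S l\<rparr>) M"
        if "x \<in> comm_prods (G\<lparr>carrier := S j\<rparr>) M" for x M
      proof -
        have "\<exists>l\<in>{l. l < j}. x \<in> comm_prods (G\<lparr>carrier := S l\<rparr>) M"
        proof (rule comm_prods_Union)
          show "{l. l < j} \<noteq> {}" using ij by auto
          show "subgroup (S l) G" if "l \<in> {l. l < j}" for l using that less.prems(2) by (intro sub) auto
          show "subgroup (\<Union>l\<in>{l. l < j}. S l) G" using sub[OF less.prems(2)] Sj by simp
          show "x \<in> comm_prods (G\<lparr>carrier := \<Union>l\<in>{l. l < j}. S l\<rparr>) M" using that Sj by simp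
          show "\<exists>n\<in>{l. l < j}. S k \<union> S l \<subseteq> S n" if "k \<in> {l. l < j}" "l \<in> {l. l < j}" for k l
          proof -
            have "max k l < j" using that by simp
            moreover from this have "max k l \<le> alpha"
              using less.prems(2) by (rule less_imp_le[OF order.strict_trans2])
            then have "S k \<subseteq> S (max k l)" "S l \<subseteq> S (max k l)"
              using mono[OF max.cobounded1] mono[OF max.cobounded2] by blast+
            ultimately show ?thesis by blast
          qed
        qed
        then obtain l where l: "l < j" "x \<in> comm_prods (G\<lparr>carrier := S l\<rparr>) M" by blast
        \<comment> \<open>Raising the stage to at least i brings it into the range of the induction
          hypothesis.\<close>
        have "max i l < j" using l ij by simp
        moreover from this have "max i l \<le> alpha"
          using less.prems(2) by (rule less_imp_le[OF order.strict_trans2])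
        moreover from this have "x \<in> comm_prods (G\<lparr>carrier := S (max i l)\<rparr>) M"
          using l by (intro comm_prods_subgroup_mono[OF _ _ _ l(2)] sub mono) auto
        ultimately show ?thesis by (intro exI[of _ "max i l"]) auto
      qed
      moreover have "comm_length_transfer G (S i) (S l)" "derived_transfer G (S i) (S l)" if "i \<le> l" "l < j" for l
        using less.IH[OF that(2,1)] that less.prems(2) by auto
      ultimately show ?thesis
        unfolding comm_length_transfer_def derived_transfer_def by meson
    qed
  qed
qed

text \<open>At a limit the element already lies in an earlier stage, but the union offers more
  commutators; \<open>iterated_transfer\<close> keeps the lower bound.\<close>

lemma iterated_positive_scl:
  fixes S :: "'i::wellorder \<Rightarrow> 'a set"
  assumes it: "iterated_rational_ext True G S alpha"
    and zero: "\<And>g. g \<in> S ord_zero \<Longrightarrow> g \<noteq> \<one> \<Longrightarrow> positive_scl (G\<lparr>carrier := S ord_zero\<rparr>) g"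
    and "j \<le> alpha" "g \<in> S j" "g \<noteq> \<one>"
  shows "positive_scl (G\<lparr>carrier := S j\<rparr>) g"
  using assms(3-5)
proof (induction j arbitrary: g rule: less_induct)
  case (less j)
  show ?case
  proof (cases rule: ordinal_cases[of j])
    case 1
    then show ?thesis using zero less.prems by simp
  next
    case (2 j')
    then have j': "j' < j" "j' \<le> alpha" using less.prems(1) by (auto simp: is_succ_def)
    have ext: "rational_ext True G (S j') (S j)"
      using it 2 less.prems(1) by (simp add: iterated_rational_ext_def)
    show ?thesis using less.IH[OF j'] less.prems by (intro rational_ext_positive_scl[OF ext]) auto
  next
    case 3
    then have "S j = (\<Union>l\<in>{l. l < j}. S l)"
      using it less.prems(1) by (simp add: iterated_rational_ext_def)
    then obtain l where l: "l < j" "g \<in> S l" using less.prems(2) by auto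
    then have la: "l \<le> alpha" using less.prems(1) by simp
    have "subgroup (S l) G" "subgroup (S j) G"
      using it la less.prems(1) by (auto simp: iterated_rational_ext_def)
    then show ?thesis
      using positive_scl_transfer iterated_transfer[OF it _ less.prems(1), of l] less.IH[OF l(1) la l(2) less.prems(3)] l
      by auto
  qed
qed

end

theorem theorem3p4:
  fixes U :: "('g, 'b) monoid_scheme" and G :: "'i::wellorder \<Rightarrow> 'g set" and alpha :: 'i
  assumes "iterated_rational_ext False U G alpha"
  shows "(\<forall>c. is_chain (G ord_zero) c \<longrightarrow>
            scl (U\<lparr>carrier := G alpha\<rparr>) c = scl (U\<lparr>carrier := G ord_zero\<rparr>) c) \<and>
         (iterated_rational_ext True U G alpha \<longrightarrow>
          (\<forall>g \<in> G ord_zero - {\<one>\<^bsub>U\<^esub>}. scl_elem (U\<lparr>carrier := G ord_zero\<rparr>) g > 0) \<longrightarrow>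
          (\<forall>g \<in> G alpha - {\<one>\<^bsub>U\<^esub>}. scl_elem (U\<lparr>carrier := G alpha\<rparr>) g > 0))"
proof -
  interpret group U using assms by (simp add: iterated_rational_ext_def)
  have zero: "ord_zero \<le> alpha" by (rule ord_zero_le)
  have sub: "subgroup (G ord_zero) U" "subgroup (G alpha) U" "G ord_zero \<subseteq> G alpha"
    using assms zero by (auto simp: iterated_rational_ext_def)
  interpret Z: group "U\<lparr>carrier := G ord_zero\<rparr>" by (rule subgroup_group[OF sub(1)])
  interpret A: group "U\<lparr>carrier := G alpha\<rparr>" by (rule subgroup_group[OF sub(2)])
  have "scl (U\<lparr>carrier := G alpha\<rparr>) c = scl (U\<lparr>carrier := G ord_zero\<rparr>) c" if "is_chain (G ord_zero) c" for c
    using scl_transfer[OF sub] iterated_transfer[OF assms zero] that by blast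
  moreover have "scl_elem (U\<lparr>carrier := G alpha\<rparr>) g > 0"
    if "iterated_rational_ext True U G alpha"
      "\<forall>g \<in> G ord_zero - {\<one>\<^bsub>U\<^esub>}. scl_elem (U\<lparr>carrier := G ord_zero\<rparr>) g > 0"
      "g \<in> G alpha - {\<one>\<^bsub>U\<^esub>}" for g
    using iterated_positive_scl[OF that(1), of alpha g] that(2,3) Z.scl_elem_pos_iff A.scl_elem_pos_iff by auto
  ultimately show ?thesis by blast
qed

end
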